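(* Let $r(t)$ be a fixed delay CIR process on $(\Omega,(\mathcal{F}_t)_{t\ge t_0},\mathbb{P})$, i.e. the unique solution of $$ \begin{cases} dr(t)=\big[a_r(\gamma_r(t)-r(t))+b_r\, r(t-\tau)\big]dt+\sigma_r\sqrt{r(t)}\,dW_r(t), & t\ge t_0,\\ r(t)=r_0(t), & t_0-\tau\le t\le t_0, \end{cases} $$ under the standing assumptions (i)--(iv) listed in the context. If $$ \int_{t_0-\tau}^{t_0}\mathbb{E}[r_0(u)]\,du<+\infty\qquad\text{and}\qquad \mathbb{E}[r_0(t_0)]<+\infty, $$ then: 1. for all $t\ge t_0$, $$\mathbb{E}\Big[\sup_{t_0\le u\le t}r(u)\Big]<\infty;$$ 2. for all $t\ge t_1\ge t_0$, $$ \mathbb{E}[r(t)]=e^{-a_r(t-t_1)}\,\mathbb{E}[r(t_1)]+\int_{t_1}^t e^{-a_r(t-u)}\big(a_r\gamma_r(u)+b_r\,\mathbb{E}[r(u-\tau)]\big)\,du . $$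
   Context: Fix $t_0\in\mathbb{R}$ and $\tau>0$. $(\Omega,\mathcal{F},\mathbb{P})$ is a complete probability space with a right-continuous filtration $\{\mathcal{F}_t\}_{t\ge t_0}$ such that $\mathcal{F}_{t_0}$ contains all $\mathbb{P}$-null sets. Standing assumptions: (i) $W_r(t)$, $t\ge t_0$, is a scalar Brownian motion (started at time $t_0$) with respect to $\{\mathcal{F}_t\}_{t\ge t_0}$, so that $\mathcal{F}_{t_0}$ is independent of the natural filtration of $W_r$; (ii) $a_r$ and $\sigma_r$ are positive constants, and $b_r$ is a nonnegative constant; (iii) the initial segment $r_0(\cdot)$ is a positive continuous random function on $[t_0-\tau,t_0]$ with $\int_{t_0-\tau}^{t_0}r_0(u)\,du<+\infty$ $\mathbb{P}$-a.s., and $r_0(t)$ is $\mathcal{F}_{t_0}$-measurable for every $t\in[t_0-\tau,t_0]$; (iv) the deterministic function $\gamma_r:[t_0,\infty)\to\mathbb{R}$ is measurable, positive, and bounded on every bounded interval. Under these assumptions the equation has a unique continuous adapted strong solution, which is nonnegative; it is called the fixed delay CIR process. *)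

theory Defs
  imports "HOL-Probability.Probability"
begin

section \<open>Filtered probability spaces\<close>

text \<open>
  Only the \<open>\<sigma>\<close>-algebras \<open>F t\<close> with \<open>t \<ge> t0\<close> matter. The library's \<^locale>\<open>filtration\<close> is indexed by
  a whole type, so it is applied to the index truncated at \<open>t0\<close>.
\<close>

locale stochastic_basis = prob_space M + complete_measure M
  for M :: "'a measure" and F :: "real \<Rightarrow> 'a measure" and t0 :: real +
  assumes filtration: "filtration (space M) (\<lambda>t. F (max t0 t))"
    and subalgebra: "\<And>t. t0 \<le> t \<Longrightarrow> subalgebra M (F t)"
    and right_continuous: "\<And>t. t0 \<le> t \<Longrightarrow> sets (F t) = (\<Inter>s\<in>{t<..}. sets (F s))"
    and null_sets_initial: "null_sets M \<subseteq> sets (F t0)"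

definition continuous_adapted ::
  "'a measure \<Rightarrow> (real \<Rightarrow> 'a measure) \<Rightarrow> real \<Rightarrow> (real \<Rightarrow> 'a \<Rightarrow> real) \<Rightarrow> bool" where
  "continuous_adapted M F t0 X \<longleftrightarrow>
     (\<forall>t\<ge>t0. X t \<in> borel_measurable (F t)) \<and>
     (AE \<omega> in M. continuous_on {t0..} (\<lambda>t. X t \<omega>))"

definition brownian_motion ::
  "'a measure \<Rightarrow> (real \<Rightarrow> 'a measure) \<Rightarrow> real \<Rightarrow> (real \<Rightarrow> 'a \<Rightarrow> real) \<Rightarrow> bool" where
  "brownian_motion M F t0 W \<longleftrightarrow>
     continuous_adapted M F t0 W \<and>
     (AE \<omega> in M. W t0 \<omega> = 0) \<and>
     (\<forall>s\<ge>t0. \<forall>t>s.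
        distributed M lborel (\<lambda>\<omega>. W t \<omega> - W s \<omega>) (normal_density 0 (sqrt (t - s))) \<and>
        prob_space.indep_set M (sets (F s))
          {(\<lambda>\<omega>. W t \<omega> - W s \<omega>) -` B \<inter> space M | B. B \<in> sets borel})"


section \<open>The Ito integral of continuous adapted processes\<close>

text \<open>
  A simple process is \<open>\<Sum>i<N. \<xi> i * indicator {p i<..p (i + 1)}\<close> with a deterministic partition
  \<open>t0 \<le> p 0 \<le> \<dots> \<le> p N\<close> and bounded \<open>F (p i)\<close>-measurable coefficients \<open>\<xi> i\<close>.
\<close>

definition simple_process_data ::
  "'a measure \<Rightarrow> (real \<Rightarrow> 'a measure) \<Rightarrow> real \<Rightarrow> nat \<Rightarrow> (nat \<Rightarrow> real) \<Rightarrow> (nat \<Rightarrow> 'a \<Rightarrow> real) \<Rightarrow> bool" where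
  "simple_process_data M F t0 N p \<xi> \<longleftrightarrow>
     t0 \<le> p 0 \<and> mono_on {..N} p \<and>
     (\<forall>i<N. \<xi> i \<in> borel_measurable (F (p i))) \<and>
     (\<exists>C. \<forall>i<N. \<forall>\<omega>\<in>space M. \<bar>\<xi> i \<omega>\<bar> \<le> C)"

definition simple_process ::
  "nat \<Rightarrow> (nat \<Rightarrow> real) \<Rightarrow> (nat \<Rightarrow> 'a \<Rightarrow> real) \<Rightarrow> real \<Rightarrow> 'a \<Rightarrow> real" where
  "simple_process N p \<xi> t \<omega> = (\<Sum>i<N. \<xi> i \<omega> * indicator {p i<..p (Suc i)} t)"

definition simple_process_integral ::
  "(real \<Rightarrow> 'a \<Rightarrow> real) \<Rightarrow> nat \<Rightarrow> (nat \<Rightarrow> real) \<Rightarrow> (nat \<Rightarrow> 'a \<Rightarrow> real) \<Rightarrow> real \<Rightarrow> 'a \<Rightarrow> real" where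
  "simple_process_integral W N p \<xi> t \<omega> =
     (\<Sum>i<N. \<xi> i \<omega> * (W (min t (p (Suc i))) \<omega> - W (min t (p i)) \<omega>))"

text \<open>
  Measurability is demanded explicitly because \<^const>\<open>measure\<close> is 0 on non-measurable sets.
\<close>

definition tendsto_zero_in_prob :: "'a measure \<Rightarrow> (nat \<Rightarrow> 'a \<Rightarrow> real) \<Rightarrow> bool" where
  "tendsto_zero_in_prob M X \<longleftrightarrow>
     (\<forall>n. X n \<in> borel_measurable M) \<and>
     (\<forall>\<epsilon>>0. (\<lambda>n. measure M {\<omega>\<in>space M. \<epsilon> < \<bar>X n \<omega>\<bar>}) \<longlonglongrightarrow> 0)"

text \<open>
  \<open>has_ito_integral M F t0 W H I\<close> states that the process \<open>I\<close> is (a version of) the Ito integral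
  \<open>I(t) = \<integral> H(s) dW(s)\<close> over \<open>[t0, t]\<close>: on every compact interval, \<open>H\<close> is approximated by simple
  processes in \<open>L\<^sup>2(ds)\<close> in probability, and \<open>I\<close> is the limit of their integrals, uniformly in time,
  in probability. The paths of \<open>H\<close> are a.s. continuous, hence a.s. locally square integrable, so the
  time integrals and suprema below are meaningful almost surely.
\<close>

definition has_ito_integral ::
  "'a measure \<Rightarrow> (real \<Rightarrow> 'a measure) \<Rightarrow> real \<Rightarrow> (real \<Rightarrow> 'a \<Rightarrow> real) \<Rightarrow>
   (real \<Rightarrow> 'a \<Rightarrow> real) \<Rightarrow> (real \<Rightarrow> 'a \<Rightarrow> real) \<Rightarrow> bool" where
  "has_ito_integral M F t0 W H I \<longleftrightarrow>
     continuous_adapted M F t0 H \<and> continuous_adapted M F t0 I \<and>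
     (\<exists>N p \<xi>.
        (\<forall>n. simple_process_data M F t0 (N n) (p n) (\<xi> n)) \<and>
        (\<forall>T\<ge>t0.
           tendsto_zero_in_prob M
             (\<lambda>n \<omega>. LINT s:{t0..T}|lborel. (simple_process (N n) (p n) (\<xi> n) s \<omega> - H s \<omega>)\<^sup>2) \<and>
           tendsto_zero_in_prob M
             (\<lambda>n \<omega>. SUP t\<in>{t0..T}. \<bar>simple_process_integral W (N n) (p n) (\<xi> n) t \<omega> - I t \<omega>\<bar>)))"


section \<open>The fixed delay CIR process\<close>

definition initial_segment ::
  "'a measure \<Rightarrow> (real \<Rightarrow> 'a measure) \<Rightarrow> real \<Rightarrow> real \<Rightarrow> (real \<Rightarrow> 'a \<Rightarrow> real) \<Rightarrow> bool" where
  "initial_segment M F t0 \<tau> r0 \<longleftrightarrow>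
     (\<forall>t\<in>{t0-\<tau>..t0}. r0 t \<in> borel_measurable (F t0)) \<and>
     (AE \<omega> in M. continuous_on {t0-\<tau>..t0} (\<lambda>t. r0 t \<omega>)) \<and>
     (AE \<omega> in M. \<forall>t\<in>{t0-\<tau>..t0}. 0 < r0 t \<omega>) \<and>
     (AE \<omega> in M. (\<integral>\<^sup>+u\<in>{t0-\<tau>..t0}. ennreal (r0 u \<omega>) \<partial>lborel) < \<infinity>)"

definition mean_level :: "real \<Rightarrow> (real \<Rightarrow> real) \<Rightarrow> bool" where
  "mean_level t0 \<gamma> \<longleftrightarrow>
     \<gamma> \<in> borel_measurable (restrict_space borel {t0..}) \<and>
     (\<forall>t\<ge>t0. 0 < \<gamma> t) \<and>
     (\<forall>T\<ge>t0. bounded (\<gamma> ` {t0..T}))"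

text \<open>
  Nonnegativity is part of being a solution: the square root in the diffusion coefficient only makes
  sense then, whereas \<^const>\<open>sqrt\<close> is total with \<open>sqrt (-x) = - sqrt x\<close>.
\<close>

definition fixed_delay_CIR ::
  "'a measure \<Rightarrow> (real \<Rightarrow> 'a measure) \<Rightarrow> real \<Rightarrow> real \<Rightarrow> (real \<Rightarrow> 'a \<Rightarrow> real) \<Rightarrow>
   real \<Rightarrow> real \<Rightarrow> real \<Rightarrow> (real \<Rightarrow> real) \<Rightarrow> (real \<Rightarrow> 'a \<Rightarrow> real) \<Rightarrow> (real \<Rightarrow> 'a \<Rightarrow> real) \<Rightarrow> bool" where
  "fixed_delay_CIR M F t0 \<tau> W a b \<sigma> \<gamma> r0 r \<longleftrightarrow>
     continuous_adapted M F t0 r \<and>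
     (AE \<omega> in M. \<forall>t\<ge>t0. 0 \<le> r t \<omega>) \<and>
     (AE \<omega> in M. \<forall>t\<in>{t0-\<tau>..t0}. r t \<omega> = r0 t \<omega>) \<and>
     (\<exists>I. has_ito_integral M F t0 W (\<lambda>t \<omega>. \<sigma> * sqrt (r t \<omega>)) I \<and>
        (AE \<omega> in M. \<forall>t\<ge>t0.
           r t \<omega> = r t0 \<omega>
             + (LINT s:{t0..t}|lborel. a * (\<gamma> s - r s \<omega>) + b * r (s - \<tau>) \<omega>)
             + I t \<omega>))"

end

theory Submission
  imports Defs
begin

text \<open>
  The mean of the process satisfies a linear delay equation as soon as the Ito integral
  \<open>I(t) = \<integral> \<sigma> * sqrt r dW\<close> is known to have mean zero, and for this it suffices that its expected
  quadratic variation \<open>\<sigma>\<^sup>2 * E (\<integral> r ds)\<close> is finite. Thus everything rests on an a priori bound for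
  \<open>E (r(t))\<close>, which must be found while \<open>I\<close> is only a limit in probability.

  The a priori bound comes from positivity. Dropping \<open>- a * r\<close> from the drift gives
  \<open>0 \<le> r(u) \<le> \<zeta> + I(u)\<close> for all \<open>u\<close> in \<open>[t0, t]\<close>, where the random variable \<open>\<zeta>\<close> collects the initial value, the
  mean level and the delayed term, and hence depends on \<open>r\<close> only up to time \<open>t - \<tau>\<close>. An Ito integral
  bounded below by \<open>- \<zeta>\<close> satisfies \<open>E (\<zeta> + I(t)) \<le> E \<zeta>\<close> (\<open>ito_integral_supermartingale\<close>). Therefore
  \<open>E (r(t)) \<le> E \<zeta>\<close>, and finiteness of the mean spreads from one delay interval to the next
  (\<open>mean_integral_finite\<close>). Once the expected variation is finite, Doob's \<open>L\<^sup>2\<close> inequality bounds the mean of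
  the supremum of \<open>I\<close> (\<open>ito_integral_maximal\<close>), and therefore that of \<open>r\<close>; also \<open>E (I(t)) = 0\<close>
  (\<open>ito_integral_martingale\<close>). Taking expectations in the equation and solving the resulting linear integral
  equation (\<open>variation_of_constants\<close>) yields the formula for \<open>E (r(t))\<close>.

  The three facts about Ito integrals are derived from the definition by simple processes by
  discrete stopping. A simple process is stopped, on a deterministic grid, just before its quadratic
  variation would exceed a level \<open>K\<close>; this truncation is predictable, so the resulting sum is a
  martingale with second moment at most \<open>K\<close>. With high probability it stays close to \<open>I\<close> until some grid time, and
  close to \<open>I\<close> throughout if the level is not reached (\<open>ito_approximation\<close>). The moments of these discrete
  martingales come from the independence of the increments of Brownian motion (\<open>Z_moments\<close>) and from a
  deterministic form of Doob's inequality (\<open>pathwise_doob\<close>).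
\<close>

section \<open>Transforms of square-integrable independent increments\<close>

lemma (in prob_space) square_integrable_imp_integrable:
  fixes f :: "'a \<Rightarrow> real"
  assumes [measurable]: "f \<in> borel_measurable M" and "integrable M (\<lambda>x. (f x)\<^sup>2)"
  shows "integrable M f"
proof (rule Bochner_Integration.integrable_bound[where f = "\<lambda>x. 1 + (f x)\<^sup>2"])
  show "integrable M (\<lambda>x. 1 + (f x)\<^sup>2)" using assms(2) by simp
  have "\<bar>y\<bar> \<le> 1 + y\<^sup>2" for y :: real
    using zero_le_power2[of "\<bar>y\<bar> - 1"] by (simp add: power2_diff)
  then show "AE x in M. norm (f x) \<le> norm (1 + (f x)\<^sup>2)"
    by (smt (verit) AE_I2 real_norm_def)
qed measurable

lemma square_integrable_mult:
  fixes f g :: "'a \<Rightarrow> real"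
  assumes [measurable]: "f \<in> borel_measurable M" "g \<in> borel_measurable M"
    and "integrable M (\<lambda>x. (f x)\<^sup>2)" "integrable M (\<lambda>x. (g x)\<^sup>2)"
  shows "integrable M (\<lambda>x. f x * g x)"
proof (rule Bochner_Integration.integrable_bound[where f = "\<lambda>x. (f x)\<^sup>2 + (g x)\<^sup>2"])
  show "integrable M (\<lambda>x. (f x)\<^sup>2 + (g x)\<^sup>2)" using assms(3,4) by simp
  have "\<bar>y * z\<bar> \<le> y\<^sup>2 + z\<^sup>2" for y z :: real
  proof -
    have "0 \<le> (\<bar>y\<bar> - \<bar>z\<bar>)\<^sup>2" by simp
    then have "2 * \<bar>y * z\<bar> \<le> y\<^sup>2 + z\<^sup>2" by (simp add: power2_diff abs_mult)
    then show ?thesis by (smt (verit))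
  qed
  then show "AE x in M. norm (f x * g x) \<le> norm ((f x)\<^sup>2 + (g x)\<^sup>2)"
    by (smt (verit) AE_I2 real_norm_def)
qed measurable

lemma square_integrable_add:
  fixes f g :: "'a \<Rightarrow> real"
  assumes [measurable]: "f \<in> borel_measurable M" "g \<in> borel_measurable M"
    and "integrable M (\<lambda>x. (f x)\<^sup>2)" "integrable M (\<lambda>x. (g x)\<^sup>2)"
  shows "integrable M (\<lambda>x. (f x + g x)\<^sup>2)"
  using assms(3,4) square_integrable_mult[OF assms]
  by (simp add: power2_sum mult.assoc)

primrec running_max :: "(nat \<Rightarrow> real) \<Rightarrow> nat \<Rightarrow> real" where
  "running_max f 0 = f 0"
| "running_max f (Suc n) = max (running_max f n) (f (Suc n))"

lemma le_running_max: "i \<le> n \<Longrightarrow> f i \<le> running_max f n"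
  by (induction n) (auto simp: le_Suc_eq max_def)

text \<open>
  Summation by parts moves the running maximum out of the sum, and the maximum only moves when it
  equals the current value. Since the sum has mean zero for a martingale \<open>f\<close>, Doob's maximal
  inequality in \<open>L\<^sup>2\<close> follows from this deterministic inequality by taking expectations.
\<close>

lemma pathwise_doob:
  assumes "f 0 = 0"
  shows "(running_max f n)\<^sup>2 \<le> 4 * (f n)\<^sup>2 - 4 * (\<Sum>k<n. running_max f k * (f (Suc k) - f k))"
proof -
  have *: "(running_max f n)\<^sup>2 / 2
      \<le> running_max f n * f n - (\<Sum>k<n. running_max f k * (f (Suc k) - f k))"
  proof (induction n)
    case 0
    show ?case using assms by simp
  next
    case (Suc n)
    let ?x = "running_max f (Suc n)" and ?y = "running_max f n"
    have "(?x\<^sup>2 - ?y\<^sup>2) / 2 \<le> (?x - ?y) * f (Suc n)"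
    proof (cases "f (Suc n) \<le> ?y")
      case True
      then show ?thesis by (simp add: max_def)
    next
      case False
      then have x: "?x = f (Suc n)" by simp
      have "(x\<^sup>2 - y\<^sup>2) / 2 \<le> (x - y) * x" for x y :: real
        using zero_le_power2[of "x - y"] by (simp add: power2_eq_square field_simps)
      from this[of ?x ?y] show ?thesis unfolding x[symmetric] .
    qed
    with Suc show ?case by (simp add: algebra_simps add_divide_distrib diff_divide_distrib)
  qed
  have "0 \<le> (running_max f n / 2 - f n)\<^sup>2" by simp
  with * show ?thesis by (simp add: power2_eq_square field_simps)
qed

locale independent_increments = prob_space M
  for M :: "'a measure" +
  fixes m :: nat and G :: "nat \<Rightarrow> 'a measure" and X :: "nat \<Rightarrow> 'a \<Rightarrow> real" and v :: "nat \<Rightarrow> real"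
  assumes subalgebra_G: "j \<le> m \<Longrightarrow> subalgebra M (G j)"
    and sets_G_mono: "i \<le> j \<Longrightarrow> j \<le> m \<Longrightarrow> sets (G i) \<subseteq> sets (G j)"
    and X_measurable: "j < m \<Longrightarrow> X j \<in> borel_measurable (G (Suc j))"
    and X_indep: "j < m \<Longrightarrow> indep_set (sets (G j)) {X j -` B \<inter> space M | B. B \<in> sets borel}"
    and X_square_integrable: "j < m \<Longrightarrow> integrable M (\<lambda>\<omega>. (X j \<omega>)\<^sup>2)"
    and X_mean: "j < m \<Longrightarrow> expectation (X j) = 0"
    and X_variance: "j < m \<Longrightarrow> expectation (\<lambda>\<omega>. (X j \<omega>)\<^sup>2) = v j"
begin

lemma measurable_G_mono:
  assumes "f \<in> borel_measurable (G i)" "i \<le> j" "j \<le> m"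
  shows "f \<in> borel_measurable (G j)"
proof -
  have "subalgebra (G j) (G i)"
    using sets_G_mono[OF assms(2,3)] subalgebra_G[of i] subalgebra_G[of j] assms(2,3)
    unfolding subalgebra_def by auto
  then show ?thesis using assms(1) by (rule measurable_from_subalg)
qed

lemma measurable_G_M: "f \<in> borel_measurable (G j) \<Longrightarrow> j \<le> m \<Longrightarrow> f \<in> borel_measurable M"
  using subalgebra_G measurable_from_subalg by blast

lemma indep_var_X:
  assumes j: "j < m" and Y: "Y \<in> borel_measurable (G j)"
  shows "indep_var borel Y borel (X j)"
proof -
  have XM: "X j \<in> borel_measurable M"
    using X_measurable[OF j] measurable_G_M[of _ "Suc j"] j by simp
  have YM: "Y \<in> borel_measurable M" using measurable_G_M[OF Y] j by simp
  have sp: "space (G j) = space M" using subalgebra_G[of j] j by (simp add: subalgebra_def)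
  have "indep_set {Y -` A \<inter> space M | A. A \<in> sets borel} {X j -` A \<inter> space M | A. A \<in> sets borel}"
  proof (rule indep_setI)
    show "{Y -` A \<inter> space M | A. A \<in> sets borel} \<subseteq> events"
      "{X j -` A \<inter> space M | A. A \<in> sets borel} \<subseteq> events"
      using XM YM by (auto dest: measurable_sets)
    fix a b assume a: "a \<in> {Y -` A \<inter> space M | A. A \<in> sets borel}"
      and b: "b \<in> {X j -` A \<inter> space M | A. A \<in> sets borel}"
    have "a \<in> sets (G j)" using a Y sp by (auto dest: measurable_sets)
    then show "prob (a \<inter> b) = prob a * prob b"
      using indep_setD[OF X_indep[OF j]] b by blast
  qed
  moreover have "Int_stable {f -` A \<inter> space M | A. A \<in> sets borel}" for f :: "'a \<Rightarrow> real"
    unfolding Int_stable_def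
  proof safe
    fix A B :: "real set" assume "A \<in> sets borel" "B \<in> sets borel"
    then show "\<exists>C. (f -` A \<inter> space M) \<inter> (f -` B \<inter> space M) = f -` C \<inter> space M \<and> C \<in> sets borel"
      by (intro exI[of _ "A \<inter> B"]) auto
  qed
  ultimately show ?thesis
    unfolding indep_var_eq using XM YM by (intro conjI indep_set_sigma_sets)
qed

lemma mult_X:
  assumes j: "j < m" and Y: "Y \<in> borel_measurable (G j)" and "integrable M Y"
  shows "integrable M (\<lambda>\<omega>. Y \<omega> * X j \<omega>)"
    and "expectation (\<lambda>\<omega>. Y \<omega> * X j \<omega>) = 0"
proof -
  have XM: "X j \<in> borel_measurable M"
    using X_measurable[OF j] measurable_G_M[of _ "Suc j"] j by simp
  have X: "integrable M (X j)"
    using square_integrable_imp_integrable[OF XM] X_square_integrable[OF j] .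
  show "integrable M (\<lambda>\<omega>. Y \<omega> * X j \<omega>)"
    by (rule indep_var_integrable[OF indep_var_X[OF j Y] assms(3) X])
  show "expectation (\<lambda>\<omega>. Y \<omega> * X j \<omega>) = 0"
    using indep_var_lebesgue_integral[OF indep_var_X[OF j Y] assms(3) X] X_mean[OF j] by simp
qed

lemma mult_X_square:
  assumes j: "j < m" and Y: "Y \<in> borel_measurable (G j)" and "integrable M (\<lambda>\<omega>. (Y \<omega>)\<^sup>2)"
  shows "integrable M (\<lambda>\<omega>. (Y \<omega> * X j \<omega>)\<^sup>2)"
    and "expectation (\<lambda>\<omega>. (Y \<omega> * X j \<omega>)\<^sup>2) = expectation (\<lambda>\<omega>. (Y \<omega>)\<^sup>2 * v j)"
proof -
  have *: "indep_var borel (\<lambda>\<omega>. (Y \<omega>)\<^sup>2) borel (\<lambda>\<omega>. (X j \<omega>)\<^sup>2)"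
    using indep_var_compose[OF indep_var_X[OF j Y], of "\<lambda>x. x\<^sup>2" borel "\<lambda>x. x\<^sup>2" borel]
    by (simp add: comp_def)
  show "integrable M (\<lambda>\<omega>. (Y \<omega> * X j \<omega>)\<^sup>2)"
    unfolding power_mult_distrib
    by (rule indep_var_integrable[OF * assms(3) X_square_integrable[OF j]])
  show "expectation (\<lambda>\<omega>. (Y \<omega> * X j \<omega>)\<^sup>2) = expectation (\<lambda>\<omega>. (Y \<omega>)\<^sup>2 * v j)"
    unfolding power_mult_distrib
    using indep_var_lebesgue_integral[OF * assms(3) X_square_integrable[OF j]] X_variance[OF j]
    by simp
qed

end

definition transform :: "(nat \<Rightarrow> 'a \<Rightarrow> real) \<Rightarrow> (nat \<Rightarrow> 'a \<Rightarrow> real) \<Rightarrow> nat \<Rightarrow> 'a \<Rightarrow> real" where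
  "transform e X j \<omega> = (\<Sum>l<j. e l \<omega> * X l \<omega>)"

locale predictable_transform = independent_increments +
  fixes e :: "nat \<Rightarrow> 'a \<Rightarrow> real" and C :: real
  assumes e_measurable: "j < m \<Longrightarrow> e j \<in> borel_measurable (G j)"
    and e_bounded: "j < m \<Longrightarrow> \<omega> \<in> space M \<Longrightarrow> \<bar>e j \<omega>\<bar> \<le> C"
begin

abbreviation "Z \<equiv> transform e X"

lemma Z_measurable: "j \<le> m \<Longrightarrow> Z j \<in> borel_measurable (G j)"
proof -
  assume j: "j \<le> m"
  have "(\<lambda>\<omega>. \<Sum>l<j. e l \<omega> * X l \<omega>) \<in> borel_measurable (G j)"
  proof (intro borel_measurable_sum borel_measurable_times)
    fix l assume "l \<in> {..<j}"
    then show "e l \<in> borel_measurable (G j)" "X l \<in> borel_measurable (G j)"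
      using e_measurable[of l] X_measurable[of l] j
      by (auto elim!: measurable_G_mono)
  qed
  moreover have "Z j = (\<lambda>\<omega>. \<Sum>l<j. e l \<omega> * X l \<omega>)" by (rule ext) (simp add: transform_def)
  ultimately show ?thesis by simp
qed

lemma Z_measurable_M: "j \<le> m \<Longrightarrow> Z j \<in> borel_measurable M"
  using Z_measurable measurable_G_M by blast

lemma integrable_e_mult:
  assumes j: "j < m" and "Y \<in> borel_measurable (G j)" "integrable M Y"
  shows "integrable M (\<lambda>\<omega>. Y \<omega> * e j \<omega>)"
proof (rule Bochner_Integration.integrable_bound[where f = "\<lambda>\<omega>. C * Y \<omega>"])
  show "integrable M (\<lambda>\<omega>. C * Y \<omega>)" using assms(3) by simp
  show "(\<lambda>\<omega>. Y \<omega> * e j \<omega>) \<in> borel_measurable M"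
    using measurable_G_M[OF assms(2)] measurable_G_M[OF e_measurable[OF j]] j
    by (intro borel_measurable_times) linarith+
  show "AE \<omega> in M. norm (Y \<omega> * e j \<omega>) \<le> norm (C * Y \<omega>)"
  proof (rule AE_I2)
    fix \<omega> assume "\<omega> \<in> space M"
    then have "\<bar>e j \<omega>\<bar> \<le> \<bar>C\<bar>" using e_bounded[OF j] by force
    then show "norm (Y \<omega> * e j \<omega>) \<le> norm (C * Y \<omega>)"
      by (simp add: abs_mult mult.commute[of "\<bar>Y \<omega>\<bar>"] mult_right_mono)
  qed
qed

lemma integrable_e_square: "j < m \<Longrightarrow> integrable M (\<lambda>\<omega>. (e j \<omega>)\<^sup>2)"
proof (rule Bochner_Integration.integrable_bound[where f = "\<lambda>\<omega>. C\<^sup>2"])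
  assume j: "j < m"
  show "integrable M (\<lambda>\<omega>. C\<^sup>2)" by simp
  show "(\<lambda>\<omega>. (e j \<omega>)\<^sup>2) \<in> borel_measurable M"
    using measurable_G_M[OF e_measurable[OF j]] j by (intro borel_measurable_power) linarith
  show "AE \<omega> in M. norm ((e j \<omega>)\<^sup>2) \<le> norm (C\<^sup>2)"
  proof (rule AE_I2)
    fix \<omega> assume "\<omega> \<in> space M"
    then have "\<bar>e j \<omega>\<bar> \<le> \<bar>C\<bar>" using e_bounded[OF j] by force
    then show "norm ((e j \<omega>)\<^sup>2) \<le> norm (C\<^sup>2)" by (simp add: abs_le_square_iff)
  qed
qed

text \<open>
  An increment is orthogonal to everything known before it, so the second moments of the terms add up.
\<close>

lemma Z_moments:
  assumes "j \<le> m"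
  shows "integrable M (\<lambda>\<omega>. (Z j \<omega>)\<^sup>2)" "expectation (Z j) = 0"
    "expectation (\<lambda>\<omega>. (Z j \<omega>)\<^sup>2) = expectation (\<lambda>\<omega>. \<Sum>l<j. (e l \<omega>)\<^sup>2 * v l)"
proof -
  have "integrable M (\<lambda>\<omega>. (Z j \<omega>)\<^sup>2) \<and> expectation (Z j) = 0 \<and>
    expectation (\<lambda>\<omega>. (Z j \<omega>)\<^sup>2) = expectation (\<lambda>\<omega>. \<Sum>l<j. (e l \<omega>)\<^sup>2 * v l)"
    using assms
  proof (induction j)
    case 0
    then show ?case by (simp add: transform_def)
  next
    case (Suc j)
    then have j: "j < m" and IH: "integrable M (\<lambda>\<omega>. (Z j \<omega>)\<^sup>2)" "expectation (Z j) = 0"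
      "expectation (\<lambda>\<omega>. (Z j \<omega>)\<^sup>2) = expectation (\<lambda>\<omega>. \<Sum>l<j. (e l \<omega>)\<^sup>2 * v l)" by auto
    have eM: "e j \<in> borel_measurable M" and XM: "X j \<in> borel_measurable M"
      and ZM: "Z j \<in> borel_measurable M"
      using e_measurable[OF j] X_measurable[OF j] j measurable_G_M[of _ j] measurable_G_M[of _ "Suc j"]
        Z_measurable_M by auto
    have step: "Z (Suc j) \<omega> = Z j \<omega> + e j \<omega> * X j \<omega>" for \<omega>
      by (simp add: transform_def)
    have Zi: "integrable M (Z j)" by (rule square_integrable_imp_integrable[OF ZM IH(1)])
    have ei: "integrable M (e j)"
      by (rule square_integrable_imp_integrable[OF eM integrable_e_square[OF j]])
    note d2 = mult_X_square[OF j e_measurable[OF j] integrable_e_square[OF j]]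
    note d1 = mult_X[OF j e_measurable[OF j] ei]
    have Zm: "Z j \<in> borel_measurable (G j)" using Z_measurable j by simp
    have Ze: "(\<lambda>\<omega>. Z j \<omega> * e j \<omega>) \<in> borel_measurable (G j)"
      using Zm e_measurable[OF j] by (rule borel_measurable_times)
    note c = mult_X[OF j Ze integrable_e_mult[OF j Zm Zi]]
    have sq: "(Z (Suc j) \<omega>)\<^sup>2 = (Z j \<omega>)\<^sup>2 + (e j \<omega> * X j \<omega>)\<^sup>2 + 2 * (Z j \<omega> * e j \<omega> * X j \<omega>)" for \<omega>
      unfolding step by (simp add: power2_sum)
    have "integrable M (\<lambda>\<omega>. (Z (Suc j) \<omega>)\<^sup>2)"
      unfolding sq using IH(1) d2(1) c(1) by simp
    moreover have "expectation (Z (Suc j)) = 0"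
      unfolding step[abs_def] using Zi d1 IH(2) by simp
    moreover have "expectation (\<lambda>\<omega>. (Z (Suc j) \<omega>)\<^sup>2)
        = expectation (\<lambda>\<omega>. (Z j \<omega>)\<^sup>2) + expectation (\<lambda>\<omega>. (e j \<omega>)\<^sup>2 * v j)"
      unfolding sq using IH(1) d2 c by simp
    moreover have "expectation (\<lambda>\<omega>. \<Sum>l<Suc j. (e l \<omega>)\<^sup>2 * v l)
        = expectation (\<lambda>\<omega>. \<Sum>l<j. (e l \<omega>)\<^sup>2 * v l) + expectation (\<lambda>\<omega>. (e j \<omega>)\<^sup>2 * v j)"
      unfolding sum.lessThan_Suc
      using integrable_e_square j by (intro Bochner_Integration.integral_add) auto
    ultimately show ?case using IH(3) by simp
  qed
  then show "integrable M (\<lambda>\<omega>. (Z j \<omega>)\<^sup>2)" "expectation (Z j) = 0"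
    "expectation (\<lambda>\<omega>. (Z j \<omega>)\<^sup>2) = expectation (\<lambda>\<omega>. \<Sum>l<j. (e l \<omega>)\<^sup>2 * v l)" by auto
qed

lemma running_max_measurable:
  "j \<le> m \<Longrightarrow> (\<lambda>\<omega>. running_max (\<lambda>i. Z i \<omega>) j) \<in> borel_measurable (G j)"
proof (induction j)
  case 0
  then show ?case using Z_measurable[of 0] by simp
next
  case (Suc j)
  then have "(\<lambda>\<omega>. running_max (\<lambda>i. Z i \<omega>) j) \<in> borel_measurable (G (Suc j))"
    by (auto intro: measurable_G_mono)
  then show ?case using Z_measurable[OF Suc.prems] by simp
qed

lemma running_max_square_integrable:
  "j \<le> m \<Longrightarrow> integrable M (\<lambda>\<omega>. (running_max (\<lambda>i. Z i \<omega>) j)\<^sup>2)"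
proof (induction j)
  case 0
  then show ?case using Z_moments(1)[of 0] by simp
next
  case (Suc j)
  show ?case
  proof (rule Bochner_Integration.integrable_bound)
    show "integrable M (\<lambda>\<omega>. (running_max (\<lambda>i. Z i \<omega>) j)\<^sup>2 + (Z (Suc j) \<omega>)\<^sup>2)"
      using Suc Z_moments(1)[of "Suc j"] by auto
    show "(\<lambda>\<omega>. (running_max (\<lambda>i. Z i \<omega>) (Suc j))\<^sup>2) \<in> borel_measurable M"
      using running_max_measurable[of "Suc j"] Suc.prems measurable_G_M
      by (intro borel_measurable_power) auto
    show "AE \<omega> in M. norm ((running_max (\<lambda>i. Z i \<omega>) (Suc j))\<^sup>2)
        \<le> norm ((running_max (\<lambda>i. Z i \<omega>) j)\<^sup>2 + (Z (Suc j) \<omega>)\<^sup>2)"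
      by (rule AE_I2) (simp add: max_def)
  qed
qed

lemma doob_L2:
  assumes j: "j \<le> m"
  shows "expectation (\<lambda>\<omega>. (running_max (\<lambda>i. Z i \<omega>) j)\<^sup>2) \<le> 4 * expectation (\<lambda>\<omega>. (Z j \<omega>)\<^sup>2)"
proof -
  let ?R = "\<lambda>k \<omega>. running_max (\<lambda>i. Z i \<omega>) k"
  have k: "integrable M (\<lambda>\<omega>. ?R k \<omega> * (Z (Suc k) \<omega> - Z k \<omega>)) \<and>
      expectation (\<lambda>\<omega>. ?R k \<omega> * (Z (Suc k) \<omega> - Z k \<omega>)) = 0" if "k < j" for k
  proof -
    have km: "k < m" using that j by simp
    have Rm: "?R k \<in> borel_measurable (G k)" using running_max_measurable km by simp
    have Ri: "integrable M (?R k)"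
    proof (rule square_integrable_imp_integrable)
      show "?R k \<in> borel_measurable M" using measurable_G_M[OF Rm] km by linarith
      show "integrable M (\<lambda>\<omega>. (?R k \<omega>)\<^sup>2)"
        using running_max_square_integrable[of k] km by linarith
    qed
    have "(\<lambda>\<omega>. ?R k \<omega> * e k \<omega>) \<in> borel_measurable (G k)"
      using Rm e_measurable[OF km] by (rule borel_measurable_times)
    from mult_X[OF km this integrable_e_mult[OF km Rm Ri]]
    show ?thesis by (simp add: transform_def mult.assoc)
  qed
  have "expectation (\<lambda>\<omega>. (?R j \<omega>)\<^sup>2)
      \<le> expectation (\<lambda>\<omega>. 4 * (Z j \<omega>)\<^sup>2 - 4 * (\<Sum>k<j. ?R k \<omega> * (Z (Suc k) \<omega> - Z k \<omega>)))"
  proof (rule integral_mono)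
    show "integrable M (\<lambda>\<omega>. (?R j \<omega>)\<^sup>2)" by (rule running_max_square_integrable[OF j])
    show "integrable M (\<lambda>\<omega>. 4 * (Z j \<omega>)\<^sup>2 - 4 * (\<Sum>k<j. ?R k \<omega> * (Z (Suc k) \<omega> - Z k \<omega>)))"
      using Z_moments(1)[OF j] k
      by (intro Bochner_Integration.integrable_diff integrable_mult_right
          Bochner_Integration.integrable_sum) auto
    show "(?R j \<omega>)\<^sup>2 \<le> 4 * (Z j \<omega>)\<^sup>2 - 4 * (\<Sum>k<j. ?R k \<omega> * (Z (Suc k) \<omega> - Z k \<omega>))" for \<omega>
      by (rule pathwise_doob) (simp add: transform_def)
  qed
  also have "\<dots> = 4 * expectation (\<lambda>\<omega>. (Z j \<omega>)\<^sup>2)"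
  proof -
    have "integrable M (\<lambda>\<omega>. \<Sum>k<j. ?R k \<omega> * (Z (Suc k) \<omega> - Z k \<omega>))"
      "expectation (\<lambda>\<omega>. \<Sum>k<j. ?R k \<omega> * (Z (Suc k) \<omega> - Z k \<omega>)) = 0"
      using k by (auto simp: Bochner_Integration.integral_sum)
    then show ?thesis using Z_moments(1)[OF j] by simp
  qed
  finally show ?thesis .
qed

end

text \<open>
  A uniform bound for a nonnegative function on events of probability tending to 1 is a bound
  everywhere. This is how bounds on approximating martingales, which are only close to the Ito
  integral on such events, are transferred to the integral itself.
\<close>

lemma (in prob_space) nn_integral_le_of_large_events:
  assumes [measurable]: "f \<in> borel_measurable M"
    and *: "\<And>e. 0 < e \<Longrightarrow>
      \<exists>B\<in>events. prob (space M - B) \<le> e \<and> (\<integral>\<^sup>+\<omega>. f \<omega> * indicator B \<omega> \<partial>M) \<le> c + ennreal e"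
  shows "(\<integral>\<^sup>+\<omega>. f \<omega> \<partial>M) \<le> c"
proof -
  have L: "(\<integral>\<^sup>+\<omega>. inf (f \<omega>) (of_nat L) \<partial>M) \<le> c" for L
  proof (rule ennreal_le_epsilon)
    fix e :: real assume e: "0 < e"
    define d where "d = e / (1 + real L)"
    have "d + real L * d = d * (1 + real L)" by (simp add: algebra_simps)
    also have "\<dots> = e" by (simp add: d_def add_nonneg_eq_0_iff)
    finally have d: "0 < d" "d + real L * d = e" using e by (auto simp: d_def)
    obtain B where B[measurable]: "B \<in> events" and PB: "prob (space M - B) \<le> d"
      and IB: "(\<integral>\<^sup>+\<omega>. f \<omega> * indicator B \<omega> \<partial>M) \<le> c + ennreal d" using *[OF d(1)] by blast
    have "(\<integral>\<^sup>+\<omega>. inf (f \<omega>) (of_nat L) \<partial>M)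
        \<le> (\<integral>\<^sup>+\<omega>. f \<omega> * indicator B \<omega> + of_nat L * indicator (space M - B) \<omega> \<partial>M)"
      by (intro nn_integral_mono) (auto simp: indicator_def)
    also have "\<dots> = (\<integral>\<^sup>+\<omega>. f \<omega> * indicator B \<omega> \<partial>M) + of_nat L * ennreal (prob (space M - B))"
      by (simp add: nn_integral_add nn_integral_cmult_indicator emeasure_eq_measure)
    also have "\<dots> \<le> (c + ennreal d) + of_nat L * ennreal d"
      using PB IB by (intro add_mono mult_left_mono ennreal_leI) auto
    also have "\<dots> = c + ennreal e"
      using d by (simp add: add.assoc ennreal_of_nat_eq_real_of_nat flip: ennreal_mult ennreal_plus)
    finally show "(\<integral>\<^sup>+\<omega>. inf (f \<omega>) (of_nat L) \<partial>M) \<le> c + ennreal e" .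
  qed
  have "f \<omega> = (SUP L. inf (f \<omega>) (of_nat L))" for \<omega>
    by (simp flip: inf_SUP add: ennreal_SUP_of_nat_eq_top)
  then have "(\<integral>\<^sup>+\<omega>. f \<omega> \<partial>M) = (\<integral>\<^sup>+\<omega>. (SUP L. inf (f \<omega>) (of_nat L)) \<partial>M)" by simp
  also have "\<dots> = (SUP L. \<integral>\<^sup>+\<omega>. inf (f \<omega>) (of_nat L) \<partial>M)"
    by (intro nn_integral_monotone_convergence_SUP)
      (auto simp: incseq_def le_fun_def intro!: le_infI2)
  also have "\<dots> \<le> c" using L by (intro SUP_least)
  finally show ?thesis .
qed

text \<open>
  Stopping a transform as soon as its quadratic variation is about to exceed \<open>K\<close>. The partial sum
  includes the current term, which is known in advance because both the coefficient and the variance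
  of the next increment are; hence the bound \<open>K\<close> is never overshot and the coefficients stay predictable.
\<close>

definition truncate :: "real \<Rightarrow> (nat \<Rightarrow> real) \<Rightarrow> (nat \<Rightarrow> 'a \<Rightarrow> real) \<Rightarrow> nat \<Rightarrow> 'a \<Rightarrow> real" where
  "truncate K v \<eta> j \<omega> = (if (\<Sum>l\<le>j. (\<eta> l \<omega>)\<^sup>2 * v l) \<le> K then \<eta> j \<omega> else 0)"

lemma truncate_variation:
  assumes v: "\<And>l. l < j \<Longrightarrow> 0 \<le> v l" and K: "0 \<le> K"
  shows "(\<Sum>l<j. (truncate K v \<eta> l \<omega>)\<^sup>2 * v l) \<le> K"
    and "(\<Sum>l<j. (truncate K v \<eta> l \<omega>)\<^sup>2 * v l) \<le> (\<Sum>l<j. (\<eta> l \<omega>)\<^sup>2 * v l)"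
proof -
  show le: "(\<Sum>l<j. (truncate K v \<eta> l \<omega>)\<^sup>2 * v l) \<le> (\<Sum>l<j. (\<eta> l \<omega>)\<^sup>2 * v l)"
    using v by (intro sum_mono mult_right_mono) (auto simp: truncate_def)
  show "(\<Sum>l<j. (truncate K v \<eta> l \<omega>)\<^sup>2 * v l) \<le> K"
    using v
  proof (induction j)
    case 0
    then show ?case using K by simp
  next
    case (Suc j)
    show ?case
    proof (cases "(\<Sum>l\<le>j. (\<eta> l \<omega>)\<^sup>2 * v l) \<le> K")
      case True
      have "(\<Sum>l<Suc j. (truncate K v \<eta> l \<omega>)\<^sup>2 * v l) \<le> (\<Sum>l<Suc j. (\<eta> l \<omega>)\<^sup>2 * v l)"
        using Suc.prems by (intro sum_mono mult_right_mono) (auto simp: truncate_def)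
      then show ?thesis using True by (simp add: lessThan_Suc_atMost)
    next
      case False
      then have "truncate K v \<eta> j \<omega> = 0" by (simp add: truncate_def)
      then show ?thesis using Suc by simp
    qed
  qed
qed

lemma transform_truncate:
  assumes v: "\<And>l. l < m \<Longrightarrow> 0 \<le> v l" and j: "j \<le> m"
  shows "\<exists>k\<le>j. transform (truncate K v \<eta>) X j \<omega> = transform \<eta> X k \<omega>"
    and "(\<Sum>l<m. (\<eta> l \<omega>)\<^sup>2 * v l) \<le> K \<Longrightarrow> transform (truncate K v \<eta>) X j \<omega> = transform \<eta> X j \<omega>"
proof -
  have mono: "(\<Sum>l\<le>i. (\<eta> l \<omega>)\<^sup>2 * v l) \<le> (\<Sum>l\<le>k. (\<eta> l \<omega>)\<^sup>2 * v l)" if "i \<le> k" "k < m" for i k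
    using v that by (intro sum_mono2) auto
  have eq: "transform (truncate K v \<eta>) X j \<omega> = transform \<eta> X j \<omega>"
    if "\<And>l. l < j \<Longrightarrow> (\<Sum>l\<le>l. (\<eta> l \<omega>)\<^sup>2 * v l) \<le> K" for j
    using that by (auto simp: transform_def truncate_def intro!: sum.cong)
  show "transform (truncate K v \<eta>) X j \<omega> = transform \<eta> X j \<omega>"
    if "(\<Sum>l<m. (\<eta> l \<omega>)\<^sup>2 * v l) \<le> K"
  proof (rule eq)
    fix l assume "l < j"
    then have "(\<Sum>l\<le>l. (\<eta> l \<omega>)\<^sup>2 * v l) \<le> (\<Sum>l<m. (\<eta> l \<omega>)\<^sup>2 * v l)"
      using v j by (intro sum_mono2) auto
    then show "(\<Sum>l\<le>l. (\<eta> l \<omega>)\<^sup>2 * v l) \<le> K" using that by simp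
  qed
  show "\<exists>k\<le>j. transform (truncate K v \<eta>) X j \<omega> = transform \<eta> X k \<omega>"
    using j
  proof (induction j)
    case 0
    then show ?case by (auto simp: transform_def)
  next
    case (Suc j)
    show ?case
    proof (cases "(\<Sum>l\<le>j. (\<eta> l \<omega>)\<^sup>2 * v l) \<le> K")
      case True
      have "transform (truncate K v \<eta>) X (Suc j) \<omega> = transform \<eta> X (Suc j) \<omega>"
      proof (rule eq)
        fix l assume "l < Suc j"
        then show "(\<Sum>l\<le>l. (\<eta> l \<omega>)\<^sup>2 * v l) \<le> K" using mono[of l j] True Suc.prems by simp
      qed
      then show ?thesis by blast
    next
      case False
      then have "transform (truncate K v \<eta>) X (Suc j) \<omega> = transform (truncate K v \<eta>) X j \<omega>"
        by (simp add: transform_def truncate_def)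
      then show ?thesis using Suc by (metis Suc_leD le_Suc_eq)
    qed
  qed
qed

section \<open>Simple processes on a refined grid\<close>

text \<open>
  Integrals have to be evaluated at prescribed times, whereas a simple process comes with its own
  partition; enumerating both sets of points together gives one grid that serves both.
\<close>

lemma increasing_enumeration:
  fixes t0 T :: real
  assumes "t0 \<le> T" and "finite D" "D \<subseteq> {t0..T}"
  shows "\<exists>(q :: nat \<Rightarrow> real) m. q 0 = t0 \<and> q m = T \<and> strict_mono_on {..m} q \<and> D \<subseteq> q ` {..m}"
proof -
  let ?A = "insert t0 (insert T D)"
  let ?xs = "sorted_list_of_set ?A"
  have fin: "finite ?A" using assms by simp
  have set: "set ?xs = ?A" using fin by (rule set_sorted_list_of_set)
  have ne: "?xs \<noteq> []" using set by (metis insert_not_empty list.set(1))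
  have st: "sorted_wrt (<) ?xs" by (rule strict_sorted_list_of_set)
  define m where "m = length ?xs - 1"
  have "0 < length ?xs" using ne by (simp only: length_greater_0_conv not_False_eq_True)
  then have m: "length ?xs = Suc m" unfolding m_def by linarith
  have smono: "strict_mono_on {..m} ((!) ?xs)"
    using st m by (auto simp: strict_mono_on_def sorted_wrt_iff_nth_less)
  have img: "(!) ?xs ` {..m} = ?A"
  proof -
    have "(!) ys ` {..<length ys} = set ys" for ys :: "real list" by (auto simp: set_conv_nth)
    from this[of ?xs] show ?thesis using set m by (simp only: lessThan_Suc_atMost)
  qed
  have lo: "t0 \<le> ?xs ! i" "?xs ! i \<le> T" if "i \<le> m" for i
  proof -
    have "?xs ! i \<in> ?A" using img that by blast
    then show "t0 \<le> ?xs ! i" "?xs ! i \<le> T" using assms by auto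
  qed
  have le: "?xs ! i \<le> ?xs ! j" if "i \<le> j" "j \<le> m" for i j
    using strict_mono_onD[OF smono, of i j] that by (cases "i = j") auto
  obtain i where "i \<le> m" "?xs ! i = t0" using img by (metis atMost_iff imageE insertI1)
  then have "?xs ! 0 = t0" using le[of 0 i] lo(1)[of 0] by auto
  moreover obtain i where "i \<le> m" "?xs ! i = T" using img by (metis atMost_iff imageE insertI1 insertI2)
  then have "?xs ! m = T" using le[of i m] lo(2)[of m] by auto
  ultimately show ?thesis using smono img by blast
qed

lemma simple_process_left_constant:
  assumes "\<And>i. i \<le> N \<Longrightarrow> p i \<notin> {u<..<w}" and "u < s" "s \<le> w"
  shows "simple_process N p \<xi> s \<omega> = simple_process N p \<xi> w \<omega>"
  unfolding simple_process_def
proof (rule sum.cong)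
  fix i assume "i \<in> {..<N}"
  then have "s \<in> {p i<..p (Suc i)} \<longleftrightarrow> w \<in> {p i<..p (Suc i)}"
    using assms(1)[of i] assms(1)[of "Suc i"] assms(2,3) by auto
  then show "\<xi> i \<omega> * indicator {p i<..p (Suc i)} s = \<xi> i \<omega> * indicator {p i<..p (Suc i)} w"
    by (simp add: indicator_def)
qed simp

lemma simple_process_integral_increment:
  assumes p: "mono_on {..N} p"
    and "\<And>i. i \<le> N \<Longrightarrow> p i \<notin> {u<..<w}" and "u \<le> w"
  shows "simple_process_integral W N p \<xi> w \<omega> - simple_process_integral W N p \<xi> u \<omega>
    = simple_process N p \<xi> w \<omega> * (W w \<omega> - W u \<omega>)"
  unfolding simple_process_integral_def simple_process_def sum_distrib_right sum_subtractf[symmetric]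
proof (rule sum.cong)
  fix i assume i: "i \<in> {..<N}"
  then have pi: "p i \<le> p (Suc i)" using p by (auto simp: mono_on_def)
  have "p i \<le> u \<or> w \<le> p i" "p (Suc i) \<le> u \<or> w \<le> p (Suc i)"
    using assms(2)[of i] assms(2)[of "Suc i"] i by auto
  then consider "w \<le> p i" | "p i < w" "p i \<le> u" "w \<le> p (Suc i)" | "p (Suc i) < w" "p (Suc i) \<le> u"
    by linarith
  then show "\<xi> i \<omega> * (W (min w (p (Suc i))) \<omega> - W (min w (p i)) \<omega>)
      - \<xi> i \<omega> * (W (min u (p (Suc i))) \<omega> - W (min u (p i)) \<omega>)
    = \<xi> i \<omega> * indicator {p i<..p (Suc i)} w * (W w \<omega> - W u \<omega>)"
  proof cases
    case 1
    then show ?thesis using pi \<open>u \<le> w\<close> by (simp add: min_def)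
  next
    case 2
    then have "min w (p (Suc i)) = w" "min w (p i) = p i" "min u (p (Suc i)) = u" "min u (p i) = p i"
      using \<open>u \<le> w\<close> by auto
    then show ?thesis using 2 by (simp add: algebra_simps)
  next
    case 3
    then have "min w (p (Suc i)) = p (Suc i)" "min w (p i) = p i"
      "min u (p (Suc i)) = p (Suc i)" "min u (p i) = p i"
      using pi by auto
    then show ?thesis using 3 by simp
  qed
qed simp

lemma simple_process_data_bounds:
  assumes "simple_process_data M F t0 N p \<xi>" "i \<le> N"
  shows "t0 \<le> p i"
  using assms unfolding simple_process_data_def mono_on_def
  by (metis atMost_iff order_trans zero_le)

text \<open>
  Since simple processes are left-continuous, their value on a cell of the grid is the value at the
  \<^emph>\<open>right\<close> end point, which is nevertheless known at the left end point.
\<close>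

lemma simple_process_integral_transform:
  assumes sp: "simple_process_data M F t0 N p \<xi>" and "q 0 = t0"
    and q: "\<And>j. j < m \<Longrightarrow> q j < q (Suc j)"
    and grid: "\<And>i j. i \<le> N \<Longrightarrow> j < m \<Longrightarrow> p i \<notin> {q j<..<q (Suc j)}"
    and "j \<le> m"
  shows "simple_process_integral W N p \<xi> (q j) \<omega>
    = transform (\<lambda>l. simple_process N p \<xi> (q (Suc l))) (\<lambda>l \<omega>. W (q (Suc l)) \<omega> - W (q l) \<omega>) j \<omega>"
  using \<open>j \<le> m\<close>
proof (induction j)
  case 0
  have "min t0 (p i) = t0" if "i \<le> N" for i using simple_process_data_bounds[OF sp that] by simp
  then show ?case using \<open>q 0 = t0\<close> by (auto simp: simple_process_integral_def transform_def)
next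
  case (Suc j)
  have "mono_on {..N} p" using sp by (simp add: simple_process_data_def)
  from simple_process_integral_increment[OF this, of "q j" "q (Suc j)" W \<xi> \<omega>]
  show ?case using Suc grid[of _ j] q[of j] by (simp add: transform_def)
qed

lemma simple_process_square_integral:
  assumes sp: "simple_process_data M F t0 N p \<xi>" and "q 0 = t0"
    and q: "\<And>j. j < m \<Longrightarrow> q j < q (Suc j)"
    and grid: "\<And>i j. i \<le> N \<Longrightarrow> j < m \<Longrightarrow> p i \<notin> {q j<..<q (Suc j)}"
  shows "set_integrable lborel {t0..q m} (\<lambda>s. (simple_process N p \<xi> s \<omega>)\<^sup>2)"
    and "(LINT s:{t0..q m}|lborel. (simple_process N p \<xi> s \<omega>)\<^sup>2)
      = (\<Sum>l<m. (simple_process N p \<xi> (q (Suc l)) \<omega>)\<^sup>2 * (q (Suc l) - q l))"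
proof -
  let ?c = "\<lambda>l. (simple_process N p \<xi> (q (Suc l)) \<omega>)\<^sup>2"
  have *: "indicator {t0..q j} s * (simple_process N p \<xi> s \<omega>)\<^sup>2
      = (\<Sum>l<j. ?c l * indicator {q l<..q (Suc l)} s) \<and> t0 \<le> q j" if "j \<le> m" for j s
    using that
  proof (induction j)
    case 0
    have "\<not> p i < t0" if "i < N" for i
      using simple_process_data_bounds[OF sp, of i] that by simp
    then have "simple_process N p \<xi> t0 \<omega> = 0" by (simp add: simple_process_def)
    then show ?case using \<open>q 0 = t0\<close> by (simp add: indicator_def)
  next
    case (Suc j)
    then have j: "j < m" by simp
    have "indicator {t0..q (Suc j)} s = (indicator {t0..q j} s + indicator {q j<..q (Suc j)} s :: real)"
      using Suc q[OF j] by (auto simp: indicator_def)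
    moreover have "indicator {q j<..q (Suc j)} s * (simple_process N p \<xi> s \<omega>)\<^sup>2
        = ?c j * indicator {q j<..q (Suc j)} s"
      using simple_process_left_constant[of N p "q j" "q (Suc j)" s \<xi> \<omega>] grid j
      by (auto simp: indicator_def)
    ultimately show ?case using Suc q[OF j] by (auto simp: distrib_right)
  qed
  have eq: "(\<lambda>s. indicator {t0..q m} s *\<^sub>R (simple_process N p \<xi> s \<omega>)\<^sup>2)
      = (\<lambda>s. \<Sum>l<m. ?c l * indicator {q l<..q (Suc l)} s)"
    using *[of m] by auto
  have "has_bochner_integral lborel (\<lambda>s. ?c l * indicator {q l<..q (Suc l)} s)
      (?c l * (q (Suc l) - q l))" if "l < m" for l
  proof (rule has_bochner_integral_mult_right)
    have "measure lborel {q l<..q (Suc l)} = q (Suc l) - q l"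
      using q[OF that] by (simp add: measure_def)
    then show "has_bochner_integral lborel (indicator {q l<..q (Suc l)}) (q (Suc l) - q l)"
      using has_bochner_integral_real_indicator[of "{q l<..q (Suc l)}" lborel] q[OF that] by simp
  qed
  then have "has_bochner_integral lborel (\<lambda>s. \<Sum>l<m. ?c l * indicator {q l<..q (Suc l)} s)
      (\<Sum>l<m. ?c l * (q (Suc l) - q l))"
    by (intro has_bochner_integral_sum) auto
  then show "set_integrable lborel {t0..q m} (\<lambda>s. (simple_process N p \<xi> s \<omega>)\<^sup>2)"
    "(LINT s:{t0..q m}|lborel. (simple_process N p \<xi> s \<omega>)\<^sup>2)
      = (\<Sum>l<m. (simple_process N p \<xi> (q (Suc l)) \<omega>)\<^sup>2 * (q (Suc l) - q l))"
    unfolding set_integrable_def set_lebesgue_integral_def eq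
    by (auto simp only: has_bochner_integral_integral_eq intro: integrable.intros)
qed

context stochastic_basis
begin

lemma F_mono: "t0 \<le> s \<Longrightarrow> s \<le> t \<Longrightarrow> sets (F s) \<subseteq> sets (F t)"
  using filtration.sets_F_mono[OF filtration, of s t] by (simp add: max_def split: if_splits)

lemma measurable_F_mono:
  assumes "f \<in> borel_measurable (F s)" "t0 \<le> s" "s \<le> t"
  shows "f \<in> borel_measurable (F t)"
proof -
  have "subalgebra (F t) (F s)"
    using F_mono[OF assms(2,3)] subalgebra[of s] subalgebra[of t] assms(2,3)
    unfolding subalgebra_def by auto
  then show ?thesis using assms(1) by (rule measurable_from_subalg)
qed

lemma measurable_F_M: "f \<in> borel_measurable (F t) \<Longrightarrow> t0 \<le> t \<Longrightarrow> f \<in> borel_measurable M"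
  using subalgebra measurable_from_subalg by blast

lemma simple_process_predictable:
  assumes sp: "simple_process_data M F t0 N p \<xi>"
    and grid: "\<And>i. i \<le> N \<Longrightarrow> p i \<notin> {u<..<w}"
  shows "simple_process N p \<xi> w \<in> borel_measurable (F u)"
proof -
  have "(\<lambda>\<omega>. \<Sum>i<N. \<xi> i \<omega> * indicator {p i<..p (Suc i)} w) \<in> borel_measurable (F u)"
  proof (intro borel_measurable_sum)
    fix i assume i: "i \<in> {..<N}"
    show "(\<lambda>\<omega>. \<xi> i \<omega> * indicator {p i<..p (Suc i)} w) \<in> borel_measurable (F u)"
    proof (cases "p i < w")
      case True
      then have "p i \<le> u" "t0 \<le> p i" using grid[of i] i simple_process_data_bounds[OF sp, of i] by auto
      moreover have "\<xi> i \<in> borel_measurable (F (p i))"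
        using sp i by (simp add: simple_process_data_def)
      ultimately have "\<xi> i \<in> borel_measurable (F u)" using measurable_F_mono by blast
      then show ?thesis by (intro borel_measurable_times) auto
    qed simp
  qed
  moreover have "simple_process N p \<xi> w = (\<lambda>\<omega>. \<Sum>i<N. \<xi> i \<omega> * indicator {p i<..p (Suc i)} w)"
    by (rule ext) (simp add: simple_process_def)
  ultimately show ?thesis by simp
qed

lemma brownian_independent_increments:
  assumes W: "brownian_motion M F t0 W" and q0: "q 0 = t0"
    and q: "strict_mono_on {..m} q"
  shows "independent_increments M m (\<lambda>j. F (q j)) (\<lambda>j \<omega>. W (q (Suc j)) \<omega> - W (q j) \<omega>)
    (\<lambda>j. q (Suc j) - q j)"
proof
  have qle: "q i \<le> q j" if "i \<le> j" "j \<le> m" for i j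
    using strict_mono_onD[OF q, of i j] that by (cases "i = j") auto
  have qt: "t0 \<le> q j" if "j \<le> m" for j using qle[of 0 j] that q0 by simp
  show "subalgebra M (F (q j))" if "j \<le> m" for j using subalgebra qt that by blast
  show "sets (F (q i)) \<subseteq> sets (F (q j))" if "i \<le> j" "j \<le> m" for i j
    using F_mono qle[OF that] qt[of i] that by simp
  fix j assume j: "j < m"
  have q12: "t0 \<le> q j" "q j < q (Suc j)" using qt[of j] j q by (auto simp: strict_mono_on_def)
  have Wm: "W (q (Suc j)) \<in> borel_measurable (F (q (Suc j)))" "W (q j) \<in> borel_measurable (F (q j))"
    using W q12 by (auto simp: brownian_motion_def continuous_adapted_def)
  have "W (q j) \<in> borel_measurable (F (q (Suc j)))"
    by (rule measurable_F_mono[OF Wm(2) q12(1)]) (use q12 in linarith)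
  with Wm(1) show "(\<lambda>\<omega>. W (q (Suc j)) \<omega> - W (q j) \<omega>) \<in> borel_measurable (F (q (Suc j)))"
    by (rule borel_measurable_diff)
  let ?X = "\<lambda>\<omega>. W (q (Suc j)) \<omega> - W (q j) \<omega>" and ?s = "sqrt (q (Suc j) - q j)"
  have D: "distributed M lborel ?X (normal_density 0 ?s)"
    and "indep_set (sets (F (q j))) {?X -` B \<inter> space M | B. B \<in> sets borel}"
    using W q12 by (auto simp: brownian_motion_def)
  then show "indep_set (sets (F (q j))) {?X -` B \<inter> space M | B. B \<in> sets borel}" by simp
  have s: "0 < ?s" using q12 by simp
  show E: "expectation ?X = 0" using normal_distributed_expectation[OF s D] .
  show "expectation (\<lambda>\<omega>. (?X \<omega>)\<^sup>2) = q (Suc j) - q j"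
    using normal_distributed_variance[OF s D] E q12 by simp
  show "integrable M (\<lambda>\<omega>. (?X \<omega>)\<^sup>2)"
    using distributed_integrable[OF D, of "\<lambda>x. x\<^sup>2"] integrable_normal_moment[OF s, of 0 2] by simp
qed

end

section \<open>Continuous versions\<close>

text \<open>
  A continuous path is the limit of its values at the times \<open>\<lfloor>t * n\<rfloor> / n\<close>, and for fixed \<open>n\<close> these
  times select from countably many random variables only.
\<close>

lemma borel_measurable_pair_continuous:
  fixes X :: "real \<Rightarrow> 'a \<Rightarrow> real"
  assumes X: "\<And>t. X t \<in> borel_measurable M"
    and cont: "\<And>\<omega>. continuous_on UNIV (\<lambda>t. X t \<omega>)"
  shows "(\<lambda>(t, \<omega>). X t \<omega>) \<in> borel_measurable (borel \<Otimes>\<^sub>M M)"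
proof (rule borel_measurable_LIMSEQ_metric)
  let ?u = "\<lambda>n t. of_int \<lfloor>t * real (Suc n)\<rfloor> / real (Suc n)"
  show "(\<lambda>(t, \<omega>). X (?u n t) \<omega>) \<in> borel_measurable (borel \<Otimes>\<^sub>M M)" for n
  proof -
    have "(\<lambda>x. (\<lambda>k x. X (of_int k / real (Suc n)) (snd x)) \<lfloor>fst x * real (Suc n)\<rfloor> x)
        \<in> borel_measurable (borel \<Otimes>\<^sub>M M)"
    proof (rule measurable_compose_countable[where g = "\<lambda>x. \<lfloor>fst x * real (Suc n)\<rfloor>"
          and f = "\<lambda>k x. X (of_int k / real (Suc n)) (snd x)"])
      show "(\<lambda>x. X (of_int k / real (Suc n)) (snd x)) \<in> borel_measurable (borel \<Otimes>\<^sub>M M)" for k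
        using X by (intro measurable_compose[OF measurable_snd])
      show "(\<lambda>x. \<lfloor>fst x * real (Suc n)\<rfloor>) \<in> measurable (borel \<Otimes>\<^sub>M M) (count_space UNIV)"
        by measurable
    qed
    then show ?thesis by (simp add: case_prod_unfold)
  qed
  fix x :: "real \<times> 'a"
  have lim: "(\<lambda>n. ?u n t) \<longlonglongrightarrow> t" for t
  proof (rule tendsto_sandwich)
    show "(\<lambda>n. t - 1 / real (Suc n)) \<longlonglongrightarrow> t"
      using tendsto_diff[OF tendsto_const[of t] LIMSEQ_inverse_real_of_nat] by (simp add: inverse_eq_divide)
    show "(\<lambda>n. t) \<longlonglongrightarrow> t" by simp
    show "\<forall>\<^sub>F n in sequentially. t - 1 / real (Suc n) \<le> ?u n t"
    proof (rule always_eventually, rule allI)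
      fix n
      have "t * real (Suc n) - 1 \<le> of_int \<lfloor>t * real (Suc n)\<rfloor>" by linarith
      then have "(t * real (Suc n) - 1) / real (Suc n) \<le> ?u n t" by (rule divide_right_mono) simp
      then show "t - 1 / real (Suc n) \<le> ?u n t" by (simp add: diff_divide_distrib)
    qed
    show "\<forall>\<^sub>F n in sequentially. ?u n t \<le> t"
    proof (rule always_eventually, rule allI)
      fix n
      have "?u n t \<le> (t * real (Suc n)) / real (Suc n)"
        by (rule divide_right_mono) (auto simp: of_int_floor_le)
      then show "?u n t \<le> t" by simp
    qed
  qed
  show "(\<lambda>n. (\<lambda>(t, \<omega>). X (?u n t) \<omega>) x) \<longlonglongrightarrow> (\<lambda>(t, \<omega>). X t \<omega>) x"
    using continuous_on_tendsto_compose[OF cont[of "snd x"] lim[of "fst x"]]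
    by (simp add: case_prod_unfold)
qed

lemma (in complete_measure) measurable_AE_cong:
  assumes f: "f \<in> measurable M N" and ae: "AE \<omega> in M. g \<omega> = f \<omega>"
    and g: "\<And>\<omega>. \<omega> \<in> space M \<Longrightarrow> g \<omega> \<in> space N"
  shows "g \<in> measurable M N"
proof (rule measurableI)
  fix A assume "A \<in> sets N"
  then have "f -` A \<inter> space M \<in> sets M" using f by (rule measurable_sets[rotated])
  moreover have "AE \<omega> in M. \<omega> \<in> f -` A \<inter> space M \<longleftrightarrow> \<omega> \<in> g -` A \<inter> space M"
    using ae by eventually_elim auto
  ultimately show "g -` A \<inter> space M \<in> sets M" using in_sets_AE by blast
qed (use g in auto)

text \<open>
  Redefining a process as \<open>0\<close> on the null set of discontinuous paths keeps it measurable, because the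
  space is complete, and makes it jointly measurable, so that time integrals of it are random
  variables and Fubini's theorem applies.
\<close>

lemma (in complete_measure) continuous_version:
  fixes X :: "real \<Rightarrow> 'a \<Rightarrow> real"
  assumes X: "\<And>t. a \<le> t \<Longrightarrow> X t \<in> borel_measurable M"
    and cont: "AE \<omega> in M. continuous_on {a..} (\<lambda>t. X t \<omega>)"
  obtains Y :: "real \<Rightarrow> 'a \<Rightarrow> real"
  where "(\<lambda>(t, \<omega>). Y t \<omega>) \<in> borel_measurable (borel \<Otimes>\<^sub>M M)"
    and "\<And>\<omega>. continuous_on UNIV (\<lambda>t. Y t \<omega>)"
    and "AE \<omega> in M. \<forall>t\<ge>a. X t \<omega> = Y t \<omega>"
proof -
  let ?G = "{\<omega> \<in> space M. continuous_on {a..} (\<lambda>t. X t \<omega>)}"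
  have G: "?G \<in> sets M"
  proof (rule in_sets_AE)
    show "AE \<omega> in M. \<omega> \<in> space M \<longleftrightarrow> \<omega> \<in> ?G" using cont by eventually_elim auto
  qed auto
  define Y where "Y = (\<lambda>t \<omega>. if \<omega> \<in> ?G then X (max a t) \<omega> else 0)"
  have cY: "continuous_on UNIV (\<lambda>t. Y t \<omega>)" for \<omega>
  proof (cases "\<omega> \<in> ?G")
    case True
    then have "continuous_on UNIV (\<lambda>t. X (max a t) \<omega>)"
      by (intro continuous_on_compose2[of "{a..}" "\<lambda>t. X t \<omega>" UNIV "max a"] continuous_intros) auto
    then show ?thesis using True by (simp add: Y_def)
  next
    case False
    then have "Y t \<omega> = 0" for t unfolding Y_def by (simp only: if_False)
    then show ?thesis by (simp only: continuous_on_const)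
  qed
  have "Y t \<in> borel_measurable M" for t
    unfolding Y_def using X[of "max a t"] G by (intro measurable_If_set) auto
  then have "(\<lambda>(t, \<omega>). Y t \<omega>) \<in> borel_measurable (borel \<Otimes>\<^sub>M M)"
    using cY by (rule borel_measurable_pair_continuous)
  moreover have "AE \<omega> in M. \<forall>t\<ge>a. X t \<omega> = Y t \<omega>"
    using cont AE_space by eventually_elim (auto simp: Y_def max_def)
  ultimately show thesis using that cY by blast
qed

section \<open>Approximation of Ito integrals by square-integrable martingales\<close>

lemma square_integral_le:
  fixes f h :: "'a \<Rightarrow> real"
  assumes [measurable]: "f \<in> borel_measurable M" "h \<in> borel_measurable M"
    and "integrable M (\<lambda>x. (f x)\<^sup>2)" "integrable M (\<lambda>x. (h x)\<^sup>2)"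
  shows "(\<integral>x. (f x)\<^sup>2 \<partial>M) \<le> 2 * (\<integral>x. (h x)\<^sup>2 \<partial>M) + 2 * (\<integral>x. (f x - h x)\<^sup>2 \<partial>M)"
proof -
  have d: "integrable M (\<lambda>x. (f x - h x)\<^sup>2)"
    using square_integrable_add[of f M "\<lambda>x. - h x"] assms by simp
  have "(\<integral>x. (f x)\<^sup>2 \<partial>M) \<le> (\<integral>x. 2 * (h x)\<^sup>2 + 2 * (f x - h x)\<^sup>2 \<partial>M)"
  proof (rule integral_mono)
    fix x
    have "0 \<le> (f x - 2 * h x)\<^sup>2" by simp
    then show "(f x)\<^sup>2 \<le> 2 * (h x)\<^sup>2 + 2 * (f x - h x)\<^sup>2"
      by (simp add: power2_eq_square algebra_simps)
  qed (use assms d in auto)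
  also have "\<dots> = 2 * (\<integral>x. (h x)\<^sup>2 \<partial>M) + 2 * (\<integral>x. (f x - h x)\<^sup>2 \<partial>M)"
    using assms d by simp
  finally show ?thesis .
qed

text \<open>
  The error integral in the definition of the Ito integral controls the quadratic variation of the
  approximating simple process, up to the harmless factor 2.
\<close>

lemma simple_process_variation_le:
  assumes sp: "simple_process_data M F t0 N p \<xi>" and q0: "q 0 = t0" and qm: "q m = T"
    and q: "\<And>j. j < m \<Longrightarrow> q j < q (Suc j)"
    and grid: "\<And>i j. i \<le> N \<Longrightarrow> j < m \<Longrightarrow> p i \<notin> {q j<..<q (Suc j)}"
    and H: "continuous_on {t0..} (\<lambda>s. H s \<omega>)"
  shows "(\<Sum>l<m. (simple_process N p \<xi> (q (Suc l)) \<omega>)\<^sup>2 * (q (Suc l) - q l))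
    \<le> 2 * (LINT s:{t0..T}|lborel. (H s \<omega>)\<^sup>2)
      + 2 * (LINT s:{t0..T}|lborel. (simple_process N p \<xi> s \<omega> - H s \<omega>)\<^sup>2)"
proof -
  let ?f = "\<lambda>s. indicator {t0..T} s * simple_process N p \<xi> s \<omega>"
  let ?h = "\<lambda>s. indicator {t0..T} s * H s \<omega>"
  have cont: "continuous_on {t0..T} (\<lambda>s. H s \<omega>)" using H by (rule continuous_on_subset) auto
  have f: "?f \<in> borel_measurable lborel" unfolding simple_process_def by measurable
  have h: "?h \<in> borel_measurable lborel"
    using borel_measurable_continuous_on_indicator[OF _ cont] by simp
  have sq: "(indicator {t0..T} s * x)\<^sup>2 = indicator {t0..T} s *\<^sub>R x\<^sup>2" for s x :: real
    by (simp add: indicator_def)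
  have fi: "integrable lborel (\<lambda>s. (?f s)\<^sup>2)"
    using simple_process_square_integral(1)[where q = q and m = m, OF sp q0 q grid] qm
    unfolding set_integrable_def sq by simp
  have hi: "integrable lborel (\<lambda>s. (?h s)\<^sup>2)"
    using borel_integrable_atLeastAtMost'[OF continuous_on_power[OF cont], of 2]
    unfolding set_integrable_def sq by simp
  have "(\<lambda>s. (?f s - ?h s)\<^sup>2)
      = (\<lambda>s. indicator {t0..T} s *\<^sub>R (simple_process N p \<xi> s \<omega> - H s \<omega>)\<^sup>2)"
    by (auto simp: indicator_def)
  then show ?thesis
    using square_integral_le[OF f h fi hi]
      simple_process_square_integral(2)[where q = q and m = m, OF sp q0 q grid] qm
    unfolding set_lebesgue_integral_def sq by simp
qed

lemma simple_process_integral_le_SUP: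
  assumes sp: "simple_process_data M F t0 N p \<xi>"
    and W: "continuous_on {t0..} (\<lambda>s. W s \<omega>)" and I: "continuous_on {t0..} (\<lambda>s. I s \<omega>)"
    and s: "s \<in> {t0..T}"
  shows "\<bar>simple_process_integral W N p \<xi> s \<omega> - I s \<omega>\<bar>
    \<le> (SUP t\<in>{t0..T}. \<bar>simple_process_integral W N p \<xi> t \<omega> - I t \<omega>\<bar>)"
proof (rule cSUP_upper[OF s])
  have "continuous_on {t0..T} (\<lambda>t. W (min t (p i)) \<omega>)" if "i \<le> N" for i
    using simple_process_data_bounds[OF sp that]
    by (intro continuous_on_compose2[OF W, of "{t0..T}" "\<lambda>t. min t (p i)"] continuous_intros) auto
  then have "continuous_on {t0..T} (\<lambda>t. simple_process_integral W N p \<xi> t \<omega>)"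
    unfolding simple_process_integral_def
    by (intro continuous_on_sum continuous_on_mult continuous_on_const continuous_on_diff) auto
  moreover have "continuous_on {t0..T} (\<lambda>s. I s \<omega>)" using I by (rule continuous_on_subset) auto
  ultimately have "compact ((\<lambda>t. \<bar>simple_process_integral W N p \<xi> t \<omega> - I t \<omega>\<bar>) ` {t0..T})"
    by (intro compact_continuous_image continuous_intros) auto
  then show "bdd_above ((\<lambda>t. \<bar>simple_process_integral W N p \<xi> t \<omega> - I t \<omega>\<bar>) ` {t0..T})"
    by (intro bounded_imp_bdd_above compact_imp_bounded)
qed

context stochastic_basis
begin

lemma ito_variation_measurable:
  assumes "continuous_adapted M F t0 H"
  shows "(\<lambda>\<omega>. LINT s:{t0..T}|lborel. (H s \<omega>)\<^sup>2) \<in> borel_measurable M"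
proof -
  obtain Y where Y[measurable]: "(\<lambda>(t, \<omega>). Y t \<omega>) \<in> borel_measurable (borel \<Otimes>\<^sub>M M)"
    and eq: "AE \<omega> in M. \<forall>t\<ge>t0. H t \<omega> = Y t \<omega>"
  proof (rule continuous_version[of t0 H])
    show "H t \<in> borel_measurable M" if "t0 \<le> t" for t
      using assms that measurable_F_M by (auto simp: continuous_adapted_def)
    show "AE \<omega> in M. continuous_on {t0..} (\<lambda>t. H t \<omega>)"
      using assms by (simp add: continuous_adapted_def)
  qed
  have "(\<lambda>\<omega>. LINT s:{t0..T}|lborel. (Y s \<omega>)\<^sup>2) \<in> borel_measurable M"
    unfolding set_lebesgue_integral_def by measurable
  moreover have "AE \<omega> in M. (LINT s:{t0..T}|lborel. (H s \<omega>)\<^sup>2) = (LINT s:{t0..T}|lborel. (Y s \<omega>)\<^sup>2)"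
    using eq by eventually_elim (auto intro!: set_lebesgue_integral_cong)
  ultimately show ?thesis by (rule measurable_AE_cong) simp
qed

lemma predictable_truncation:
  assumes W: "brownian_motion M F t0 W" and sp: "simple_process_data M F t0 N p \<xi>"
    and q0: "q 0 = t0" and q: "strict_mono_on {..m} q"
    and grid: "\<And>i j. i \<le> N \<Longrightarrow> j < m \<Longrightarrow> p i \<notin> {q j<..<q (Suc j)}"
  shows "\<exists>C. predictable_transform M m (\<lambda>j. F (q j)) (\<lambda>j \<omega>. W (q (Suc j)) \<omega> - W (q j) \<omega>)
    (\<lambda>j. q (Suc j) - q j)
    (truncate K (\<lambda>j. q (Suc j) - q j) (\<lambda>l. simple_process N p \<xi> (q (Suc l)))) C"
proof -
  interpret I: independent_increments M m "\<lambda>j. F (q j)" "\<lambda>j \<omega>. W (q (Suc j)) \<omega> - W (q j) \<omega>"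
    "\<lambda>j. q (Suc j) - q j"
    by (rule brownian_independent_increments[OF W q0 q])
  let ?\<eta> = "\<lambda>l. simple_process N p \<xi> (q (Suc l))" and ?v = "\<lambda>j. q (Suc j) - q j"
  obtain C where C: "\<And>i \<omega>. i < N \<Longrightarrow> \<omega> \<in> space M \<Longrightarrow> \<bar>\<xi> i \<omega>\<bar> \<le> C"
    using sp by (auto simp: simple_process_data_def)
  show ?thesis
  proof (intro exI predictable_transform.intro predictable_transform_axioms.intro)
    show "independent_increments M m (\<lambda>j. F (q j)) (\<lambda>j \<omega>. W (q (Suc j)) \<omega> - W (q j) \<omega>) ?v"
      by unfold_locales
    fix j assume j: "j < m"
    have \<eta>: "?\<eta> l \<in> borel_measurable (F (q j))" if "l \<le> j" for l
    proof -
      have "?\<eta> l \<in> borel_measurable (F (q l))"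
        using simple_process_predictable[OF sp] grid j that by simp
      then show ?thesis by (rule I.measurable_G_mono) (use j that in auto)
    qed
    have "(\<lambda>\<omega>. if (\<Sum>l\<le>j. (?\<eta> l \<omega>)\<^sup>2 * ?v l) \<le> K then ?\<eta> j \<omega> else 0) \<in> borel_measurable (F (q j))"
    proof (rule measurable_If)
      have "(\<lambda>\<omega>. \<Sum>l\<le>j. (?\<eta> l \<omega>)\<^sup>2 * ?v l) \<in> borel_measurable (F (q j))"
        by (intro borel_measurable_sum borel_measurable_times borel_measurable_power \<eta>) auto
      then show "{\<omega> \<in> space (F (q j)). (\<Sum>l\<le>j. (?\<eta> l \<omega>)\<^sup>2 * ?v l) \<le> K} \<in> sets (F (q j))"
        by (rule borel_measurable_le) simp
    qed (use \<eta> in auto)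
    moreover have "truncate K ?v ?\<eta> j
        = (\<lambda>\<omega>. if (\<Sum>l\<le>j. (?\<eta> l \<omega>)\<^sup>2 * ?v l) \<le> K then ?\<eta> j \<omega> else 0)"
      by (rule ext) (simp add: truncate_def)
    ultimately show "truncate K ?v ?\<eta> j \<in> borel_measurable (F (q j))" by simp
    fix \<omega> assume \<omega>: "\<omega> \<in> space M"
    have "\<bar>?\<eta> j \<omega>\<bar> \<le> (\<Sum>i<N. \<bar>C\<bar>)"
      unfolding simple_process_def
    proof (rule order_trans[OF sum_abs], rule sum_mono)
      fix i assume "i \<in> {..<N}"
      then have "\<bar>\<xi> i \<omega>\<bar> \<le> \<bar>C\<bar>" using C[of i \<omega>] \<omega> by simp
      then show "\<bar>\<xi> i \<omega> * indicator {p i<..p (Suc i)} (q (Suc j))\<bar> \<le> \<bar>C\<bar>"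
        by (simp add: indicator_def)
    qed
    then show "\<bar>truncate K ?v ?\<eta> j \<omega>\<bar> \<le> (\<Sum>i<N. \<bar>C\<bar>)"
      by (auto simp: truncate_def)
  qed
qed


text \<open>
  A simple process close to \<open>H\<close> is stopped before its quadratic variation
  exceeds \<open>K\<close>; its integral \<open>Z\<close> is then a square-integrable martingale. On the event \<open>B\<close>, which
  has almost full probability, the integral of the simple process is uniformly close to \<open>I\<close>, so \<open>Z\<close> is
  close to \<open>I\<close> \<^emph>\<open>stopped at some grid time\<close>, and close to \<open>I\<close> itself if \<open>2 * A + 2 \<le> K\<close>, where \<open>2 * A + 2\<close>
  bounds the variation of the simple process as soon as its squared distance to \<open>H\<close> is at most 1.
  The variable \<open>Y\<close> is the running maximum of \<open>Z\<close>.
\<close>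

lemma ito_truncated_approximation:
  assumes W: "brownian_motion M F t0 W" and ito: "has_ito_integral M F t0 W H I"
    and T: "t0 \<le> T" and D: "finite D" "D \<subseteq> {t0..T}"
    and K: "0 \<le> K" and \<epsilon>: "0 < \<epsilon>" and \<delta>: "0 < \<delta>"
  defines "A \<equiv> \<lambda>\<omega>. LINT s:{t0..T}|lborel. (H s \<omega>)\<^sup>2"
  obtains Z :: "real \<Rightarrow> 'a \<Rightarrow> real" and Y :: "'a \<Rightarrow> real" and B :: "'a set"
  where "B \<in> events" "prob (space M - B) \<le> \<delta>"
    and "\<And>s. s \<in> D \<Longrightarrow> Z s \<in> borel_measurable M"
    and "\<And>s. s \<in> D \<Longrightarrow> integrable M (\<lambda>\<omega>. (Z s \<omega>)\<^sup>2)"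
    and "\<And>s. s \<in> D \<Longrightarrow> expectation (Z s) = 0"
    and "\<And>s. s \<in> D \<Longrightarrow> expectation (\<lambda>\<omega>. (Z s \<omega>)\<^sup>2) \<le> K"
    and "\<And>s. s \<in> D \<Longrightarrow> ennreal (expectation (\<lambda>\<omega>. (Z s \<omega>)\<^sup>2))
      \<le> (\<integral>\<^sup>+\<omega>. ennreal (2 * A \<omega> + 2) \<partial>M) + ennreal (K * \<delta>)"
    and "Y \<in> borel_measurable M" "integrable M (\<lambda>\<omega>. (Y \<omega>)\<^sup>2)"
    and "ennreal (expectation (\<lambda>\<omega>. (Y \<omega>)\<^sup>2))
      \<le> 4 * ((\<integral>\<^sup>+\<omega>. ennreal (2 * A \<omega> + 2) \<partial>M) + ennreal (K * \<delta>))"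
    and "\<And>\<omega>. 0 \<le> Y \<omega>" "\<And>s \<omega>. s \<in> D \<Longrightarrow> Z s \<omega> \<le> Y \<omega>"
    and "\<And>s \<omega>. s \<in> D \<Longrightarrow> \<omega> \<in> B \<Longrightarrow> \<exists>u\<in>{t0..s}. \<bar>Z s \<omega> - I u \<omega>\<bar> \<le> \<epsilon>"
    and "\<And>s \<omega>. s \<in> D \<Longrightarrow> \<omega> \<in> B \<Longrightarrow> 2 * A \<omega> + 2 \<le> K \<Longrightarrow> \<bar>Z s \<omega> - I s \<omega>\<bar> \<le> \<epsilon>"
proof -
  have A_nonneg: "0 \<le> A \<omega>" for \<omega>
    unfolding A_def set_lebesgue_integral_def by (intro integral_nonneg_AE) auto
  have A_measurable[measurable]: "A \<in> borel_measurable M"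
    unfolding A_def using ito by (intro ito_variation_measurable) (simp add: has_ito_integral_def)
  obtain N p \<xi> where sps: "\<And>n. simple_process_data M F t0 (N n) (p n) (\<xi> n)"
    and lim1: "tendsto_zero_in_prob M
      (\<lambda>n \<omega>. LINT s:{t0..T}|lborel. (simple_process (N n) (p n) (\<xi> n) s \<omega> - H s \<omega>)\<^sup>2)"
    and lim2: "tendsto_zero_in_prob M
      (\<lambda>n \<omega>. SUP t\<in>{t0..T}. \<bar>simple_process_integral W (N n) (p n) (\<xi> n) t \<omega> - I t \<omega>\<bar>)"
    using ito T unfolding has_ito_integral_def by blast
  let ?X1 = "\<lambda>n \<omega>. LINT s:{t0..T}|lborel. (simple_process (N n) (p n) (\<xi> n) s \<omega> - H s \<omega>)\<^sup>2"
  let ?X2 = "\<lambda>n \<omega>. SUP t\<in>{t0..T}. \<bar>simple_process_integral W (N n) (p n) (\<xi> n) t \<omega> - I t \<omega>\<bar>"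
  let ?E1 = "\<lambda>n. {\<omega>\<in>space M. 1 < \<bar>?X1 n \<omega>\<bar>}" and ?E2 = "\<lambda>n. {\<omega>\<in>space M. \<epsilon> < \<bar>?X2 n \<omega>\<bar>}"
  have "(\<lambda>n. prob (?E1 n)) \<longlonglongrightarrow> 0" "(\<lambda>n. prob (?E2 n)) \<longlonglongrightarrow> 0"
    using lim1 lim2 \<epsilon> unfolding tendsto_zero_in_prob_def by (blast intro: zero_less_one)+
  then have "\<forall>\<^sub>F n in sequentially. prob (?E1 n) < \<delta> / 2" "\<forall>\<^sub>F n in sequentially. prob (?E2 n) < \<delta> / 2"
    using \<delta> by (auto dest!: order_tendstoD(2)[where a = "\<delta> / 2"])
  then have "\<forall>\<^sub>F n in sequentially. prob (?E1 n) < \<delta> / 2 \<and> prob (?E2 n) < \<delta> / 2"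
    by eventually_elim simp
  then obtain n where n: "prob (?E1 n) < \<delta> / 2" "prob (?E2 n) < \<delta> / 2"
    unfolding eventually_sequentially by blast
  have E: "?E1 n \<in> events" "?E2 n \<in> events"
  proof -
    have X: "?X1 n \<in> borel_measurable M" "?X2 n \<in> borel_measurable M"
      using lim1 lim2 unfolding tendsto_zero_in_prob_def by blast+
    show "?E1 n \<in> events"
      by (rule borel_measurable_less[OF borel_measurable_const borel_measurable_abs[OF X(1)]])
    show "?E2 n \<in> events"
      by (rule borel_measurable_less[OF borel_measurable_const borel_measurable_abs[OF X(2)]])
  qed
  have "AE \<omega> in M. continuous_on {t0..} (\<lambda>t. W t \<omega>) \<and> continuous_on {t0..} (\<lambda>t. H t \<omega>)
      \<and> continuous_on {t0..} (\<lambda>t. I t \<omega>)"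
    using W ito by (auto simp: brownian_motion_def has_ito_integral_def continuous_adapted_def)
  then obtain Nl where Nl: "Nl \<in> null_sets M" "{\<omega>\<in>space M. \<not> (continuous_on {t0..} (\<lambda>t. W t \<omega>)
      \<and> continuous_on {t0..} (\<lambda>t. H t \<omega>) \<and> continuous_on {t0..} (\<lambda>t. I t \<omega>))} \<subseteq> Nl"
    unfolding eventually_ae_filter by blast
  define B where "B = space M - (Nl \<union> ?E1 n \<union> ?E2 n)"
  have B[measurable]: "B \<in> events" unfolding B_def using E Nl(1) by auto
  have PB: "prob (space M - B) \<le> \<delta>"
  proof -
    have "prob (space M - B) \<le> prob (Nl \<union> ?E1 n \<union> ?E2 n)"
      using E Nl(1) by (intro finite_measure_mono) (auto simp: B_def)
    also have "\<dots> \<le> prob Nl + prob (?E1 n) + prob (?E2 n)"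
      using E Nl(1) measure_Un_le[where A = "Nl \<union> ?E1 n" and B = "?E2 n" and M = M]
        measure_Un_le[where A = Nl and B = "?E1 n" and M = M] by auto
    also have "prob Nl = 0" using Nl(1) by (simp add: null_sets_def measure_def)
    finally show ?thesis using n by simp
  qed
  let ?N = "N n" and ?p = "p n" and ?\<xi> = "\<xi> n"
  note sp = sps[of n]
  have Bcont: "continuous_on {t0..} (\<lambda>t. W t \<omega>)" "continuous_on {t0..} (\<lambda>t. H t \<omega>)"
    "continuous_on {t0..} (\<lambda>t. I t \<omega>)" if "\<omega> \<in> B" for \<omega>
    using that Nl(2) by (auto simp: B_def)
  have "finite (D \<union> (?p ` {..?N} \<inter> {t0..T}))" "D \<union> (?p ` {..?N} \<inter> {t0..T}) \<subseteq> {t0..T}"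
    using D by auto
  from increasing_enumeration[OF T this]
  obtain q :: "nat \<Rightarrow> real" and m where q0: "q 0 = t0" and qm: "q m = T" and q: "strict_mono_on {..m} q"
    and Dq: "D \<union> (?p ` {..?N} \<inter> {t0..T}) \<subseteq> q ` {..m}" by blast
  have qS: "q j < q (Suc j)" if "j < m" for j using q that by (auto simp: strict_mono_on_def)
  have qle: "q i \<le> q j" if "i \<le> j" "j \<le> m" for i j
    using strict_mono_onD[OF q, of i j] that by (cases "i = j") auto
  have grid: "?p i \<notin> {q j<..<q (Suc j)}" if "i \<le> ?N" "j < m" for i j
  proof
    assume *: "?p i \<in> {q j<..<q (Suc j)}"
    then have "?p i \<in> {t0..T}" using qle[of 0 j] qle[of "Suc j" m] that q0 qm by auto
    then have "?p i \<in> q ` {..m}" using Dq that by blast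
    then obtain k where k: "k \<le> m" "?p i = q k" by blast
    then consider "k \<le> j" | "Suc j \<le> k" by linarith
    then show False
      using * k qle[of k j] qle[of "Suc j" k] that by cases auto
  qed
  let ?X = "\<lambda>j \<omega>. W (q (Suc j)) \<omega> - W (q j) \<omega>" and ?v = "\<lambda>j. q (Suc j) - q j"
    and ?\<eta> = "\<lambda>l. simple_process ?N ?p ?\<xi> (q (Suc l))"
  let ?e = "truncate K ?v ?\<eta>"
  obtain C where "predictable_transform M m (\<lambda>j. F (q j)) ?X ?v ?e C"
    using predictable_truncation[OF W sp q0 q grid] by blast
  then interpret P: predictable_transform M m "\<lambda>j. F (q j)" ?X ?v ?e C .
  let ?Z = "transform ?e ?X"
  have vn: "0 \<le> ?v l" if "l < m" for l using qS[OF that] by simp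
  define idx where "idx s = (SOME j. j \<le> m \<and> q j = s)" for s
  have idx: "idx s \<le> m" "q (idx s) = s" if "s \<in> D" for s
  proof -
    have "\<exists>j. j \<le> m \<and> q j = s" using Dq that by fastforce
    from someI_ex[OF this] show "idx s \<le> m" "q (idx s) = s" unfolding idx_def by blast+
  qed
  have Bvar: "(\<Sum>l<m. (?\<eta> l \<omega>)\<^sup>2 * ?v l) \<le> 2 * A \<omega> + 2" if "\<omega> \<in> B" for \<omega>
  proof -
    have "?X1 n \<omega> \<le> 1" using that by (auto simp: B_def)
    then show ?thesis
      using simple_process_variation_le[where q = q and m = m and \<omega> = \<omega> and H = H,
          OF sp q0 qm qS grid Bcont(2)[OF that]]
      unfolding A_def by simp
  qed
  have close: "\<bar>transform ?\<eta> ?X k \<omega> - I (q k) \<omega>\<bar> \<le> \<epsilon>" if "\<omega> \<in> B" "k \<le> m" for k \<omega>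
  proof -
    have qk: "q k \<in> {t0..T}" using qle[of 0 k] qle[of k m] that q0 qm by auto
    have "?X2 n \<omega> \<le> \<epsilon>" using that by (auto simp: B_def)
    moreover have "\<bar>simple_process_integral W ?N ?p ?\<xi> (q k) \<omega> - I (q k) \<omega>\<bar> \<le> ?X2 n \<omega>"
      by (rule simple_process_integral_le_SUP[where W = W and I = I and \<omega> = \<omega>,
          OF sp Bcont(1,3)[OF that(1)] qk])
    ultimately show ?thesis
      using simple_process_integral_transform[where q = q and m = m, OF sp q0 qS grid that(2), of W \<omega>]
      by simp
  qed
  have var_le: "expectation (\<lambda>\<omega>. (?Z j \<omega>)\<^sup>2) \<le> K"
    "ennreal (expectation (\<lambda>\<omega>. (?Z j \<omega>)\<^sup>2))
      \<le> (\<integral>\<^sup>+\<omega>. ennreal (2 * A \<omega> + 2) \<partial>M) + ennreal (K * \<delta>)" if j: "j \<le> m" for j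
  proof -
    let ?S = "\<lambda>\<omega>. \<Sum>l<j. (?e l \<omega>)\<^sup>2 * ?v l"
    have S_int: "integrable M ?S"
      using P.integrable_e_square j by (intro Bochner_Integration.integrable_sum) auto
    have S_nonneg: "0 \<le> ?S \<omega>" for \<omega> using vn j by (intro sum_nonneg) auto
    have S_K: "?S \<omega> \<le> K" for \<omega>
      by (rule truncate_variation(1)) (use vn j K in auto)
    have "expectation ?S \<le> expectation (\<lambda>\<omega>. K)"
      by (rule integral_mono) (use S_int S_K in auto)
    then show "expectation (\<lambda>\<omega>. (?Z j \<omega>)\<^sup>2) \<le> K"
      unfolding P.Z_moments(3)[OF j] by (simp add: prob_space)
    have S_B: "?S \<omega> \<le> 2 * A \<omega> + 2" if "\<omega> \<in> B" for \<omega>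
    proof -
      have "?S \<omega> \<le> (\<Sum>l<j. (?\<eta> l \<omega>)\<^sup>2 * ?v l)"
        by (rule truncate_variation(2)) (use vn j K in auto)
      also have "\<dots> \<le> (\<Sum>l<m. (?\<eta> l \<omega>)\<^sup>2 * ?v l)"
        using vn j by (intro sum_mono2) auto
      also note Bvar[OF that]
      finally show ?thesis .
    qed
    have "ennreal (expectation (\<lambda>\<omega>. (?Z j \<omega>)\<^sup>2)) = (\<integral>\<^sup>+\<omega>. ennreal (?S \<omega>) \<partial>M)"
      unfolding P.Z_moments(3)[OF j] using S_int S_nonneg
      by (intro nn_integral_eq_integral[symmetric]) auto
    also have "\<dots> \<le> (\<integral>\<^sup>+\<omega>. ennreal (2 * A \<omega> + 2) + ennreal K * indicator (space M - B) \<omega> \<partial>M)"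
    proof (rule nn_integral_mono)
      fix \<omega> assume "\<omega> \<in> space M"
      then show "ennreal (?S \<omega>) \<le> ennreal (2 * A \<omega> + 2) + ennreal K * indicator (space M - B) \<omega>"
      proof (cases "\<omega> \<in> B")
        case True
        then show ?thesis using S_B[OF True] by (simp add: ennreal_leI)
      next
        case False
        then have "ennreal (?S \<omega>) \<le> ennreal K * indicator (space M - B) \<omega>"
          using S_K[of \<omega>] \<open>\<omega> \<in> space M\<close> by (simp add: ennreal_leI)
        then show ?thesis by (rule order_trans) simp
      qed
    qed
    also have "\<dots> = (\<integral>\<^sup>+\<omega>. ennreal (2 * A \<omega> + 2) \<partial>M) + ennreal K * ennreal (prob (space M - B))"
      by (subst nn_integral_add) (auto simp: nn_integral_cmult_indicator emeasure_eq_measure)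
    also have "\<dots> \<le> (\<integral>\<^sup>+\<omega>. ennreal (2 * A \<omega> + 2) \<partial>M) + ennreal (K * \<delta>)"
      using PB K by (subst ennreal_mult[symmetric]) (auto intro!: add_left_mono ennreal_leI mult_left_mono)
    finally show "ennreal (expectation (\<lambda>\<omega>. (?Z j \<omega>)\<^sup>2))
      \<le> (\<integral>\<^sup>+\<omega>. ennreal (2 * A \<omega> + 2) \<partial>M) + ennreal (K * \<delta>)" .
  qed
  let ?Y = "\<lambda>\<omega>. running_max (\<lambda>i. ?Z i \<omega>) m"
  show thesis
  proof (rule that[of B "\<lambda>s. ?Z (idx s)" ?Y])
    show "B \<in> events" by (rule B)
    show "prob (space M - B) \<le> \<delta>" by (rule PB)
    show "?Z (idx s) \<in> borel_measurable M" if "s \<in> D" for s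
      using P.Z_measurable_M idx(1)[OF that] .
    show "integrable M (\<lambda>\<omega>. (?Z (idx s) \<omega>)\<^sup>2)" if "s \<in> D" for s
      using P.Z_moments(1) idx(1)[OF that] .
    show "expectation (?Z (idx s)) = 0" if "s \<in> D" for s
      using P.Z_moments(2) idx(1)[OF that] .
    show "expectation (\<lambda>\<omega>. (?Z (idx s) \<omega>)\<^sup>2) \<le> K" if "s \<in> D" for s
      using var_le(1) idx(1)[OF that] .
    show "ennreal (expectation (\<lambda>\<omega>. (?Z (idx s) \<omega>)\<^sup>2))
      \<le> (\<integral>\<^sup>+\<omega>. ennreal (2 * A \<omega> + 2) \<partial>M) + ennreal (K * \<delta>)" if "s \<in> D" for s
      using var_le(2) idx(1)[OF that] .
    show "?Y \<in> borel_measurable M"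
      using P.running_max_measurable[of m] P.measurable_G_M by blast
    show "integrable M (\<lambda>\<omega>. (?Y \<omega>)\<^sup>2)" using P.running_max_square_integrable by blast
    have "ennreal (expectation (\<lambda>\<omega>. (?Y \<omega>)\<^sup>2)) \<le> ennreal (4 * expectation (\<lambda>\<omega>. (?Z m \<omega>)\<^sup>2))"
      using P.doob_L2[of m] by (intro ennreal_leI) simp
    also have "\<dots> = 4 * ennreal (expectation (\<lambda>\<omega>. (?Z m \<omega>)\<^sup>2))"
      by (simp add: ennreal_mult)
    also have "\<dots> \<le> 4 * ((\<integral>\<^sup>+\<omega>. ennreal (2 * A \<omega> + 2) \<partial>M) + ennreal (K * \<delta>))"
      using var_le(2)[of m] by (intro mult_left_mono) auto
    finally show "ennreal (expectation (\<lambda>\<omega>. (?Y \<omega>)\<^sup>2))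
      \<le> 4 * ((\<integral>\<^sup>+\<omega>. ennreal (2 * A \<omega> + 2) \<partial>M) + ennreal (K * \<delta>))" .
    show "0 \<le> ?Y \<omega>" for \<omega>
      using le_running_max[of 0 m "\<lambda>i. ?Z i \<omega>"] by (simp add: transform_def)
    show "?Z (idx s) \<omega> \<le> ?Y \<omega>" if "s \<in> D" for s \<omega>
      using le_running_max[OF idx(1)[OF that], of "\<lambda>i. ?Z i \<omega>"] .
    show "\<exists>u\<in>{t0..s}. \<bar>?Z (idx s) \<omega> - I u \<omega>\<bar> \<le> \<epsilon>" if "s \<in> D" "\<omega> \<in> B" for s \<omega>
    proof -
      note s = idx[OF that(1)]
      obtain k where k: "k \<le> idx s" "?Z (idx s) \<omega> = transform ?\<eta> ?X k \<omega>"
        using transform_truncate(1)[of m ?v "idx s" K ?\<eta> ?X \<omega>] vn s(1) by blast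
      then have "q k \<in> {t0..s}" "k \<le> m"
        using qle[of 0 k] qle[of k "idx s"] s q0 by auto
      then show ?thesis using close[OF that(2), of k] k(2) by (intro bexI[of _ "q k"]) simp_all
    qed
    show "\<bar>?Z (idx s) \<omega> - I s \<omega>\<bar> \<le> \<epsilon>" if "s \<in> D" "\<omega> \<in> B" "2 * A \<omega> + 2 \<le> K" for s \<omega>
    proof -
      have "(\<Sum>l<m. (?\<eta> l \<omega>)\<^sup>2 * ?v l) \<le> K" using Bvar[OF that(2)] that(3) by simp
      then have "?Z (idx s) \<omega> = transform ?\<eta> ?X (idx s) \<omega>"
        using transform_truncate(2)[of m ?v "idx s" ?\<eta> \<omega> K ?X] vn idx(1)[OF that(1)] by blast
      then show ?thesis using close[OF that(2) idx(1)[OF that(1)]] idx(2)[OF that(1)] by simp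
    qed
  qed
qed

end

lemma (in prob_space) small_tail:
  fixes f :: "'a \<Rightarrow> real"
  assumes [measurable]: "f \<in> borel_measurable M" and "0 < e"
  obtains K where "0 \<le> K" "prob {\<omega>\<in>space M. K < f \<omega>} \<le> e"
proof -
  have "(\<lambda>n. prob {\<omega>\<in>space M. real n < f \<omega>}) \<longlonglongrightarrow> prob (\<Inter>n. {\<omega>\<in>space M. real n < f \<omega>})"
  proof (rule finite_Lim_measure_decseq)
    show "decseq (\<lambda>n. {\<omega>\<in>space M. real n < f \<omega>})"
      unfolding decseq_def by (auto dest: of_nat_mono[where 'a = real])
  qed auto
  also have "(\<Inter>n. {\<omega>\<in>space M. real n < f \<omega>}) = {}"
  proof -
    have "\<exists>n. \<not> real n < f \<omega>" for \<omega> using reals_Archimedean2[of "f \<omega>"] by (meson less_asym)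
    then show ?thesis by blast
  qed
  finally have "\<forall>\<^sub>F n in sequentially. prob {\<omega>\<in>space M. real n < f \<omega>} < e"
    using assms(2) by (intro order_tendstoD(2)[where y = "0::real"]) auto
  then obtain n where "prob {\<omega>\<in>space M. real n < f \<omega>} < e"
    unfolding eventually_sequentially by blast
  then show thesis using that[of "real n"] by simp
qed

text \<open>
  A weighted arithmetic-geometric mean inequality: multiplied by the indicator of a small event, it
  does the work of the Cauchy-Schwarz inequality.
\<close>

lemma abs_le_weighted_square: "\<bar>z\<bar> \<le> (c * z\<^sup>2 + 1 / c) / 2" if "0 < c" for z c :: real
proof -
  have "0 \<le> (c * \<bar>z\<bar> - 1)\<^sup>2 / (2 * c)" using that by (intro divide_nonneg_pos) auto
  also have "\<dots> = (c * z\<^sup>2 + 1 / c) / 2 - \<bar>z\<bar>"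
    using that by (simp add: power2_eq_square field_simps)
  finally show ?thesis by simp
qed

context stochastic_basis
begin

text \<open>
  The truncation level \<open>K\<close> is chosen so large that it is rarely reached, and only then the closeness
  of the simple process is chosen, so that \<open>(K + 1) * prob (space M - B)\<close> is small as well. This product
  bounds what \<open>Z\<close> can contribute outside \<open>B\<close>.
\<close>

lemma ito_approximation:
  assumes W: "brownian_motion M F t0 W" and ito: "has_ito_integral M F t0 W H I"
    and T: "t0 \<le> T" and D: "finite D" "D \<subseteq> {t0..T}" and \<eta>: "0 < \<eta>"
  defines "A \<equiv> \<lambda>\<omega>. LINT s:{t0..T}|lborel. (H s \<omega>)\<^sup>2"
  obtains K :: real and Z :: "real \<Rightarrow> 'a \<Rightarrow> real" and Y :: "'a \<Rightarrow> real" and B G :: "'a set"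
  where "0 \<le> K" "B \<in> events" "(K + 1) * prob (space M - B) \<le> \<eta>"
    and "G \<in> events" "G \<subseteq> B" "prob (space M - G) \<le> \<eta>"
    and "\<And>s. s \<in> D \<Longrightarrow> Z s \<in> borel_measurable M"
    and "\<And>s. s \<in> D \<Longrightarrow> integrable M (\<lambda>\<omega>. (Z s \<omega>)\<^sup>2)"
    and "\<And>s. s \<in> D \<Longrightarrow> expectation (Z s) = 0"
    and "\<And>s. s \<in> D \<Longrightarrow> expectation (\<lambda>\<omega>. (Z s \<omega>)\<^sup>2) \<le> K"
    and "\<And>s. s \<in> D \<Longrightarrow> ennreal (expectation (\<lambda>\<omega>. (Z s \<omega>)\<^sup>2))
      \<le> (\<integral>\<^sup>+\<omega>. ennreal (2 * A \<omega> + 2) \<partial>M) + ennreal \<eta>"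
    and "Y \<in> borel_measurable M" "integrable M (\<lambda>\<omega>. (Y \<omega>)\<^sup>2)"
    and "ennreal (expectation (\<lambda>\<omega>. (Y \<omega>)\<^sup>2))
      \<le> 4 * ((\<integral>\<^sup>+\<omega>. ennreal (2 * A \<omega> + 2) \<partial>M) + ennreal \<eta>)"
    and "\<And>\<omega>. 0 \<le> Y \<omega>" "\<And>s \<omega>. s \<in> D \<Longrightarrow> Z s \<omega> \<le> Y \<omega>"
    and "\<And>s \<omega>. s \<in> D \<Longrightarrow> \<omega> \<in> B \<Longrightarrow> \<exists>u\<in>{t0..s}. \<bar>Z s \<omega> - I u \<omega>\<bar> \<le> \<eta>"
    and "\<And>s \<omega>. s \<in> D \<Longrightarrow> \<omega> \<in> G \<Longrightarrow> \<bar>Z s \<omega> - I s \<omega>\<bar> \<le> \<eta>"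
proof -
  have A_measurable[measurable]: "A \<in> borel_measurable M"
    unfolding A_def using ito by (intro ito_variation_measurable) (simp add: has_ito_integral_def)
  obtain K where K: "0 \<le> K" and tail: "prob {\<omega>\<in>space M. K < 2 * A \<omega> + 2} \<le> \<eta> / 2"
    by (rule small_tail[of "\<lambda>\<omega>. 2 * A \<omega> + 2" "\<eta> / 2"]) (use \<eta> in auto)
  define \<delta> where "\<delta> = \<eta> / (2 * (K + 1))"
  have "k * (\<eta> / (2 * k)) = \<eta> / 2" if "0 < k" for k :: real using that by simp
  from this[of "K + 1"] have K\<delta>: "(K + 1) * \<delta> = \<eta> / 2" using K by (simp add: \<delta>_def)
  have \<delta>: "0 < \<delta>" using K \<eta> by (simp add: \<delta>_def)
  have "K * \<delta> + \<delta> = \<eta> / 2" using K\<delta> by (simp add: algebra_simps)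
  then have \<delta>': "\<delta> \<le> \<eta> / 2" "K * \<delta> \<le> \<eta>" using \<delta> \<eta> mult_nonneg_nonneg[OF K, of \<delta>] by linarith+
  show thesis
  proof (rule ito_truncated_approximation[OF W ito T D K \<eta> \<delta>])
    fix Z Y B
    assume B[measurable]: "B \<in> events" and PB: "prob (space M - B) \<le> \<delta>"
      and 1: "\<And>s. s \<in> D \<Longrightarrow> Z s \<in> borel_measurable M"
        "\<And>s. s \<in> D \<Longrightarrow> integrable M (\<lambda>\<omega>. (Z s \<omega>)\<^sup>2)"
        "\<And>s. s \<in> D \<Longrightarrow> expectation (Z s) = 0"
        "\<And>s. s \<in> D \<Longrightarrow> expectation (\<lambda>\<omega>. (Z s \<omega>)\<^sup>2) \<le> K"
      and EZ: "\<And>s. s \<in> D \<Longrightarrow> ennreal (expectation (\<lambda>\<omega>. (Z s \<omega>)\<^sup>2))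
        \<le> (\<integral>\<^sup>+\<omega>. ennreal (2 * (LINT s:{t0..T}|lborel. (H s \<omega>)\<^sup>2) + 2) \<partial>M) + ennreal (K * \<delta>)"
      and 2: "Y \<in> borel_measurable M" "integrable M (\<lambda>\<omega>. (Y \<omega>)\<^sup>2)"
      and EY: "ennreal (expectation (\<lambda>\<omega>. (Y \<omega>)\<^sup>2))
        \<le> 4 * ((\<integral>\<^sup>+\<omega>. ennreal (2 * (LINT s:{t0..T}|lborel. (H s \<omega>)\<^sup>2) + 2) \<partial>M) + ennreal (K * \<delta>))"
      and 3: "\<And>\<omega>. 0 \<le> Y \<omega>" "\<And>s \<omega>. s \<in> D \<Longrightarrow> Z s \<omega> \<le> Y \<omega>"
        "\<And>s \<omega>. s \<in> D \<Longrightarrow> \<omega> \<in> B \<Longrightarrow> \<exists>u\<in>{t0..s}. \<bar>Z s \<omega> - I u \<omega>\<bar> \<le> \<eta>"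
      and close: "\<And>s \<omega>. s \<in> D \<Longrightarrow> \<omega> \<in> B \<Longrightarrow> 2 * (LINT s:{t0..T}|lborel. (H s \<omega>)\<^sup>2) + 2 \<le> K
        \<Longrightarrow> \<bar>Z s \<omega> - I s \<omega>\<bar> \<le> \<eta>"
    let ?G = "B - {\<omega>\<in>space M. K < 2 * A \<omega> + 2}"
    have G: "?G \<in> events" by measurable
    have "prob (space M - ?G) \<le> prob ((space M - B) \<union> {\<omega>\<in>space M. K < 2 * A \<omega> + 2})"
      by (intro finite_measure_mono) auto
    also have "\<dots> \<le> prob (space M - B) + prob {\<omega>\<in>space M. K < 2 * A \<omega> + 2}"
      by (intro measure_Un_le) auto
    also have "\<dots> \<le> \<eta>" using PB \<delta>'(1) tail by linarith
    finally have PG: "prob (space M - ?G) \<le> \<eta>" .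
    have "(K + 1) * prob (space M - B) \<le> (K + 1) * \<delta>" using PB K by (intro mult_left_mono) auto
    then have PB': "(K + 1) * prob (space M - B) \<le> \<eta>" using K\<delta> \<eta> by simp
    have "ennreal (K * \<delta>) \<le> ennreal \<eta>" using \<delta>'(2) by (rule ennreal_leI)
    then have le: "(\<integral>\<^sup>+\<omega>. ennreal (2 * A \<omega> + 2) \<partial>M) + ennreal (K * \<delta>)
        \<le> (\<integral>\<^sup>+\<omega>. ennreal (2 * A \<omega> + 2) \<partial>M) + ennreal \<eta>" by (rule add_left_mono)
    show thesis
    proof (rule that[of K B ?G Z Y])
      show "ennreal (expectation (\<lambda>\<omega>. (Z s \<omega>)\<^sup>2))
        \<le> (\<integral>\<^sup>+\<omega>. ennreal (2 * A \<omega> + 2) \<partial>M) + ennreal \<eta>" if "s \<in> D" for s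
        unfolding A_def using order_trans[OF EZ[OF that] le[unfolded A_def]] .
      show "ennreal (expectation (\<lambda>\<omega>. (Y \<omega>)\<^sup>2))
        \<le> 4 * ((\<integral>\<^sup>+\<omega>. ennreal (2 * A \<omega> + 2) \<partial>M) + ennreal \<eta>)"
        unfolding A_def by (rule order_trans[OF EY mult_left_mono[OF le[unfolded A_def]]]) simp
      show "\<bar>Z s \<omega> - I s \<omega>\<bar> \<le> \<eta>" if "s \<in> D" "\<omega> \<in> ?G" for s \<omega>
        using close[of s \<omega>] that sets.sets_into_space[OF B] unfolding A_def by auto
    qed (rule K B PB' G Diff_subset PG 1 2 3 | assumption)+
  qed
qed

section \<open>Moments of Ito integrals\<close>

lemma ito_integral_measurable:
  "has_ito_integral M F t0 W H I \<Longrightarrow> t0 \<le> t \<Longrightarrow> I t \<in> borel_measurable M"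
  using measurable_F_M by (auto simp: has_ito_integral_def continuous_adapted_def)

text \<open>
  An Ito integral that stays above \<open>-\<zeta>\<close> has nonpositive mean. The martingale
  \<open>Z\<close> of the approximation has mean zero and, being close to a stopped version of \<open>I\<close>, is also at
  least \<open>-\<zeta>\<close> up to an error on \<open>B\<close>; so dropping the part of \<open>\<zeta> + Z\<close> where \<open>Z\<close> differs from \<open>I\<close>
  only decreases the expectation.
\<close>

lemma ito_integral_supermartingale:
  assumes W: "brownian_motion M F t0 W" and ito: "has_ito_integral M F t0 W H I" and t: "t0 \<le> t"
    and \<zeta>: "integrable M \<zeta>" and \<zeta>_nonneg: "AE \<omega> in M. 0 \<le> \<zeta> \<omega>"
    and lower: "AE \<omega> in M. \<forall>u\<in>{t0..t}. 0 \<le> \<zeta> \<omega> + I u \<omega>"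
  shows "(\<integral>\<^sup>+\<omega>. ennreal (\<zeta> \<omega> + I t \<omega>) \<partial>M) \<le> ennreal (expectation \<zeta>)"
proof (rule nn_integral_le_of_large_events)
  have [measurable]: "\<zeta> \<in> borel_measurable M" "I t \<in> borel_measurable M"
    using \<zeta> ito_integral_measurable[OF ito t] by auto
  show "(\<lambda>\<omega>. ennreal (\<zeta> \<omega> + I t \<omega>)) \<in> borel_measurable M" by measurable
  fix e :: real assume e: "0 < e"
  \<comment> \<open>With the weight \<open>c = e / (2 * (K + 1))\<close> below, \<open>c * E (Z\<^sup>2)\<close> is at most \<open>e / 2\<close>, and \<open>e\<^sup>2 / 8\<close> makes
    the probability of leaving \<open>B\<close>, divided by \<open>c\<close>, at most \<open>e / 4\<close>.\<close>
  define \<eta> where "\<eta> = min (e / 4) (e\<^sup>2 / 8)"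
  have \<eta>: "0 < \<eta>" "\<eta> \<le> e / 4" "\<eta> \<le> e\<^sup>2 / 8" using e by (auto simp: \<eta>_def)
  have D: "finite {t}" "{t} \<subseteq> {t0..t}" using t by auto
  show "\<exists>G\<in>events. prob (space M - G) \<le> e \<and>
    (\<integral>\<^sup>+\<omega>. ennreal (\<zeta> \<omega> + I t \<omega>) * indicator G \<omega> \<partial>M) \<le> ennreal (expectation \<zeta>) + ennreal e"
  proof (rule ito_approximation[OF W ito t D \<eta>(1)])
    fix K Z Y B G
    assume K: "0 \<le> K" and B[measurable]: "B \<in> events" and PB: "(K + 1) * prob (space M - B) \<le> \<eta>"
      and G[measurable]: "G \<in> events" and "G \<subseteq> B" and PG: "prob (space M - G) \<le> \<eta>"
      and "\<And>s. s \<in> {t} \<Longrightarrow> Z s \<in> borel_measurable M"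
        "\<And>s. s \<in> {t} \<Longrightarrow> integrable M (\<lambda>\<omega>. (Z s \<omega>)\<^sup>2)"
        "\<And>s. s \<in> {t} \<Longrightarrow> expectation (Z s) = 0"
        "\<And>s. s \<in> {t} \<Longrightarrow> expectation (\<lambda>\<omega>. (Z s \<omega>)\<^sup>2) \<le> K"
        "\<And>s \<omega>. s \<in> {t} \<Longrightarrow> \<omega> \<in> B \<Longrightarrow> \<exists>u\<in>{t0..s}. \<bar>Z s \<omega> - I u \<omega>\<bar> \<le> \<eta>"
        "\<And>s \<omega>. s \<in> {t} \<Longrightarrow> \<omega> \<in> G \<Longrightarrow> \<bar>Z s \<omega> - I s \<omega>\<bar> \<le> \<eta>"
    then have Z[measurable]: "Z t \<in> borel_measurable M" and Z2: "integrable M (\<lambda>\<omega>. (Z t \<omega>)\<^sup>2)"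
      and EZ: "expectation (Z t) = 0" and EZ2: "expectation (\<lambda>\<omega>. (Z t \<omega>)\<^sup>2) \<le> K"
      and ZB: "\<And>\<omega>. \<omega> \<in> B \<Longrightarrow> \<exists>u\<in>{t0..t}. \<bar>Z t \<omega> - I u \<omega>\<bar> \<le> \<eta>"
      and ZG: "\<And>\<omega>. \<omega> \<in> G \<Longrightarrow> \<bar>Z t \<omega> - I t \<omega>\<bar> \<le> \<eta>" by auto
    have Z1: "integrable M (Z t)" by (rule square_integrable_imp_integrable[OF Z Z2])
    define c where "c = e / (2 * (K + 1))"
    have c: "0 < c" using e K by (simp add: c_def)
    \<comment> \<open>The weighted square makes \<open>?U\<close> nonnegative also outside \<open>B\<close>, where \<open>Z\<close> has no pathwise lower bound.\<close>
    let ?U = "\<lambda>\<omega>. \<zeta> \<omega> + \<eta> + Z t \<omega> + (c * (Z t \<omega>)\<^sup>2 + 1 / c * indicator (space M - B) \<omega>) / 2"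
    have ind: "integrable M (indicator (space M - B) :: 'a \<Rightarrow> real)"
      by (simp add: emeasure_eq_measure)
    have U_int: "integrable M ?U"
      using \<zeta> Z1 Z2
      by (intro Bochner_Integration.integrable_add integrable_divide integrable_mult_right
          integrable_real_indicator) (auto simp: emeasure_eq_measure)
    have EU: "expectation ?U = expectation \<zeta> + \<eta>
        + (c * expectation (\<lambda>\<omega>. (Z t \<omega>)\<^sup>2) + 1 / c * prob (space M - B)) / 2"
      using \<zeta> Z1 Z2 EZ ind by (simp add: prob_space)
    have "c * expectation (\<lambda>\<omega>. (Z t \<omega>)\<^sup>2) \<le> c * (K + 1)"
      using EZ2 c by (intro mult_left_mono) auto
    also have "\<dots> = e / 2"
    proof -
      have "e / (2 * k) * k = e / 2" if "0 < k" for k :: real using that by simp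
      from this[of "K + 1"] show ?thesis using K by (simp add: c_def)
    qed
    finally have t1: "c * expectation (\<lambda>\<omega>. (Z t \<omega>)\<^sup>2) \<le> e / 2" .
    have "1 / c * prob (space M - B) = 2 / e * ((K + 1) * prob (space M - B))"
      using K e by (simp add: c_def)
    also have "\<dots> \<le> 2 / e * (e\<^sup>2 / 8)"
      using PB \<eta>(3) e by (intro mult_left_mono) auto
    also have "\<dots> = e / 4" using e by (simp add: power2_eq_square)
    finally have t2: "1 / c * prob (space M - B) \<le> e / 4" .
    have "E + \<eta> + (x + y) / 2 \<le> E + e" if "x \<le> e / 2" "y \<le> e / 4" for E x y :: real
      using that \<eta>(2) e by (simp add: field_simps)
    from this[OF t1 t2] have EU_le: "expectation ?U \<le> expectation \<zeta> + e" unfolding EU .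
    have U_nonneg: "AE \<omega> in M. 0 \<le> ?U \<omega>"
      using lower \<zeta>_nonneg AE_space
    proof eventually_elim
      case (elim \<omega>)
      show ?case
      proof (cases "\<omega> \<in> B")
        case True
        then obtain u where "u \<in> {t0..t}" "\<bar>Z t \<omega> - I u \<omega>\<bar> \<le> \<eta>" using ZB by blast
        then have "0 \<le> \<zeta> \<omega> + \<eta> + Z t \<omega>" using elim(1) by fastforce
        moreover have "0 \<le> (c * (Z t \<omega>)\<^sup>2 + 1 / c * indicator (space M - B) \<omega>) / 2"
          using c by (simp add: indicator_def)
        ultimately show ?thesis by simp
      next
        case False
        then have "(c * (Z t \<omega>)\<^sup>2 + 1 / c * indicator (space M - B) \<omega>) / 2
            = (c * (Z t \<omega>)\<^sup>2 + 1 / c) / 2" using elim(3) by simp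
        then show ?thesis
          using abs_le_weighted_square[OF c, of "Z t \<omega>"] elim(2) \<eta>(1) by linarith
      qed
    qed
    have "(\<integral>\<^sup>+\<omega>. ennreal (\<zeta> \<omega> + I t \<omega>) * indicator G \<omega> \<partial>M) \<le> (\<integral>\<^sup>+\<omega>. ennreal (?U \<omega>) \<partial>M)"
      using U_nonneg
    proof (intro nn_integral_mono_AE, eventually_elim)
      case (elim \<omega>)
      show ?case
      proof (cases "\<omega> \<in> G")
        case True
        then have "\<omega> \<in> B" using \<open>G \<subseteq> B\<close> by blast
        have "\<zeta> \<omega> + I t \<omega> \<le> \<zeta> \<omega> + \<eta> + Z t \<omega>" using ZG[OF True] by linarith
        moreover have "0 \<le> (c * (Z t \<omega>)\<^sup>2 + 1 / c * indicator (space M - B) \<omega>) / 2"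
          using c by (simp add: indicator_def)
        ultimately have "\<zeta> \<omega> + I t \<omega> \<le> ?U \<omega>" by linarith
        then show ?thesis using True by (simp add: ennreal_leI)
      qed simp
    qed
    also have "\<dots> = ennreal (expectation ?U)" by (rule nn_integral_eq_integral[OF U_int U_nonneg])
    also have "\<dots> \<le> ennreal (expectation \<zeta> + e)" using EU_le by (rule ennreal_leI)
    also have "\<dots> = ennreal (expectation \<zeta>) + ennreal e"
      using e integral_nonneg_AE[OF \<zeta>_nonneg] by (intro ennreal_plus) auto
    finally show ?thesis using G PG \<eta>(2) e by (intro bexI[of _ G]) auto
  qed
qed

text \<open>
  On the event \<open>G\<close> the integral is at most \<open>Y + 1 \<le> 2 + Y\<^sup>2\<close> on any finite set of times, where \<open>Y\<close> is the
  running maximum of the approximation, and Doob's inequality bounds \<open>Y\<close> in \<open>L\<^sup>2\<close> independently of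
  that set. A countable dense set of times suffices for continuous paths.
\<close>

lemma ito_integral_maximal:
  assumes W: "brownian_motion M F t0 W" and ito: "has_ito_integral M F t0 W H I" and T: "t0 \<le> T"
    and C: "countable C" "C \<subseteq> {t0..T}"
  shows "(\<integral>\<^sup>+\<omega>. (SUP s\<in>C. ennreal (I s \<omega>)) \<partial>M)
    \<le> 2 + 4 * ((\<integral>\<^sup>+\<omega>. ennreal (2 * (LINT s:{t0..T}|lborel. (H s \<omega>)\<^sup>2) + 2) \<partial>M) + 1)"
    (is "_ \<le> ?c")
proof -
  have I: "I s \<in> borel_measurable M" if "s \<in> C" for s
    using ito_integral_measurable[OF ito] C(2) that by auto
  have fin: "(\<integral>\<^sup>+\<omega>. (SUP s\<in>D. ennreal (I s \<omega>)) \<partial>M) \<le> ?c" if D: "finite D" "D \<subseteq> C" for D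
  proof (rule nn_integral_le_of_large_events)
    show "(\<lambda>\<omega>. SUP s\<in>D. ennreal (I s \<omega>)) \<in> borel_measurable M"
      using I D countable_finite
      by (intro borel_measurable_SUP measurable_compose[OF _ measurable_ennreal]) auto
    fix e :: real assume e: "0 < e"
    define \<eta> where "\<eta> = min e 1"
    have \<eta>: "0 < \<eta>" "\<eta> \<le> e" "\<eta> \<le> 1" using e by (auto simp: \<eta>_def)
    have D': "D \<subseteq> {t0..T}" using D C by auto
    show "\<exists>G\<in>events. prob (space M - G) \<le> e \<and>
      (\<integral>\<^sup>+\<omega>. (SUP s\<in>D. ennreal (I s \<omega>)) * indicator G \<omega> \<partial>M) \<le> ?c + ennreal e"
    proof (rule ito_approximation[OF W ito T D(1) D' \<eta>(1)])
      fix K Z Y B G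
      assume G: "G \<in> events" and PG: "prob (space M - G) \<le> \<eta>"
        and Y[measurable]: "Y \<in> borel_measurable M" and Y2: "integrable M (\<lambda>\<omega>. (Y \<omega>)\<^sup>2)"
        and EY: "ennreal (expectation (\<lambda>\<omega>. (Y \<omega>)\<^sup>2))
          \<le> 4 * ((\<integral>\<^sup>+\<omega>. ennreal (2 * (LINT s:{t0..T}|lborel. (H s \<omega>)\<^sup>2) + 2) \<partial>M) + ennreal \<eta>)"
        and ZY: "\<And>\<omega>. 0 \<le> Y \<omega>" "\<And>s \<omega>. s \<in> D \<Longrightarrow> Z s \<omega> \<le> Y \<omega>"
        and ZG: "\<And>s \<omega>. s \<in> D \<Longrightarrow> \<omega> \<in> G \<Longrightarrow> \<bar>Z s \<omega> - I s \<omega>\<bar> \<le> \<eta>"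
      have "(\<integral>\<^sup>+\<omega>. (SUP s\<in>D. ennreal (I s \<omega>)) * indicator G \<omega> \<partial>M)
          \<le> (\<integral>\<^sup>+\<omega>. 2 + ennreal ((Y \<omega>)\<^sup>2) \<partial>M)"
      proof (rule nn_integral_mono)
        fix \<omega>
        have "ennreal (I s \<omega>) \<le> 2 + ennreal ((Y \<omega>)\<^sup>2)" if "s \<in> D" "\<omega> \<in> G" for s
        proof -
          have "Y \<omega> \<le> 1 + (Y \<omega>)\<^sup>2" using abs_le_weighted_square[of 1 "Y \<omega>"] by simp
          then have "I s \<omega> \<le> 2 + (Y \<omega>)\<^sup>2"
            using ZG[OF that] ZY(2)[OF that(1), of \<omega>] \<eta>(3) by linarith
          then have "ennreal (I s \<omega>) \<le> ennreal (2 + (Y \<omega>)\<^sup>2)" by (rule ennreal_leI)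
          then show ?thesis by (simp add: ennreal_plus)
        qed
        then show "(SUP s\<in>D. ennreal (I s \<omega>)) * indicator G \<omega> \<le> 2 + ennreal ((Y \<omega>)\<^sup>2)"
          by (auto simp: indicator_def intro!: SUP_least)
      qed
      also have "\<dots> = 2 + ennreal (expectation (\<lambda>\<omega>. (Y \<omega>)\<^sup>2))"
        using Y2 by (simp add: nn_integral_add emeasure_space_1 nn_integral_eq_integral)
      also have "\<dots> \<le> ?c"
      proof (intro add_left_mono order_trans[OF EY] mult_left_mono add_left_mono)
        show "ennreal \<eta> \<le> 1" using \<eta>(3) by simp
      qed simp
      also have "?c \<le> ?c + ennreal e" by simp
      finally show ?thesis using G PG \<eta>(2) by (intro bexI[of _ G]) auto
    qed
  qed
  show ?thesis
  proof (cases "C = {}")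
    case True
    then show ?thesis by (simp add: bot_ennreal)
  next
    case False
    let ?f = "from_nat_into C"
    have ran: "range ?f = C" by (rule range_from_nat_into[OF False C(1)])
    have "(SUP s\<in>C. ennreal (I s \<omega>)) = (SUP n. SUP s\<in>?f ` {..n}. ennreal (I s \<omega>))" for \<omega>
    proof (rule antisym)
      show "(SUP s\<in>C. ennreal (I s \<omega>)) \<le> (SUP n. SUP s\<in>?f ` {..n}. ennreal (I s \<omega>))"
      proof (rule SUP_least)
        fix s assume "s \<in> C"
        then obtain n where "s = ?f n" using ran by blast
        then show "ennreal (I s \<omega>) \<le> (SUP n. SUP s\<in>?f ` {..n}. ennreal (I s \<omega>))"
          by (intro SUP_upper2[of n] SUP_upper) auto
      qed
      show "(SUP n. SUP s\<in>?f ` {..n}. ennreal (I s \<omega>)) \<le> (SUP s\<in>C. ennreal (I s \<omega>))"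
        using ran by (intro SUP_least SUP_upper) auto
    qed
    then have "(\<integral>\<^sup>+\<omega>. (SUP s\<in>C. ennreal (I s \<omega>)) \<partial>M)
        = (\<integral>\<^sup>+\<omega>. (SUP n. SUP s\<in>?f ` {..n}. ennreal (I s \<omega>)) \<partial>M)" by simp
    also have "\<dots> = (SUP n. \<integral>\<^sup>+\<omega>. (SUP s\<in>?f ` {..n}. ennreal (I s \<omega>)) \<partial>M)"
    proof (rule nn_integral_monotone_convergence_SUP)
      show "incseq (\<lambda>n \<omega>. SUP s\<in>?f ` {..n}. ennreal (I s \<omega>))"
        unfolding incseq_def le_fun_def by (intro allI impI SUP_subset_mono) auto
      show "(\<lambda>\<omega>. SUP s\<in>?f ` {..n}. ennreal (I s \<omega>)) \<in> borel_measurable M" for n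
        using I ran by (intro borel_measurable_SUP measurable_compose[OF _ measurable_ennreal]) auto
    qed
    also have "\<dots> \<le> ?c" using ran by (intro SUP_least fin) auto
    finally show ?thesis .
  qed
qed

text \<open>
  If the expected variation is finite, the second moments of the approximations are bounded. This
  bound passes to \<open>I t\<close>, and then \<open>I t - Z t\<close>, which is small with high probability and bounded in \<open>L\<^sup>2\<close>,
  is small in \<open>L\<^sup>1\<close>; but \<open>Z t\<close> has mean zero.
\<close>

lemma ito_integral_martingale:
  assumes W: "brownian_motion M F t0 W" and ito: "has_ito_integral M F t0 W H I" and t: "t0 \<le> t"
    and A: "(\<integral>\<^sup>+\<omega>. ennreal (LINT s:{t0..t}|lborel. (H s \<omega>)\<^sup>2) \<partial>M) < \<infinity>"
  shows "integrable M (I t)" "expectation (I t) = 0"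
proof -
  let ?A = "\<lambda>\<omega>. LINT s:{t0..t}|lborel. (H s \<omega>)\<^sup>2"
  have I[measurable]: "I t \<in> borel_measurable M" by (rule ito_integral_measurable[OF ito t])
  have D: "finite {t}" "{t} \<subseteq> {t0..t}" using t by auto
  have A_nonneg: "0 \<le> ?A \<omega>" for \<omega>
    unfolding set_lebesgue_integral_def by (intro integral_nonneg_AE) auto
  have [measurable]: "?A \<in> borel_measurable M"
    using ito by (intro ito_variation_measurable) (simp add: has_ito_integral_def)
  define V where "V = (\<integral>\<^sup>+\<omega>. ennreal (2 * ?A \<omega> + 2) \<partial>M) + 1"
  have "V = 2 * (\<integral>\<^sup>+\<omega>. ennreal (?A \<omega>) \<partial>M) + 2 + 1"
    using A_nonneg
    by (simp add: V_def ennreal_plus ennreal_mult nn_integral_add nn_integral_cmult emeasure_space_1)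
  then have V: "V < \<infinity>" using A by (simp add: ennreal_mult_less_top)
  have V_enn: "V = ennreal (enn2real V)" using V by simp
  have "(\<integral>\<^sup>+\<omega>. ennreal ((I t \<omega>)\<^sup>2) \<partial>M) \<le> 2 * V + 2"
  proof (rule nn_integral_le_of_large_events)
    show "(\<lambda>\<omega>. ennreal ((I t \<omega>)\<^sup>2)) \<in> borel_measurable M" by measurable
    fix e :: real assume e: "0 < e"
    define \<eta> where "\<eta> = min e 1"
    have \<eta>: "0 < \<eta>" "\<eta> \<le> e" "\<eta> \<le> 1" using e by (auto simp: \<eta>_def)
    show "\<exists>G\<in>events. prob (space M - G) \<le> e \<and>
      (\<integral>\<^sup>+\<omega>. ennreal ((I t \<omega>)\<^sup>2) * indicator G \<omega> \<partial>M) \<le> 2 * V + 2 + ennreal e"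
    proof (rule ito_approximation[OF W ito t D \<eta>(1)])
      fix K Z Y B G
      assume G: "G \<in> events" and PG: "prob (space M - G) \<le> \<eta>"
        and "\<And>s. s \<in> {t} \<Longrightarrow> Z s \<in> borel_measurable M"
          "\<And>s. s \<in> {t} \<Longrightarrow> integrable M (\<lambda>\<omega>. (Z s \<omega>)\<^sup>2)"
          "\<And>s. s \<in> {t} \<Longrightarrow> ennreal (expectation (\<lambda>\<omega>. (Z s \<omega>)\<^sup>2))
            \<le> (\<integral>\<^sup>+\<omega>. ennreal (2 * ?A \<omega> + 2) \<partial>M) + ennreal \<eta>"
          "\<And>s \<omega>. s \<in> {t} \<Longrightarrow> \<omega> \<in> G \<Longrightarrow> \<bar>Z s \<omega> - I s \<omega>\<bar> \<le> \<eta>"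
      then have Z[measurable]: "Z t \<in> borel_measurable M" and Z2: "integrable M (\<lambda>\<omega>. (Z t \<omega>)\<^sup>2)"
        and EZ: "ennreal (expectation (\<lambda>\<omega>. (Z t \<omega>)\<^sup>2))
            \<le> (\<integral>\<^sup>+\<omega>. ennreal (2 * ?A \<omega> + 2) \<partial>M) + ennreal \<eta>"
        and ZG: "\<And>\<omega>. \<omega> \<in> G \<Longrightarrow> \<bar>Z t \<omega> - I t \<omega>\<bar> \<le> \<eta>" by auto
      have "ennreal \<eta> \<le> 1" using \<eta>(3) by simp
      then have EZ': "ennreal (expectation (\<lambda>\<omega>. (Z t \<omega>)\<^sup>2)) \<le> V"
        unfolding V_def by (intro order_trans[OF EZ] add_left_mono)
      have "(\<integral>\<^sup>+\<omega>. ennreal ((I t \<omega>)\<^sup>2) * indicator G \<omega> \<partial>M)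
          \<le> (\<integral>\<^sup>+\<omega>. 2 * ennreal ((Z t \<omega>)\<^sup>2) + 2 \<partial>M)"
      proof (rule nn_integral_mono)
        fix \<omega>
        have "ennreal ((I t \<omega>)\<^sup>2) \<le> 2 * ennreal ((Z t \<omega>)\<^sup>2) + 2" if "\<omega> \<in> G"
        proof -
          have "\<bar>Z t \<omega> - I t \<omega>\<bar>\<^sup>2 \<le> 1\<^sup>2" using ZG[OF that] \<eta>(3) by (intro power_mono) auto
          moreover have "0 \<le> (2 * Z t \<omega> - I t \<omega>)\<^sup>2" by simp
          ultimately have "(I t \<omega>)\<^sup>2 \<le> 2 * (Z t \<omega>)\<^sup>2 + 2"
            by (simp add: power2_eq_square algebra_simps)
          then have "ennreal ((I t \<omega>)\<^sup>2) \<le> ennreal (2 * (Z t \<omega>)\<^sup>2 + 2)" by (rule ennreal_leI)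
          then show ?thesis by (simp add: ennreal_plus ennreal_mult)
        qed
        then show "ennreal ((I t \<omega>)\<^sup>2) * indicator G \<omega> \<le> 2 * ennreal ((Z t \<omega>)\<^sup>2) + 2"
          by (simp add: indicator_def)
      qed
      also have "\<dots> = 2 * ennreal (expectation (\<lambda>\<omega>. (Z t \<omega>)\<^sup>2)) + 2"
        using Z2 by (simp add: nn_integral_add nn_integral_cmult emeasure_space_1 nn_integral_eq_integral)
      also have "\<dots> \<le> 2 * V + 2" using EZ' by (intro add_right_mono mult_left_mono) auto
      also have "2 * V + 2 \<le> 2 * V + 2 + ennreal e" by simp
      finally show ?thesis using G PG \<eta>(2) by (intro bexI[of _ G]) auto
    qed
  qed
  also have "\<dots> < \<infinity>" using V by (simp add: ennreal_mult_less_top)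
  finally have I2: "integrable M (\<lambda>\<omega>. (I t \<omega>)\<^sup>2)" by (intro integrableI_nonneg) auto
  show I1: "integrable M (I t)" by (rule square_integrable_imp_integrable[OF I I2])
  define L where "L = 2 * expectation (\<lambda>\<omega>. (I t \<omega>)\<^sup>2) + 2 * enn2real V"
  have L: "0 \<le> L" by (auto simp: L_def)
  have "\<bar>expectation (I t)\<bar> \<le> 0 + e" if e: "0 < e" for e
  proof -
    define c where "c = e / (L + 1)"
    have c: "0 < c" using e L by (simp add: c_def add_nonneg_pos)
    define \<eta> where "\<eta> = min 1 (min (e / 4) (c * e / 4))"
    have \<eta>: "0 < \<eta>" "\<eta> \<le> 1" "\<eta> \<le> e / 4" "\<eta> \<le> c * e / 4" using e c by (auto simp: \<eta>_def)
    show ?thesis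
    proof (rule ito_approximation[OF W ito t D \<eta>(1)])
      fix K Z Y B G
      assume G[measurable]: "G \<in> events" and PG: "prob (space M - G) \<le> \<eta>"
        and "\<And>s. s \<in> {t} \<Longrightarrow> Z s \<in> borel_measurable M"
          "\<And>s. s \<in> {t} \<Longrightarrow> integrable M (\<lambda>\<omega>. (Z s \<omega>)\<^sup>2)"
          "\<And>s. s \<in> {t} \<Longrightarrow> expectation (Z s) = 0"
          "\<And>s. s \<in> {t} \<Longrightarrow> ennreal (expectation (\<lambda>\<omega>. (Z s \<omega>)\<^sup>2))
            \<le> (\<integral>\<^sup>+\<omega>. ennreal (2 * ?A \<omega> + 2) \<partial>M) + ennreal \<eta>"
          "\<And>s \<omega>. s \<in> {t} \<Longrightarrow> \<omega> \<in> G \<Longrightarrow> \<bar>Z s \<omega> - I s \<omega>\<bar> \<le> \<eta>"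
      then have Z[measurable]: "Z t \<in> borel_measurable M" and Z2: "integrable M (\<lambda>\<omega>. (Z t \<omega>)\<^sup>2)"
        and EZ: "expectation (Z t) = 0"
        and EZ2: "ennreal (expectation (\<lambda>\<omega>. (Z t \<omega>)\<^sup>2))
            \<le> (\<integral>\<^sup>+\<omega>. ennreal (2 * ?A \<omega> + 2) \<partial>M) + ennreal \<eta>"
        and ZG: "\<And>\<omega>. \<omega> \<in> G \<Longrightarrow> \<bar>Z t \<omega> - I t \<omega>\<bar> \<le> \<eta>" by auto
      have Z1: "integrable M (Z t)" by (rule square_integrable_imp_integrable[OF Z Z2])
      have "ennreal \<eta> \<le> 1" using \<eta>(2) by simp
      then have "ennreal (expectation (\<lambda>\<omega>. (Z t \<omega>)\<^sup>2)) \<le> ennreal (enn2real V)"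
        unfolding V_enn[symmetric] unfolding V_def by (intro order_trans[OF EZ2] add_left_mono)
      then have EZ': "expectation (\<lambda>\<omega>. (Z t \<omega>)\<^sup>2) \<le> enn2real V"
        by (simp add: ennreal_le_iff)
      let ?Q = "\<lambda>\<omega>. I t \<omega> - Z t \<omega>"
      have Q2: "integrable M (\<lambda>\<omega>. (?Q \<omega>)\<^sup>2)"
        using square_integrable_add[of "I t" M "\<lambda>\<omega>. - Z t \<omega>"] I2 Z2 by simp
      have "expectation (\<lambda>\<omega>. (?Q \<omega>)\<^sup>2) \<le> expectation (\<lambda>\<omega>. 2 * (I t \<omega>)\<^sup>2 + 2 * (Z t \<omega>)\<^sup>2)"
      proof (rule integral_mono)
        fix \<omega>
        have "0 \<le> (I t \<omega> + Z t \<omega>)\<^sup>2" by simp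
        then show "(?Q \<omega>)\<^sup>2 \<le> 2 * (I t \<omega>)\<^sup>2 + 2 * (Z t \<omega>)\<^sup>2"
          by (simp add: power2_eq_square algebra_simps)
      qed (use Q2 I2 Z2 in auto)
      also have "\<dots> \<le> L" using I2 Z2 EZ' by (simp add: L_def)
      finally have EQ: "expectation (\<lambda>\<omega>. (?Q \<omega>)\<^sup>2) \<le> L" .
      have ind: "integrable M (indicator (space M - G) :: 'a \<Rightarrow> real)"
        by (simp add: emeasure_eq_measure)
      let ?U = "\<lambda>\<omega>. \<eta> + (c * (?Q \<omega>)\<^sup>2 + 1 / c * indicator (space M - G) \<omega>) / 2"
      have "\<bar>expectation (I t)\<bar> = \<bar>expectation ?Q\<bar>" using I1 Z1 EZ by simp
      also have "\<dots> \<le> expectation (\<lambda>\<omega>. \<bar>?Q \<omega>\<bar>)" by (rule integral_abs_bound)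
      also have "\<dots> \<le> expectation ?U"
      proof (rule integral_mono)
        fix \<omega> assume \<omega>: "\<omega> \<in> space M"
        show "\<bar>?Q \<omega>\<bar> \<le> ?U \<omega>"
        proof (cases "\<omega> \<in> G")
          case True
          then have "\<bar>?Q \<omega>\<bar> \<le> \<eta>" using ZG[OF True] by linarith
          moreover have "0 \<le> c * (?Q \<omega>)\<^sup>2" using c by simp
          ultimately show ?thesis using True by simp
        next
          case False
          then have "indicator (space M - G) \<omega> = (1::real)" using \<omega> by simp
          then have "?U \<omega> = \<eta> + (c * (?Q \<omega>)\<^sup>2 + 1 / c) / 2" by simp
          then show ?thesis using abs_le_weighted_square[OF c, of "?Q \<omega>"] \<eta>(1) by linarith
        qed
      qed (use I1 Z1 Q2 ind in auto)
      also have "\<dots> = \<eta> + (c * expectation (\<lambda>\<omega>. (?Q \<omega>)\<^sup>2) + 1 / c * prob (space M - G)) / 2"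
        using Q2 ind by (simp add: prob_space)
      also have "\<dots> \<le> 0 + e"
      proof -
        have "c * expectation (\<lambda>\<omega>. (?Q \<omega>)\<^sup>2) \<le> c * (L + 1)" using EQ c by (intro mult_left_mono) auto
        also have "\<dots> = e" using L by (simp add: c_def)
        finally have 1: "c * expectation (\<lambda>\<omega>. (?Q \<omega>)\<^sup>2) \<le> e" .
        have "1 / c * prob (space M - G) \<le> 1 / c * (c * e / 4)"
          using PG \<eta>(4) c by (intro mult_left_mono) auto
        also have "\<dots> = e / 4" using c by simp
        finally have 2: "1 / c * prob (space M - G) \<le> e / 4" .
        have "\<eta> + (x + y) / 2 \<le> 0 + e" if "x \<le> e" "y \<le> e / 4" for x y :: real
          using that \<eta>(3) e by (simp add: field_simps)
        from this[OF 1 2] show ?thesis .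
      qed
      finally show ?thesis .
    qed
  qed
  then have "\<bar>expectation (I t)\<bar> \<le> 0" by (rule field_le_epsilon)
  then show "expectation (I t) = 0" by simp
qed

end

section \<open>Linear integral equations\<close>

lemma set_integral_split:
  fixes f :: "real \<Rightarrow> real"
  assumes "set_integrable lborel {x..z} f" "x \<le> y" "y \<le> z"
  shows "(LINT s:{x..z}|lborel. f s) = (LINT s:{x..y}|lborel. f s) + (LINT s:{y..z}|lborel. f s)"
proof -
  have "{x..z} = {x..y} \<union> {y..z}" using assms(2,3) by auto
  moreover have "AE s in lborel. \<not> (s \<in> {x..y} \<and> s \<in> {y..z})"
    using AE_lborel_singleton[of y] by eventually_elim auto
  moreover have "set_integrable lborel {x..y} f" "set_integrable lborel {y..z} f"
    using assms by (auto intro: set_integrable_subset[OF assms(1)])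
  ultimately show ?thesis by (simp add: set_integral_Un_AE)
qed

text \<open>
  For merely integrable \<open>h\<close> the equation holds only in integrated form, so the usual
  product rule is replaced by Fubini's theorem on the triangle \<open>t1 \<le> s \<le> u \<le> t\<close>, applied to
  \<open>h s * a * exp (- a * (t - u))\<close>.
\<close>

lemma variation_of_constants:
  fixes h m :: "real \<Rightarrow> real"
  assumes a: "0 < a" and t: "t1 \<le> t" and h: "set_integrable lborel {t1..t} h"
    and m: "\<And>s. s \<in> {t1..t} \<Longrightarrow> m s = m t1 + (LINT u:{t1..s}|lborel. h u)"
  shows "set_integrable lborel {t1..t} (\<lambda>u. exp (- a * (t - u)) * (h u + a * m u))"
    and "m t = exp (- a * (t - t1)) * m t1
      + (LINT u:{t1..t}|lborel. exp (- a * (t - u)) * (h u + a * m u))"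
proof -
  let ?e = "\<lambda>u. exp (- a * (t - u))"
  let ?h = "\<lambda>s. indicator {t1..t} s * h s"
  have hi: "integrable lborel ?h" using h by (simp add: set_integrable_def)
  then have [measurable]: "?h \<in> borel_measurable borel" by (auto dest: borel_measurable_integrable)
  have ftc: "integrable lborel (\<lambda>u. indicator {s..t} u * (a * ?e u))"
    "(\<integral>u. indicator {s..t} u * (a * ?e u) \<partial>lborel) = 1 - ?e s" if "s \<le> t" for s
  proof -
    have c: "continuous_on {s..t} (\<lambda>u. a * ?e u)" by (intro continuous_intros)
    show "integrable lborel (\<lambda>u. indicator {s..t} u * (a * ?e u))"
      using borel_integrable_atLeastAtMost'[OF c] by (simp add: set_integrable_def)
    have "(\<integral>u. indicator {s..t} u *\<^sub>R (a * ?e u) \<partial>lborel) = ?e t - ?e s"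
    proof (rule integral_FTC_atLeastAtMost[OF that _ c])
      show "(?e has_vector_derivative a * ?e x) (at x within {s..t})" for x
        by (auto intro!: derivative_eq_intros simp flip: has_real_derivative_iff_has_vector_derivative)
    qed
    then show "(\<integral>u. indicator {s..t} u * (a * ?e u) \<partial>lborel) = 1 - ?e s" by simp
  qed
  define f where "f = (\<lambda>s u. ?h s * (indicator {s..t} u * (a * ?e u)))"
  have f_eq: "f s u = indicator {t1..t} u * (a * ?e u) * (indicator {t1..u} s * h s)" for s u
    by (auto simp: f_def indicator_def)
  have f_inner: "integrable lborel (f s)" "(\<integral>u. f s u \<partial>lborel) = ?h s * (1 - ?e s)"
    "(\<integral>u. norm (f s u) \<partial>lborel) = \<bar>?h s\<bar> * (1 - ?e s)" for s
  proof -
    have "integrable lborel (f s) \<and> (\<integral>u. f s u \<partial>lborel) = ?h s * (1 - ?e s)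
      \<and> (\<integral>u. norm (f s u) \<partial>lborel) = \<bar>?h s\<bar> * (1 - ?e s)"
    proof (cases "s \<le> t")
      case True
      have "norm (f s u) = \<bar>?h s\<bar> * (indicator {s..t} u * (a * ?e u))" for u
        using a by (simp add: f_def abs_mult indicator_def)
      then show ?thesis using ftc[OF True] by (simp add: f_def)
    next
      case False
      then show ?thesis by (simp add: f_def)
    qed
    then show "integrable lborel (f s)" "(\<integral>u. f s u \<partial>lborel) = ?h s * (1 - ?e s)"
      "(\<integral>u. norm (f s u) \<partial>lborel) = \<bar>?h s\<bar> * (1 - ?e s)" by blast+
  qed
  have he: "integrable lborel (\<lambda>s. ?h s * ?e s)"
  proof (rule Bochner_Integration.integrable_bound[OF hi])
    show "(\<lambda>s. ?h s * ?e s) \<in> borel_measurable lborel" by measurable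
    show "AE s in lborel. norm (?h s * ?e s) \<le> norm (?h s)"
    proof (rule AE_I2)
      fix s
      have "?e s \<le> 1" if "s \<le> t" using a that by simp
      then show "norm (?h s * ?e s) \<le> norm (?h s)"
        by (auto simp: indicator_def abs_mult intro!: mult_left_le)
    qed
  qed
  have fi: "integrable (lborel \<Otimes>\<^sub>M lborel) (case_prod f)"
  proof (rule lborel_pair.Fubini_integrable)
    have "case_prod f = (\<lambda>(s, u). ?h s * ((if s \<le> u \<and> u \<le> t then 1 else 0) * (a * ?e u)))"
      by (auto simp: f_def indicator_def)
    also have "\<dots> \<in> borel_measurable (lborel \<Otimes>\<^sub>M lborel)" by measurable
    finally show "case_prod f \<in> borel_measurable (lborel \<Otimes>\<^sub>M lborel)" .
    have "integrable lborel (\<lambda>s. \<bar>?h s - ?h s * ?e s\<bar>)" using hi he by auto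
    moreover have "\<bar>?h s - ?h s * ?e s\<bar> = \<bar>?h s\<bar> * (1 - ?e s)" for s
    proof (cases "s \<in> {t1..t}")
      case True
      then have "0 \<le> 1 - ?e s" using a by simp
      moreover have "?h s - ?h s * ?e s = ?h s * (1 - ?e s)" by (simp add: right_diff_distrib)
      ultimately show ?thesis by (simp only: abs_mult abs_of_nonneg)
    qed simp
    ultimately have "integrable lborel (\<lambda>s. \<bar>?h s\<bar> * (1 - ?e s))" by (simp only:)
    then show "integrable lborel (\<lambda>s. \<integral>u. norm (case_prod f (s, u)) \<partial>lborel)"
      unfolding case_prod_conv f_inner(3) .
    show "AE s in lborel. integrable lborel (\<lambda>u. case_prod f (s, u))"
      using f_inner(1) by simp
  qed
  have in_s: "(\<integral>s. f s u \<partial>lborel) = indicator {t1..t} u * (a * ?e u) * (m u - m t1)" for u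
    unfolding f_eq using m[of u] by (auto simp: indicator_def set_lebesgue_integral_def)
  have mi: "integrable lborel (\<lambda>u. indicator {t1..t} u * (a * ?e u) * (m u - m t1))"
    using lborel_pair.integrable_snd[OF fi] unfolding in_s .
  have "(\<integral>u. indicator {t1..t} u * (a * ?e u) * (m u - m t1) \<partial>lborel) = (\<integral>s. ?h s * (1 - ?e s) \<partial>lborel)"
    using lborel_pair.Fubini_integral[OF fi] unfolding in_s f_inner(2) .
  also have "\<dots> = (\<integral>s. ?h s \<partial>lborel) - (\<integral>s. ?h s * ?e s \<partial>lborel)"
    using hi he by (simp add: right_diff_distrib)
  also have "(\<integral>s. ?h s \<partial>lborel) = m t - m t1"
    using m[of t] t by (simp add: set_lebesgue_integral_def)
  finally have fub: "(\<integral>u. indicator {t1..t} u * (a * ?e u) * (m u - m t1) \<partial>lborel)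
      = m t - m t1 - (\<integral>s. ?h s * ?e s \<partial>lborel)" .
  let ?p = "\<lambda>u. indicator {t1..t} u * (a * ?e u)"
  have split: "indicator {t1..t} u *\<^sub>R (?e u * (h u + a * m u))
      = ?h u * ?e u + ?p u * (m u - m t1) + ?p u * m t1" for u
    by (simp add: algebra_simps)
  have pi: "integrable lborel (\<lambda>u. ?p u * m t1)" "(\<integral>u. ?p u * m t1 \<partial>lborel) = (1 - ?e t1) * m t1"
    using ftc[OF t] by auto
  show "set_integrable lborel {t1..t} (\<lambda>u. ?e u * (h u + a * m u))"
    unfolding set_integrable_def split using he mi pi(1) by (intro Bochner_Integration.integrable_add)
  have "(LINT u:{t1..t}|lborel. ?e u * (h u + a * m u))
      = (\<integral>s. ?h s * ?e s \<partial>lborel) + (\<integral>u. ?p u * (m u - m t1) \<partial>lborel) + (\<integral>u. ?p u * m t1 \<partial>lborel)"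
    unfolding set_lebesgue_integral_def split using he mi pi(1)
    by (subst Bochner_Integration.integral_add; (intro Bochner_Integration.integrable_add)?;
        (subst Bochner_Integration.integral_add)?; simp)
  then show "m t = ?e t1 * m t1 + (LINT u:{t1..t}|lborel. ?e u * (h u + a * m u))"
    using fub pi(2) by (simp add: algebra_simps)
qed

section \<open>The fixed delay CIR process\<close>

lemma (in prob_space) expectation_set_integral:
  fixes P :: "real \<Rightarrow> 'a \<Rightarrow> real"
  assumes P[measurable]: "(\<lambda>(s, \<omega>). P s \<omega>) \<in> borel_measurable (borel \<Otimes>\<^sub>M M)"
    and nonneg: "\<And>s \<omega>. 0 \<le> P s \<omega>"
    and fin: "(\<integral>\<^sup>+s\<in>{x..y}. (\<integral>\<^sup>+\<omega>. ennreal (P s \<omega>) \<partial>M) \<partial>lborel) < \<infinity>"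
  shows "integrable M (\<lambda>\<omega>. LINT s:{x..y}|lborel. P s \<omega>)"
    and "set_integrable lborel {x..y} (\<lambda>s. expectation (P s))"
    and "expectation (\<lambda>\<omega>. LINT s:{x..y}|lborel. P s \<omega>) = (LINT s:{x..y}|lborel. expectation (P s))"
proof -
  interpret Q: pair_sigma_finite lborel M by unfold_locales
  let ?f = "\<lambda>s \<omega>. indicator {x..y} s * P s \<omega>"
  have [measurable]: "case_prod ?f \<in> borel_measurable (lborel \<Otimes>\<^sub>M M)" by measurable
  have "(\<integral>\<^sup>+z. ennreal (norm (case_prod ?f z)) \<partial>(lborel \<Otimes>\<^sub>M M))
      = (\<integral>\<^sup>+s. \<integral>\<^sup>+\<omega>. ennreal (norm (case_prod ?f (s, \<omega>))) \<partial>M \<partial>lborel)"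
    by (rule nn_integral_fst[symmetric]) measurable
  also have "\<dots> = (\<integral>\<^sup>+s\<in>{x..y}. (\<integral>\<^sup>+\<omega>. ennreal (P s \<omega>) \<partial>M) \<partial>lborel)"
    using nonneg by (intro nn_integral_cong) (auto simp: indicator_def)
  finally have int: "integrable (lborel \<Otimes>\<^sub>M M) (case_prod ?f)"
    using fin by (intro integrableI_bounded) auto
  show "integrable M (\<lambda>\<omega>. LINT s:{x..y}|lborel. P s \<omega>)"
    using Q.integrable_snd[OF int] by (simp add: set_lebesgue_integral_def)
  show "set_integrable lborel {x..y} (\<lambda>s. expectation (P s))"
    using Q.integrable_fst[OF int] by (simp add: set_integrable_def)
  show "expectation (\<lambda>\<omega>. LINT s:{x..y}|lborel. P s \<omega>) = (LINT s:{x..y}|lborel. expectation (P s))"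
    using Q.Fubini_integral[OF int] by (simp add: set_lebesgue_integral_def)
qed

text \<open>
  The maximum over the interval is attained, and the maximiser is a limit of points of \<open>C\<close>. For
  countable \<open>C\<close> the right-hand side is visibly measurable in a parameter of \<open>f\<close>.
\<close>

lemma ennreal_SUP_dense:
  fixes f :: "real \<Rightarrow> real"
  assumes f: "continuous_on {x..y} f" and xy: "x \<le> y"
    and C: "C \<subseteq> {x..y}" "{x..y} \<subseteq> closure C"
  shows "ennreal (SUP u\<in>{x..y}. f u) = (SUP u\<in>C. ennreal (f u))"
proof -
  obtain z where z: "z \<in> {x..y}" "\<And>u. u \<in> {x..y} \<Longrightarrow> f u \<le> f z"
    using continuous_attains_sup[of "{x..y}" f] f xy by auto
  have S: "(SUP u\<in>{x..y}. f u) = f z"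
    using z by (intro cSup_eq_maximum) auto
  obtain w where w: "\<And>n. w n \<in> C" "w \<longlonglongrightarrow> z"
    using C(2) z(1) closure_sequential[of z C] by blast
  have "(\<lambda>n. f (w n)) \<longlonglongrightarrow> f z"
  proof (rule continuous_on_tendsto_compose[OF f w(2) z(1)])
    show "\<forall>\<^sub>F n in sequentially. w n \<in> {x..y}" using w(1) C(1) by (intro always_eventually) blast
  qed
  then have "(\<lambda>n. ennreal (f (w n))) \<longlonglongrightarrow> ennreal (f z)" by (rule tendsto_ennrealI)
  then have "ennreal (f z) \<le> (SUP u\<in>C. ennreal (f u))"
    by (rule LIMSEQ_le_const2) (use w(1) in \<open>auto intro!: exI[of _ 0] SUP_upper\<close>)
  moreover have "(SUP u\<in>C. ennreal (f u)) \<le> ennreal (f z)"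
    using C(1) z(2) by (intro SUP_least ennreal_leI) auto
  ultimately show ?thesis unfolding S by (rule antisym)
qed

lemma set_integral_nonneg_mono:
  fixes f :: "real \<Rightarrow> real"
  assumes "set_integrable lborel {x..z} f" "\<And>s. 0 \<le> f s" "y \<le> z"
  shows "0 \<le> (LINT s:{x..y}|lborel. f s)" "(LINT s:{x..y}|lborel. f s) \<le> (LINT s:{x..z}|lborel. f s)"
proof -
  have "set_integrable lborel {x..y} f"
    using assms(3) by (intro set_integrable_subset[OF assms(1)]) auto
  then show "(LINT s:{x..y}|lborel. f s) \<le> (LINT s:{x..z}|lborel. f s)"
    unfolding set_lebesgue_integral_def set_integrable_def
    using assms by (intro integral_mono) (auto simp: set_integrable_def indicator_def)
  show "0 \<le> (LINT s:{x..y}|lborel. f s)"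
    unfolding set_lebesgue_integral_def using assms(2) by (intro integral_nonneg_AE) auto
qed

text \<open>
  The equation for a version \<open>R\<close> of the process whose paths are all continuous and nonnegative, with
  the mean level extended by zero to the times before \<open>t0\<close> (called \<open>g\<close>). The integrand \<open>H\<close> and the
  integral \<open>I\<close> stay those of the original process.
\<close>

locale regular_delay_CIR = stochastic_basis M F t0
  for M :: "'a measure" and F t0 +
  fixes W H I R :: "real \<Rightarrow> 'a \<Rightarrow> real" and g :: "real \<Rightarrow> real" and \<tau> a b \<sigma> :: real
  assumes W: "brownian_motion M F t0 W" and ito: "has_ito_integral M F t0 W H I"
    and H: "AE \<omega> in M. \<forall>s\<ge>t0. (H s \<omega>)\<^sup>2 = \<sigma>\<^sup>2 * R s \<omega>"
    and R_measurable[measurable]: "(\<lambda>(s, \<omega>). R s \<omega>) \<in> borel_measurable (borel \<Otimes>\<^sub>M M)"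
    and R_nonneg: "0 \<le> R s \<omega>" and R_continuous: "continuous_on UNIV (\<lambda>s. R s \<omega>)"
    and g_nonneg: "0 \<le> g s" and g_integrable: "set_integrable lborel {t0..T} g"
    and \<tau>: "0 < \<tau>" and a: "0 < a" and b: "0 \<le> b"
    and equation: "AE \<omega> in M. \<forall>t\<ge>t0. R t \<omega> = R t0 \<omega>
      + (LINT s:{t0..t}|lborel. a * (g s - R s \<omega>) + b * R (s - \<tau>) \<omega>) + I t \<omega>"
    and initial_segment_mean: "(\<integral>\<^sup>+u\<in>{t0-\<tau>..t0}. (\<integral>\<^sup>+\<omega>. ennreal (R u \<omega>) \<partial>M) \<partial>lborel) < \<infinity>"
    and initial_mean: "(\<integral>\<^sup>+\<omega>. ennreal (R t0 \<omega>) \<partial>M) < \<infinity>"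
begin

lemma R_measurable1[measurable]: "R s \<in> borel_measurable M"
  using measurable_compose_Pair1[OF _ R_measurable, of s] by simp

lemma R_integrable_path:
  "set_integrable lborel {x..y} (\<lambda>s. R s \<omega>)" "set_integrable lborel {x..y} (\<lambda>s. R (s - \<tau>) \<omega>)"
proof -
  show "set_integrable lborel {x..y} (\<lambda>s. R s \<omega>)"
    by (rule borel_integrable_atLeastAtMost') (rule continuous_on_subset[OF R_continuous], simp)
  show "set_integrable lborel {x..y} (\<lambda>s. R (s - \<tau>) \<omega>)"
    by (intro borel_integrable_atLeastAtMost' continuous_on_compose2[OF R_continuous] continuous_intros) auto
qed

lemma drift_split:
  "(LINT s:{t0..t}|lborel. a * (g s - R s \<omega>) + b * R (s - \<tau>) \<omega>)
    = a * (LINT s:{t0..t}|lborel. g s) - a * (LINT s:{t0..t}|lborel. R s \<omega>)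
      + b * (LINT s:{t0..t}|lborel. R (s - \<tau>) \<omega>)"
  using R_integrable_path[of t0 t \<omega>] g_integrable[of t]
  by (simp add: set_integral_add set_integral_diff right_diff_distrib set_integral_mult_right
      set_integrable_mult_right)

text \<open>
  Dropping the nonpositive term \<open>- a * R\<close> from the drift leaves an expression that increases with time.
  Its value at \<open>T\<close> dominates \<open>R - I\<close> on the whole interval \<open>[t0, T]\<close>, and involves the process only up to
  time \<open>T - \<tau>\<close>.
\<close>

definition bound :: "real \<Rightarrow> 'a \<Rightarrow> real" where
  "bound T \<omega> = R t0 \<omega> + a * (LINT s:{t0..T}|lborel. g s)
    + b * (LINT s:{t0..T}|lborel. R (s - \<tau>) \<omega>)"

lemma bound_nonneg: "0 \<le> bound T \<omega>"
  using R_nonneg a b set_integral_nonneg_mono(1)[OF g_integrable[of T] g_nonneg order_refl]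
    set_integral_nonneg_mono(1)[OF R_integrable_path(2)[of t0 T \<omega>] R_nonneg order_refl]
  by (simp add: bound_def)

lemma R_le_bound:
  "AE \<omega> in M. \<forall>u\<in>{t0..T}. R u \<omega> \<le> bound T \<omega> + I u \<omega>"
  using equation
proof eventually_elim
  case (elim \<omega>)
  show ?case
  proof
    fix u assume u: "u \<in> {t0..T}"
    have "a * (LINT s:{t0..u}|lborel. g s) \<le> a * (LINT s:{t0..T}|lborel. g s)"
      using set_integral_nonneg_mono(2)[OF g_integrable[of T] g_nonneg] u a
      by (intro mult_left_mono) auto
    moreover have "b * (LINT s:{t0..u}|lborel. R (s - \<tau>) \<omega>) \<le> b * (LINT s:{t0..T}|lborel. R (s - \<tau>) \<omega>)"
      using set_integral_nonneg_mono(2)[OF R_integrable_path(2)[of t0 T \<omega>] R_nonneg] u b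
      by (intro mult_left_mono) auto
    moreover have "0 \<le> a * (LINT s:{t0..u}|lborel. R s \<omega>)"
      using set_integral_nonneg_mono(1)[OF R_integrable_path(1)[of t0 u \<omega>] R_nonneg order_refl] a by simp
    moreover have "R u \<omega> = R t0 \<omega>
      + (LINT s:{t0..u}|lborel. a * (g s - R s \<omega>) + b * R (s - \<tau>) \<omega>) + I u \<omega>"
      by (rule elim[rule_format]) (use u in simp)
    ultimately show "R u \<omega> \<le> bound T \<omega> + I u \<omega>" unfolding drift_split bound_def by linarith
  qed
qed

lemma delayed_mean_integral:
  "(\<integral>\<^sup>+s\<in>{x..y}. (\<integral>\<^sup>+\<omega>. ennreal (R (s - \<tau>) \<omega>) \<partial>M) \<partial>lborel)
    = (\<integral>\<^sup>+s\<in>{x - \<tau>..y - \<tau>}. (\<integral>\<^sup>+\<omega>. ennreal (R s \<omega>) \<partial>M) \<partial>lborel)"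
proof -
  have "(\<integral>\<^sup>+s\<in>{x - \<tau>..y - \<tau>}. (\<integral>\<^sup>+\<omega>. ennreal (R s \<omega>) \<partial>M) \<partial>lborel)
    = (\<integral>\<^sup>+s. (\<integral>\<^sup>+\<omega>. ennreal (R (- \<tau> + 1 * s) \<omega>) \<partial>M) * indicator {x - \<tau>..y - \<tau>} (- \<tau> + 1 * s) \<partial>lborel)"
    by (subst nn_integral_real_affine[of _ 1 "- \<tau>"]) auto
  also have "\<dots> = (\<integral>\<^sup>+s\<in>{x..y}. (\<integral>\<^sup>+\<omega>. ennreal (R (s - \<tau>) \<omega>) \<partial>M) \<partial>lborel)"
    by (intro nn_integral_cong) (auto simp: indicator_def)
  finally show ?thesis by simp
qed

lemma delayed_measurable[measurable]:
  "(\<lambda>(s, \<omega>). R (s - \<tau>) \<omega>) \<in> borel_measurable (borel \<Otimes>\<^sub>M M)"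
  by measurable

lemma initial_integrable: "integrable M (R t0)"
  using initial_mean R_nonneg by (intro integrableI_nonneg) auto

lemma bound_integrableI:
  assumes "(\<integral>\<^sup>+s\<in>{t0 - \<tau>..T - \<tau>}. (\<integral>\<^sup>+\<omega>. ennreal (R s \<omega>) \<partial>M) \<partial>lborel) < \<infinity>"
  shows "integrable M (bound T)"
proof -
  have "integrable M (\<lambda>\<omega>. LINT s:{t0..T}|lborel. R (s - \<tau>) \<omega>)"
    by (rule expectation_set_integral(1))
      (use assms R_nonneg delayed_measurable delayed_mean_integral in auto)
  then have "integrable M (\<lambda>\<omega>. R t0 \<omega> + a * (LINT s:{t0..T}|lborel. g s)
      + b * (LINT s:{t0..T}|lborel. R (s - \<tau>) \<omega>))"
    using initial_integrable by (intro Bochner_Integration.integrable_add integrable_mult_right) auto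
  moreover have "bound T = (\<lambda>\<omega>. R t0 \<omega> + a * (LINT s:{t0..T}|lborel. g s)
      + b * (LINT s:{t0..T}|lborel. R (s - \<tau>) \<omega>))" by (rule ext) (rule bound_def)
  ultimately show ?thesis by simp
qed

text \<open>
  Because \<open>R\<close> is nonnegative, \<open>I\<close> is bounded below by \<open>- bound T\<close>, which is what makes the
  supermartingale inequality applicable before anything is known about the moments of \<open>R\<close>.
\<close>

lemma mean_le_bound:
  assumes fin: "(\<integral>\<^sup>+s\<in>{t0 - \<tau>..T - \<tau>}. (\<integral>\<^sup>+\<omega>. ennreal (R s \<omega>) \<partial>M) \<partial>lborel) < \<infinity>"
    and t: "t \<in> {t0..T}"
  shows "(\<integral>\<^sup>+\<omega>. ennreal (R t \<omega>) \<partial>M) \<le> ennreal (expectation (bound T))"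
proof -
  have t': "t0 \<le> t" using t by simp
  have "(\<integral>\<^sup>+\<omega>. ennreal (R t \<omega>) \<partial>M) \<le> (\<integral>\<^sup>+\<omega>. ennreal (bound T \<omega> + I t \<omega>) \<partial>M)"
    using R_le_bound[of T] by (intro nn_integral_mono_AE, eventually_elim) (use t in \<open>auto intro: ennreal_leI\<close>)
  also have "\<dots> \<le> ennreal (expectation (bound T))"
  proof (rule ito_integral_supermartingale[OF W ito t' bound_integrableI[OF fin]])
    show "AE \<omega> in M. 0 \<le> bound T \<omega>" using bound_nonneg by simp
    show "AE \<omega> in M. \<forall>u\<in>{t0..t}. 0 \<le> bound T \<omega> + I u \<omega>"
      using R_le_bound[of T]
    proof eventually_elim
      case (elim \<omega>)
      show ?case
      proof
        fix u assume "u \<in> {t0..t}"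
        then have "R u \<omega> \<le> bound T \<omega> + I u \<omega>" using elim t by auto
        then show "0 \<le> bound T \<omega> + I u \<omega>" using R_nonneg[of u \<omega>] by linarith
      qed
    qed
  qed
  finally show ?thesis .
qed

text \<open>
  Induction over delay intervals: the mean up to \<open>T\<close> is controlled by the mean up to \<open>T - \<tau>\<close>. 
\<close>

lemma mean_integral_finite:
  "(\<integral>\<^sup>+s\<in>{t0 - \<tau>..T}. (\<integral>\<^sup>+\<omega>. ennreal (R s \<omega>) \<partial>M) \<partial>lborel) < \<infinity>"
proof -
  let ?N = "\<lambda>s. \<integral>\<^sup>+\<omega>. ennreal (R s \<omega>) \<partial>M"
  have step: "(\<integral>\<^sup>+s\<in>{t0 - \<tau>..t0 + real k * \<tau>}. ?N s \<partial>lborel) < \<infinity>" for k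
  proof (induction k)
    case 0
    then show ?case using initial_segment_mean by simp
  next
    case (Suc k)
    let ?T = "t0 + real (Suc k) * \<tau>"
    have T: "?T - \<tau> = t0 + real k * \<tau>" by (simp add: algebra_simps)
    have le: "?N s \<le> ennreal (expectation (bound ?T))" if "s \<in> {t0..?T}" for s
      by (rule mean_le_bound[OF _ that], unfold T) (rule Suc)
    have "(\<integral>\<^sup>+s\<in>{t0 - \<tau>..?T}. ?N s \<partial>lborel)
        \<le> (\<integral>\<^sup>+s. ?N s * indicator {t0 - \<tau>..t0} s
            + ennreal (expectation (bound ?T)) * indicator {t0..?T} s \<partial>lborel)"
    proof (rule nn_integral_mono)
      fix s
      show "?N s * indicator {t0 - \<tau>..?T} s \<le> ?N s * indicator {t0 - \<tau>..t0} s
            + ennreal (expectation (bound ?T)) * indicator {t0..?T} s"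
        using le[of s] by (auto simp: indicator_def)
    qed
    also have "\<dots> = (\<integral>\<^sup>+s\<in>{t0 - \<tau>..t0}. ?N s \<partial>lborel)
        + ennreal (expectation (bound ?T)) * ennreal (?T - t0)"
      using \<tau> by (simp add: nn_integral_add nn_integral_cmult_indicator)
    also have "\<dots> < \<infinity>" using initial_segment_mean by (simp add: ennreal_mult_less_top)
    finally show ?case .
  qed
  obtain k where "T - t0 < real k * \<tau>" using reals_Archimedean3[OF \<tau>] by blast
  then have "{t0 - \<tau>..T} \<subseteq> {t0 - \<tau>..t0 + real k * \<tau>}" by auto
  then have "(\<integral>\<^sup>+s\<in>{t0 - \<tau>..T}. ?N s \<partial>lborel) \<le> (\<integral>\<^sup>+s\<in>{t0 - \<tau>..t0 + real k * \<tau>}. ?N s \<partial>lborel)"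
    by (intro nn_integral_mono) (auto simp: indicator_def)
  then show ?thesis using step[of k] by (rule order.strict_trans1)
qed

lemma bound_integrable: "integrable M (bound T)"
  by (rule bound_integrableI[OF mean_integral_finite])

lemma mean_integral_finite_from_start:
  "(\<integral>\<^sup>+s\<in>{t0..T}. (\<integral>\<^sup>+\<omega>. ennreal (R s \<omega>) \<partial>M) \<partial>lborel) < \<infinity>"
proof -
  have "(\<integral>\<^sup>+s\<in>{t0..T}. (\<integral>\<^sup>+\<omega>. ennreal (R s \<omega>) \<partial>M) \<partial>lborel)
    \<le> (\<integral>\<^sup>+s\<in>{t0 - \<tau>..T}. (\<integral>\<^sup>+\<omega>. ennreal (R s \<omega>) \<partial>M) \<partial>lborel)"
    using \<tau> by (intro nn_integral_mono) (auto simp: indicator_def)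
  then show ?thesis using mean_integral_finite by (rule order.strict_trans1)
qed

lemmas R_time_mean = expectation_set_integral[OF R_measurable R_nonneg mean_integral_finite_from_start]

lemma R_delayed_time_mean:
  "integrable M (\<lambda>\<omega>. LINT s:{t0..T}|lborel. R (s - \<tau>) \<omega>)"
  "set_integrable lborel {t0..T} (\<lambda>s. expectation (R (s - \<tau>)))"
  "expectation (\<lambda>\<omega>. LINT s:{t0..T}|lborel. R (s - \<tau>) \<omega>)
    = (LINT s:{t0..T}|lborel. expectation (R (s - \<tau>)))"
proof -
  have "(\<integral>\<^sup>+s\<in>{t0..T}. (\<integral>\<^sup>+\<omega>. ennreal (R (s - \<tau>) \<omega>) \<partial>M) \<partial>lborel) < \<infinity>"
    unfolding delayed_mean_integral by (rule mean_integral_finite)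
  from expectation_set_integral[OF delayed_measurable R_nonneg this]
  show "integrable M (\<lambda>\<omega>. LINT s:{t0..T}|lborel. R (s - \<tau>) \<omega>)"
    "set_integrable lborel {t0..T} (\<lambda>s. expectation (R (s - \<tau>)))"
    "expectation (\<lambda>\<omega>. LINT s:{t0..T}|lborel. R (s - \<tau>) \<omega>)
      = (LINT s:{t0..T}|lborel. expectation (R (s - \<tau>)))" .
qed

lemma variation_finite:
  "(\<integral>\<^sup>+\<omega>. ennreal (LINT s:{t0..T}|lborel. (H s \<omega>)\<^sup>2) \<partial>M) < \<infinity>"
proof -
  let ?R = "\<lambda>\<omega>. LINT s:{t0..T}|lborel. R s \<omega>"
  have "AE \<omega> in M. (LINT s:{t0..T}|lborel. (H s \<omega>)\<^sup>2) = \<sigma>\<^sup>2 * ?R \<omega>"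
    using H
  proof eventually_elim
    case (elim \<omega>)
    then have "(LINT s:{t0..T}|lborel. (H s \<omega>)\<^sup>2) = (LINT s:{t0..T}|lborel. \<sigma>\<^sup>2 * R s \<omega>)"
      by (intro set_lebesgue_integral_cong) auto
    then show ?case by simp
  qed
  then have "(\<integral>\<^sup>+\<omega>. ennreal (LINT s:{t0..T}|lborel. (H s \<omega>)\<^sup>2) \<partial>M)
      = (\<integral>\<^sup>+\<omega>. ennreal (\<sigma>\<^sup>2 * ?R \<omega>) \<partial>M)" by (intro nn_integral_cong_AE) auto
  also have "\<dots> < \<infinity>"
  proof -
    have "integrable M (\<lambda>\<omega>. \<sigma>\<^sup>2 * ?R \<omega>)" using R_time_mean(1) by simp
    then have "(\<integral>\<^sup>+\<omega>. ennreal (\<sigma>\<^sup>2 * ?R \<omega>) \<partial>M) \<noteq> \<infinity>" by (rule integrableD(2))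
    then show ?thesis by (simp add: less_top)
  qed
  finally show ?thesis .
qed

text \<open>
  The supremum is at most \<open>bound t\<close> plus the supremum of the Ito integral. Continuity reduces it to
  countably many times, which also settles its measurability.
\<close>

lemma SUP_R_integrable:
  assumes t: "t0 \<le> t"
  shows "integrable M (\<lambda>\<omega>. SUP u\<in>{t0..t}. R u \<omega>)"
proof -
  obtain C where C: "countable C" "C \<subseteq> {t0..t}" "{t0..t} \<subseteq> closure C"
    using separable[of "{t0..t}"] by blast
  let ?S = "\<lambda>\<omega>. SUP u\<in>C. ennreal (R u \<omega>)" and ?J = "\<lambda>\<omega>. SUP u\<in>C. ennreal (I u \<omega>)"
  have SUP_eq: "ennreal (SUP u\<in>{t0..t}. R u \<omega>) = ?S \<omega>" for \<omega>
    using t C(2,3) by (intro ennreal_SUP_dense continuous_on_subset[OF R_continuous]) auto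
  have SUP_nonneg: "0 \<le> (SUP u\<in>{t0..t}. R u \<omega>)" for \<omega>
  proof -
    have "compact ((\<lambda>u. R u \<omega>) ` {t0..t})"
      by (intro compact_continuous_image continuous_on_subset[OF R_continuous]) auto
    then have "bdd_above ((\<lambda>u. R u \<omega>) ` {t0..t})"
      by (intro bounded_imp_bdd_above compact_imp_bounded)
    then have "R t0 \<omega> \<le> (SUP u\<in>{t0..t}. R u \<omega>)" using t by (intro cSUP_upper) auto
    then show ?thesis using R_nonneg[of t0 \<omega>] by linarith
  qed
  have S[measurable]: "?S \<in> borel_measurable M"
    by (intro borel_measurable_SUP C(1)) measurable
  have J[measurable]: "?J \<in> borel_measurable M"
  proof (intro borel_measurable_SUP C(1) measurable_compose[OF _ measurable_ennreal])
    show "I u \<in> borel_measurable M" if "u \<in> C" for u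
      using ito_integral_measurable[OF ito] C(2) that by auto
  qed
  show ?thesis
  proof (rule integrableI_nonneg)
    have "(\<lambda>\<omega>. SUP u\<in>{t0..t}. R u \<omega>) = (\<lambda>\<omega>. enn2real (?S \<omega>))"
      using SUP_nonneg by (simp flip: SUP_eq)
    also have "\<dots> \<in> borel_measurable M" by measurable
    finally show "(\<lambda>\<omega>. SUP u\<in>{t0..t}. R u \<omega>) \<in> borel_measurable M" .
    show "AE \<omega> in M. 0 \<le> (SUP u\<in>{t0..t}. R u \<omega>)" using SUP_nonneg by simp
    have "(\<integral>\<^sup>+\<omega>. ennreal (SUP u\<in>{t0..t}. R u \<omega>) \<partial>M) = (\<integral>\<^sup>+\<omega>. ?S \<omega> \<partial>M)"
      by (simp only: SUP_eq)
    also have "\<dots> \<le> (\<integral>\<^sup>+\<omega>. ennreal (bound t \<omega>) + ?J \<omega> \<partial>M)"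
      using R_le_bound[of t]
    proof (intro nn_integral_mono_AE, eventually_elim)
      case (elim \<omega>)
      show ?case
      proof (rule SUP_least)
        fix u assume u: "u \<in> C"
        then have "ennreal (R u \<omega>) \<le> ennreal (bound t \<omega> + I u \<omega>)"
          using elim C(2) by (intro ennreal_leI) auto
        also have "\<dots> \<le> ennreal (bound t \<omega>) + ennreal (I u \<omega>)"
        proof (cases "0 \<le> I u \<omega>")
          case True
          then show ?thesis using bound_nonneg by (simp add: ennreal_plus)
        next
          case False
          then have "ennreal (bound t \<omega> + I u \<omega>) \<le> ennreal (bound t \<omega>)" by (intro ennreal_leI) simp
          then show ?thesis by (rule order_trans) simp
        qed
        also have "\<dots> \<le> ennreal (bound t \<omega>) + ?J \<omega>" using u by (intro add_left_mono SUP_upper)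
        finally show "ennreal (R u \<omega>) \<le> ennreal (bound t \<omega>) + ?J \<omega>" .
      qed
    qed
    also have "\<dots> = (\<integral>\<^sup>+\<omega>. ennreal (bound t \<omega>) \<partial>M) + (\<integral>\<^sup>+\<omega>. ?J \<omega> \<partial>M)"
      using bound_integrable by (intro nn_integral_add) auto
    also have "\<dots> < \<infinity>"
    proof -
      have "(\<integral>\<^sup>+\<omega>. ennreal (bound t \<omega>) \<partial>M) = ennreal (expectation (bound t))"
        using bound_nonneg by (intro nn_integral_eq_integral bound_integrable) auto
      moreover have "(\<integral>\<^sup>+\<omega>. ?J \<omega> \<partial>M) < \<infinity>"
      proof (rule order.strict_trans1[OF ito_integral_maximal[OF W ito t C(1,2)]])
        let ?A = "\<lambda>\<omega>. LINT s:{t0..t}|lborel. (H s \<omega>)\<^sup>2"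
        have [measurable]: "?A \<in> borel_measurable M"
          using ito by (intro ito_variation_measurable) (simp add: has_ito_integral_def)
        have "0 \<le> ?A \<omega>" for \<omega>
          unfolding set_lebesgue_integral_def by (intro integral_nonneg_AE) auto
        then have "(\<integral>\<^sup>+\<omega>. ennreal (2 * ?A \<omega> + 2) \<partial>M) = 2 * (\<integral>\<^sup>+\<omega>. ennreal (?A \<omega>) \<partial>M) + 2"
          by (simp add: ennreal_plus ennreal_mult nn_integral_add nn_integral_cmult emeasure_space_1)
        then show "2 + 4 * ((\<integral>\<^sup>+\<omega>. ennreal (2 * ?A \<omega> + 2) \<partial>M) + 1) < \<infinity>"
          using variation_finite[of t] by (simp add: ennreal_mult_less_top)
      qed
      ultimately show ?thesis by simp
    qed
    finally show "(\<integral>\<^sup>+\<omega>. ennreal (SUP u\<in>{t0..t}. R u \<omega>) \<partial>M) < \<infinity>" .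
  qed
qed

definition mean_drift :: "real \<Rightarrow> real" where
  "mean_drift s = a * (g s - expectation (R s)) + b * expectation (R (s - \<tau>))"

lemma mean_drift_integrable: "set_integrable lborel {t0..T} mean_drift"
proof -
  have "set_integrable lborel {t0..T} (\<lambda>s. a * (g s - expectation (R s)) + b * expectation (R (s - \<tau>)))"
    using g_integrable[of T] R_time_mean(2)[of T] R_delayed_time_mean(2)[of T]
    by (intro set_integral_add(1) set_integrable_mult_right set_integral_diff(1))
  then show ?thesis by (simp add: mean_drift_def[abs_def])
qed

text \<open>
  The variation has finite mean by now, so the Ito integral is a true martingale and drops out
  on taking expectations.
\<close>

lemma mean_equation:
  assumes t: "t0 \<le> t"
  shows "expectation (R t) = expectation (R t0) + (LINT s:{t0..t}|lborel. mean_drift s)"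
proof -
  note I = ito_integral_martingale[OF W ito t variation_finite]
  let ?D = "\<lambda>\<omega>. LINT s:{t0..t}|lborel. a * (g s - R s \<omega>) + b * R (s - \<tau>) \<omega>"
  have D: "integrable M ?D"
    unfolding drift_split using R_time_mean(1)[of t] R_delayed_time_mean(1)[of t] by simp
  have ED: "expectation ?D = a * (LINT s:{t0..t}|lborel. g s)
      - a * (LINT s:{t0..t}|lborel. expectation (R s))
      + b * (LINT s:{t0..t}|lborel. expectation (R (s - \<tau>)))"
    unfolding drift_split using R_time_mean(1,3)[of t] R_delayed_time_mean(1,3)[of t]
    by (simp add: prob_space)
  also have "\<dots> = (LINT s:{t0..t}|lborel. mean_drift s)"
    unfolding mean_drift_def
    using g_integrable[of t] R_time_mean(2)[of t] R_delayed_time_mean(2)[of t]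
    by (simp add: set_integral_add set_integral_diff right_diff_distrib set_integral_mult_right
        set_integrable_mult_right)
  finally have ED: "expectation ?D = (LINT s:{t0..t}|lborel. mean_drift s)" .
  have "expectation (R t) = expectation (\<lambda>\<omega>. R t0 \<omega> + ?D \<omega> + I t \<omega>)"
  proof (rule integral_cong_AE)
    show "AE \<omega> in M. R t \<omega> = R t0 \<omega> + ?D \<omega> + I t \<omega>"
      using equation by eventually_elim (erule allE, erule mp, rule t)
    show "(\<lambda>\<omega>. R t0 \<omega> + ?D \<omega> + I t \<omega>) \<in> borel_measurable M"
      using D I(1) by (intro borel_measurable_add) auto
  qed measurable
  also have "\<dots> = expectation (R t0) + expectation ?D + expectation (I t)"
    using D I(1) initial_integrable by simp
  finally show ?thesis using ED I(2) by simp
qed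

lemma mean_formula:
  assumes t1: "t0 \<le> t1" and t: "t1 \<le> t"
  shows "set_integrable lborel {t1..t}
      (\<lambda>u. exp (- a * (t - u)) * (a * g u + b * expectation (R (u - \<tau>))))"
    and "expectation (R t) = exp (- a * (t - t1)) * expectation (R t1)
      + (LINT u:{t1..t}|lborel. exp (- a * (t - u)) * (a * g u + b * expectation (R (u - \<tau>))))"
proof -
  have int: "set_integrable lborel {t1..t} mean_drift"
    using t1 by (intro set_integrable_subset[OF mean_drift_integrable[of t]]) auto
  have eq: "expectation (R s) = expectation (R t1) + (LINT u:{t1..s}|lborel. mean_drift u)"
    if "s \<in> {t1..t}" for s
    using mean_equation[of s] mean_equation[of t1] that t1
      set_integral_split[OF mean_drift_integrable[of s], of t1] by auto
  have drift: "mean_drift u + a * expectation (R u) = a * g u + b * expectation (R (u - \<tau>))" for u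
    by (simp add: mean_drift_def algebra_simps)
  note * = variation_of_constants[where m = "\<lambda>s. expectation (R s)", OF a t int eq]
  show "set_integrable lborel {t1..t}
      (\<lambda>u. exp (- a * (t - u)) * (a * g u + b * expectation (R (u - \<tau>))))"
    using *(1) unfolding drift .
  show "expectation (R t) = exp (- a * (t - t1)) * expectation (R t1)
      + (LINT u:{t1..t}|lborel. exp (- a * (t - u)) * (a * g u + b * expectation (R (u - \<tau>))))"
    using *(2) unfolding drift .
qed

end

theorem proposition2:
  fixes M :: "'a measure" and F :: "real \<Rightarrow> 'a measure"
    and W r0 r :: "real \<Rightarrow> 'a \<Rightarrow> real" and \<gamma> :: "real \<Rightarrow> real"
    and t0 \<tau> a b \<sigma> :: real
  assumes "0 < \<tau>"
    and "stochastic_basis M F t0"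
    and "brownian_motion M F t0 W"
    and "0 < a" and "0 < \<sigma>" and "0 \<le> b"
    and "initial_segment M F t0 \<tau> r0"
    and "mean_level t0 \<gamma>"
    and "fixed_delay_CIR M F t0 \<tau> W a b \<sigma> \<gamma> r0 r"
    and "(\<integral>\<^sup>+u\<in>{t0-\<tau>..t0}. (\<integral>\<^sup>+\<omega>. ennreal (r0 u \<omega>) \<partial>M) \<partial>lborel) < \<infinity>"
    and "(\<integral>\<^sup>+\<omega>. ennreal (r0 t0 \<omega>) \<partial>M) < \<infinity>"
  shows "(\<forall>t\<ge>t0. integrable M (\<lambda>\<omega>. SUP u\<in>{t0..t}. r u \<omega>)) \<and>
    (\<forall>t1\<ge>t0. \<forall>t\<ge>t1.
       set_integrable lborel {t1..t}
         (\<lambda>u. exp (- a * (t - u)) * (a * \<gamma> u + b * (\<integral>\<omega>. r (u - \<tau>) \<omega> \<partial>M))) \<and>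
       (\<integral>\<omega>. r t \<omega> \<partial>M) = exp (- a * (t - t1)) * (\<integral>\<omega>. r t1 \<omega> \<partial>M)
         + (LINT u:{t1..t}|lborel.
              exp (- a * (t - u)) * (a * \<gamma> u + b * (\<integral>\<omega>. r (u - \<tau>) \<omega> \<partial>M))))"
proof -
  interpret stochastic_basis M F t0 by fact
  have "continuous_adapted M F t0 r" and r_nonneg: "AE \<omega> in M. \<forall>t\<ge>t0. 0 \<le> r t \<omega>"
    and r_initial: "AE \<omega> in M. \<forall>t\<in>{t0-\<tau>..t0}. r t \<omega> = r0 t \<omega>"
    and "\<exists>I. has_ito_integral M F t0 W (\<lambda>t \<omega>. \<sigma> * sqrt (r t \<omega>)) I \<and>
      (AE \<omega> in M. \<forall>t\<ge>t0. r t \<omega> = r t0 \<omega>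
        + (LINT s:{t0..t}|lborel. a * (\<gamma> s - r s \<omega>) + b * r (s - \<tau>) \<omega>) + I t \<omega>)"
    using assms(9) unfolding fixed_delay_CIR_def by blast+
  then obtain I where ito: "has_ito_integral M F t0 W (\<lambda>t \<omega>. \<sigma> * sqrt (r t \<omega>)) I"
    and r_eq: "AE \<omega> in M. \<forall>t\<ge>t0. r t \<omega> = r t0 \<omega>
        + (LINT s:{t0..t}|lborel. a * (\<gamma> s - r s \<omega>) + b * r (s - \<tau>) \<omega>) + I t \<omega>"
    and r_adapted: "\<And>t. t0 \<le> t \<Longrightarrow> r t \<in> borel_measurable (F t)"
    and r_cont: "AE \<omega> in M. continuous_on {t0..} (\<lambda>t. r t \<omega>)"
    unfolding continuous_adapted_def by blast
  have r0_meas: "\<And>t. t \<in> {t0-\<tau>..t0} \<Longrightarrow> r0 t \<in> borel_measurable (F t0)"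
    and r0_cont: "AE \<omega> in M. continuous_on {t0-\<tau>..t0} (\<lambda>t. r0 t \<omega>)"
    and r0_pos: "AE \<omega> in M. \<forall>t\<in>{t0-\<tau>..t0}. 0 < r0 t \<omega>"
    using assms(7) unfolding initial_segment_def by blast+
  have r_meas: "r t \<in> borel_measurable M" if "t0 - \<tau> \<le> t" for t
  proof (cases "t0 \<le> t")
    case True
    then show ?thesis using r_adapted measurable_F_M by blast
  next
    case False
    then have t: "t \<in> {t0-\<tau>..t0}" using that by simp
    show ?thesis
    proof (rule measurable_AE_cong)
      show "r0 t \<in> borel_measurable M" using r0_meas[OF t] measurable_F_M by blast
      show "AE \<omega> in M. r t \<omega> = r0 t \<omega>" using r_initial by eventually_elim (use t in blast)
    qed simp
  qed
  have "AE \<omega> in M. continuous_on {t0 - \<tau>..} (\<lambda>t. r t \<omega>)"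
    using r_initial r_cont r0_cont
  proof eventually_elim
    case (elim \<omega>)
    have "continuous_on {t0 - \<tau>..t0} (\<lambda>t. r t \<omega>)"
      using elim(3) by (rule continuous_on_eq) (use elim(1) in auto)
    then have "continuous_on ({t0 - \<tau>..t0} \<union> {t0..}) (\<lambda>t. r t \<omega>)"
      using elim(2) by (intro continuous_on_closed_Un) auto
    moreover have "{t0 - \<tau>..t0} \<union> {t0..} = {t0 - \<tau>..}" using \<open>0 < \<tau>\<close> by auto
    ultimately show ?case by simp
  qed
  from continuous_version[OF r_meas this]
  obtain Y where Y[measurable]: "(\<lambda>(t, \<omega>). Y t \<omega>) \<in> borel_measurable (borel \<Otimes>\<^sub>M M)"
    and Y_cont: "\<And>\<omega>. continuous_on UNIV (\<lambda>t. Y t \<omega>)"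
    and rY: "AE \<omega> in M. \<forall>t\<ge>t0 - \<tau>. r t \<omega> = Y t \<omega>" by blast
  \<comment> \<open>The continuous version is nonnegative only almost surely; its absolute value is so everywhere.\<close>
  define R where "R = (\<lambda>t \<omega>. \<bar>Y t \<omega>\<bar>)"
  have rR: "AE \<omega> in M. \<forall>t\<ge>t0 - \<tau>. r t \<omega> = R t \<omega>"
    using rY r_nonneg r_initial r0_pos
  proof eventually_elim
    case (elim \<omega>)
    have "0 \<le> r t \<omega>" if "t0 - \<tau> \<le> t" for t
    proof (cases "t0 \<le> t")
      case True
      then show ?thesis using elim(2) by blast
    next
      case False
      then have "t \<in> {t0-\<tau>..t0}" using that by simp
      then have "r t \<omega> = r0 t \<omega>" "0 < r0 t \<omega>" using elim(3,4) by blast+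
      then show ?thesis by simp
    qed
    then show ?case using elim(1) by (simp add: R_def)
  qed
  have R_meas: "(\<lambda>(t, \<omega>). R t \<omega>) \<in> borel_measurable (borel \<Otimes>\<^sub>M M)" unfolding R_def by measurable
  then have R_meas1: "R t \<in> borel_measurable M" for t
    using measurable_compose_Pair1[OF _ R_meas, of t] by simp
  have rR1: "AE \<omega> in M. r t \<omega> = R t \<omega>" if "t0 - \<tau> \<le> t" for t
    using rR by eventually_elim (use that in blast)
  have E_rR: "(\<integral>\<omega>. r t \<omega> \<partial>M) = expectation (R t)" if "t0 - \<tau> \<le> t" for t
    using rR1[OF that] r_meas[OF that] R_meas1 by (intro integral_cong_AE)
  have N_rR: "(\<integral>\<^sup>+\<omega>. ennreal (R t \<omega>) \<partial>M) = (\<integral>\<^sup>+\<omega>. ennreal (r0 t \<omega>) \<partial>M)" if "t \<in> {t0-\<tau>..t0}" for t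
  proof (rule nn_integral_cong_AE)
    have "t0 - \<tau> \<le> t" using that by simp
    from rR1[OF this] r_initial show "AE \<omega> in M. ennreal (R t \<omega>) = ennreal (r0 t \<omega>)"
      by eventually_elim (use that in auto)
  qed
  define g where "g = (\<lambda>s. indicator {t0..} s * \<gamma> s)"
  have g\<gamma>: "g s = \<gamma> s" if "t0 \<le> s" for s using that by (simp add: g_def)
  have g_meas[measurable]: "g \<in> borel_measurable borel"
  proof -
    have "\<gamma> \<in> borel_measurable (restrict_space borel {t0..})"
      using assms(8) by (simp add: mean_level_def)
    then show ?thesis
      by (subst (asm) borel_measurable_restrict_space_iff) (auto simp: g_def)
  qed
  interpret C: regular_delay_CIR M F t0 W "\<lambda>t \<omega>. \<sigma> * sqrt (r t \<omega>)" I R g \<tau> a b \<sigma>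
  proof
    show "brownian_motion M F t0 W" by fact
    show "has_ito_integral M F t0 W (\<lambda>t \<omega>. \<sigma> * sqrt (r t \<omega>)) I" by fact
    show "(\<lambda>(t, \<omega>). R t \<omega>) \<in> borel_measurable (borel \<Otimes>\<^sub>M M)" by fact
    show "0 \<le> R s \<omega>" for s \<omega> by (simp add: R_def)
    show "continuous_on UNIV (\<lambda>s. R s \<omega>)" for \<omega>
      unfolding R_def by (intro continuous_intros Y_cont)
    show "AE \<omega> in M. \<forall>s\<ge>t0. (\<sigma> * sqrt (r s \<omega>))\<^sup>2 = \<sigma>\<^sup>2 * R s \<omega>"
      using rR
    proof eventually_elim
      case (elim \<omega>)
      show ?case
      proof (intro allI impI)
        fix s assume "t0 \<le> s"
        then have "t0 - \<tau> \<le> s" using \<open>0 < \<tau>\<close> by simp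
        then have "r s \<omega> = R s \<omega>" using elim by blast
        then show "(\<sigma> * sqrt (r s \<omega>))\<^sup>2 = \<sigma>\<^sup>2 * R s \<omega>" by (simp add: power_mult_distrib R_def)
      qed
    qed
    show "0 \<le> g s" for s
      using assms(8) by (auto simp: g_def mean_level_def indicator_def intro: less_imp_le)
    show "set_integrable lborel {t0..T} g" for T
    proof (cases "t0 \<le> T")
      case True
      then have "bounded (\<gamma> ` {t0..T})" using assms(8) by (simp add: mean_level_def)
      then obtain B where B: "\<And>s. s \<in> {t0..T} \<Longrightarrow> \<bar>\<gamma> s\<bar> \<le> B"
        unfolding bounded_iff real_norm_def by blast
      show ?thesis unfolding set_integrable_def
      proof (rule Bochner_Integration.integrable_bound[where f = "\<lambda>s. B * indicator {t0..T} s"])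
        show "integrable lborel (\<lambda>s. B * indicator {t0..T} s)"
          by (intro integrable_mult_right integrable_real_indicator) (auto simp: emeasure_lborel_Icc_eq)
        show "(\<lambda>s. indicator {t0..T} s *\<^sub>R g s) \<in> borel_measurable lborel" by measurable
        show "AE s in lborel. norm (indicator {t0..T} s *\<^sub>R g s) \<le> norm (B * indicator {t0..T} s)"
          using B by (intro AE_I2) (force simp: indicator_def g_def)
      qed
    qed (simp add: set_integrable_def)
    show "0 < \<tau>" "0 < a" "0 \<le> b" by fact+
    show "AE \<omega> in M. \<forall>t\<ge>t0. R t \<omega> = R t0 \<omega>
        + (LINT s:{t0..t}|lborel. a * (g s - R s \<omega>) + b * R (s - \<tau>) \<omega>) + I t \<omega>"
      using r_eq rR
    proof eventually_elim
      case (elim \<omega>)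
      show ?case
      proof (intro allI impI)
        fix t assume t: "t0 \<le> t"
        have R: "R s \<omega> = r s \<omega>" if "t0 - \<tau> \<le> s" for s using elim(2) that by simp
        have "(LINT s:{t0..t}|lborel. a * (g s - R s \<omega>) + b * R (s - \<tau>) \<omega>)
            = (LINT s:{t0..t}|lborel. a * (\<gamma> s - r s \<omega>) + b * r (s - \<tau>) \<omega>)"
          using R g\<gamma> \<open>0 < \<tau>\<close> by (intro set_lebesgue_integral_cong) auto
        moreover have "R t \<omega> = r t \<omega>" "R t0 \<omega> = r t0 \<omega>" using R t \<open>0 < \<tau>\<close> by auto
        moreover have "r t \<omega> = r t0 \<omega>
            + (LINT s:{t0..t}|lborel. a * (\<gamma> s - r s \<omega>) + b * r (s - \<tau>) \<omega>) + I t \<omega>"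
          using elim(1) t by blast
        ultimately show "R t \<omega> = R t0 \<omega>
            + (LINT s:{t0..t}|lborel. a * (g s - R s \<omega>) + b * R (s - \<tau>) \<omega>) + I t \<omega>"
          by (simp only:)
      qed
    qed
    have "(\<integral>\<^sup>+u\<in>{t0-\<tau>..t0}. (\<integral>\<^sup>+\<omega>. ennreal (R u \<omega>) \<partial>M) \<partial>lborel)
        = (\<integral>\<^sup>+u\<in>{t0-\<tau>..t0}. (\<integral>\<^sup>+\<omega>. ennreal (r0 u \<omega>) \<partial>M) \<partial>lborel)"
      by (intro nn_integral_cong) (simp add: indicator_def N_rR)
    then show "(\<integral>\<^sup>+u\<in>{t0-\<tau>..t0}. (\<integral>\<^sup>+\<omega>. ennreal (R u \<omega>) \<partial>M) \<partial>lborel) < \<infinity>"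
      using assms(10) by (simp only:)
    show "(\<integral>\<^sup>+\<omega>. ennreal (R t0 \<omega>) \<partial>M) < \<infinity>"
      using assms(11) N_rR[of t0] \<open>0 < \<tau>\<close> by simp
  qed
  show ?thesis
  proof (intro conjI allI impI)
    fix t assume t: "t0 \<le> t"
    have eq: "AE \<omega> in M. (SUP u\<in>{t0..t}. r u \<omega>) = (SUP u\<in>{t0..t}. R u \<omega>)"
      using rR
    proof eventually_elim
      case (elim \<omega>)
      show ?case by (rule SUP_cong) (use elim \<open>0 < \<tau>\<close> in auto)
    qed
    have S: "integrable M (\<lambda>\<omega>. SUP u\<in>{t0..t}. R u \<omega>)" by (rule C.SUP_R_integrable[OF t])
    show "integrable M (\<lambda>\<omega>. SUP u\<in>{t0..t}. r u \<omega>)"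
    proof (subst integrable_cong_AE[OF _ _ eq])
      show "(\<lambda>\<omega>. SUP u\<in>{t0..t}. R u \<omega>) \<in> borel_measurable M" using S by simp
      then show "(\<lambda>\<omega>. SUP u\<in>{t0..t}. r u \<omega>) \<in> borel_measurable M"
        using eq by (rule measurable_AE_cong) simp
    qed (rule S)
  next
    fix t1 t assume t: "t0 \<le> t1" "t1 \<le> t"
    have eq: "exp (- a * (t - u)) * (a * g u + b * expectation (R (u - \<tau>)))
        = exp (- a * (t - u)) * (a * \<gamma> u + b * (\<integral>\<omega>. r (u - \<tau>) \<omega> \<partial>M))" if "u \<in> {t1..t}" for u
      using that t g\<gamma>[of u] E_rR[of "u - \<tau>"] by simp
    have "set_integrable lborel {t1..t}
        (\<lambda>u. exp (- a * (t - u)) * (a * g u + b * expectation (R (u - \<tau>))))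
      \<longleftrightarrow> set_integrable lborel {t1..t}
        (\<lambda>u. exp (- a * (t - u)) * (a * \<gamma> u + b * (\<integral>\<omega>. r (u - \<tau>) \<omega> \<partial>M)))"
      using eq by (intro set_integrable_cong) auto
    then show "set_integrable lborel {t1..t}
        (\<lambda>u. exp (- a * (t - u)) * (a * \<gamma> u + b * (\<integral>\<omega>. r (u - \<tau>) \<omega> \<partial>M)))"
      using C.mean_formula(1)[OF t] by (simp only:)
    have "(LINT u:{t1..t}|lborel. exp (- a * (t - u)) * (a * g u + b * expectation (R (u - \<tau>))))
      = (LINT u:{t1..t}|lborel. exp (- a * (t - u)) * (a * \<gamma> u + b * (\<integral>\<omega>. r (u - \<tau>) \<omega> \<partial>M)))"
      using eq by (intro set_lebesgue_integral_cong) auto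
    moreover have "(\<integral>\<omega>. r t \<omega> \<partial>M) = expectation (R t)" "(\<integral>\<omega>. r t1 \<omega> \<partial>M) = expectation (R t1)"
      using E_rR t \<open>0 < \<tau>\<close> by auto
    ultimately show "(\<integral>\<omega>. r t \<omega> \<partial>M) = exp (- a * (t - t1)) * (\<integral>\<omega>. r t1 \<omega> \<partial>M)
        + (LINT u:{t1..t}|lborel.
            exp (- a * (t - u)) * (a * \<gamma> u + b * (\<integral>\<omega>. r (u - \<tau>) \<omega> \<partial>M)))"
      using C.mean_formula(2)[OF t] by (simp only:)
  qed
qed

end
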